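(* Let $e>1$ and $s_1,\dots,s_\ell$ be integers. Let $q=\exp(2\pi\sqrt{-1}/e)$ and $Q_i=q^{s_i}$ for $1\le i\le \ell$. A representation of the cyclotomic Hecke algebra $\mathcal{H}_{q,Q_1,\dots,Q_\ell}(n)$ over $\mathbb{C}$ is unitary if and only if it is calibrated.
   Context: The extended affine braid group $B^{ea}_n$ is generated by $T_1,\dots,T_{n-1},x_1,\dots,x_n$ subject to: $T_iT_{i+1}T_i=T_{i+1}T_iT_{i+1}$; $T_iT_j=T_jT_i$ if $|i-j|>1$; $x_ix_j=x_jx_i$; $T_ix_iT_i=x_{i+1}$; $T_ix_j=x_jT_i$ if $j\ne i,i+1$. For $q\in\mathbb{C}^\times$, the affine Hecke algebra $\mathcal{H}^{\mathsf{aff}}_q(n)$ is the quotient of the group algebra $\mathbb{C}B^{ea}_n$ by the relations $(T_i-q)(T_i+1)=0$ for $1\le i\le n-1$. Put $X_i=q^{1-i}x_i$, so that $T_iX_iT_i=qX_{i+1}$. The cyclotomic Hecke algebra is $\mathcal{H}_{q,Q_1,\dots,Q_\ell}(n)=\mathcal{H}^{\mathsf{aff}}_q(n)/\big(\prod_{i=1}^\ell(X_1-Q_i)\big)$, the quotient by the two-sided ideal generated by the product. Representations of it are regarded as representations of $\mathcal{H}^{\mathsf{aff}}_q(n)$, and hence of the group $B^{ea}_n$. A finite-dimensional representation is called unitary if it admits a positive-definite $B^{ea}_n$-invariant Hermitian form, i.e. one with $\langle gm,gm'\rangle=\langle m,m'\rangle$ for all $g\in B^{ea}_n$ and all vectors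 $m,m'$. A representation is called calibrated if the Jucys–Murphy subalgebra, generated by $X_1^{\pm1},\dots,X_n^{\pm1}$, acts semisimply on it.
   Formalization: That calibrated implies unitary is stated only for completely reducible representations; it fails otherwise: for n=2, Q=(1,q), X_1=diag(1,q), T_1 with rows (q,0),(1,-1) is calibrated but not unitary. That unitary implies calibrated is stated for all finite-dimensional representations. *)

theory Defs
  imports
    Complex_Main
    "HOL-Algebra.QuotRing"
    "HOL-Algebra.Generated_Rings"
    "HOL-Algebra.Module"
begin

section \<open>Groups given by generators and relations\<close>

text \<open>A letter \<open>(s, True)\<close> stands for the generator \<open>s\<close>, and \<open>(s, False)\<close> for its inverse.
  A relation is a pair of words in the letters over \<open>S\<close>.\<close>

type_synonym 'a word = "('a \<times> bool) list"

definition words :: "'a set \<Rightarrow> 'a word set" where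
  "words S = lists (S \<times> UNIV)"

inductive_set word_eq :: "'a set \<Rightarrow> ('a word \<times> 'a word) set \<Rightarrow> ('a word \<times> 'a word) set"
  for S R where
    refl: "w \<in> words S \<Longrightarrow> (w, w) \<in> word_eq S R"
  | sym: "(v, w) \<in> word_eq S R \<Longrightarrow> (w, v) \<in> word_eq S R"
  | trans: "(u, v) \<in> word_eq S R \<Longrightarrow> (v, w) \<in> word_eq S R \<Longrightarrow> (u, w) \<in> word_eq S R"
  | cancel: "u \<in> words S \<Longrightarrow> v \<in> words S \<Longrightarrow> s \<in> S \<Longrightarrow>
      (u @ [(s, b), (s, \<not> b)] @ v, u @ v) \<in> word_eq S R"
  | relation: "u \<in> words S \<Longrightarrow> v \<in> words S \<Longrightarrow> (l, r) \<in> R \<Longrightarrow>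
      (u @ l @ v, u @ r @ v) \<in> word_eq S R"

definition presented_group :: "'a set \<Rightarrow> ('a word \<times> 'a word) set \<Rightarrow> 'a word set monoid" where
  "presented_group S R =
    \<lparr>carrier = words S // word_eq S R,
     mult = (\<lambda>A B. \<Union>u\<in>A. \<Union>v\<in>B. word_eq S R `` {u @ v}),
     one = word_eq S R `` {[]}\<rparr>"

section \<open>Algebras over the complex numbers\<close>

text \<open>Complex algebras, not necessarily commutative, are presented as records of type
  \<open>module\<close>: the ring structure together with the scalar multiplication \<open>\<odot>\<close>.\<close>

type_synonym 'a calgebra = "(complex, 'a) module"

definition group_algebra :: "('g, 'b) monoid_scheme \<Rightarrow> ('g \<Rightarrow> complex) calgebra" where
  "group_algebra G =
    \<lparr>carrier = {f. finite {g. f g \<noteq> 0} \<and> {g. f g \<noteq> 0} \<subseteq> carrier G},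
     mult = (\<lambda>f h g. \<Sum>a\<in>{a. f a \<noteq> 0}. \<Sum>b\<in>{b. h b \<noteq> 0}.
       if a \<otimes>\<^bsub>G\<^esub> b = g then f a * h b else 0),
     one = (\<lambda>g. if g = \<one>\<^bsub>G\<^esub> then 1 else 0),
     zero = (\<lambda>g. 0),
     add = (\<lambda>f h g. f g + h g),
     smult = (\<lambda>c f g. c * f g)\<rparr>"

definition group_elem :: "'g \<Rightarrow> 'g \<Rightarrow> complex" where
  "group_elem a = (\<lambda>g. if g = a then 1 else 0)"

definition quot_algebra :: "'a calgebra \<Rightarrow> 'a set \<Rightarrow> 'a set calgebra" where
  "quot_algebra A I =
    \<lparr>carrier = carrier (A Quot I),
     mult = mult (A Quot I),
     one = one (A Quot I),
     zero = zero (A Quot I),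
     add = add (A Quot I),
     smult = (\<lambda>c C. \<Union>a\<in>C. I +>\<^bsub>A\<^esub> (c \<odot>\<^bsub>A\<^esub> a))\<rparr>"

definition generated_subalgebra :: "'a calgebra \<Rightarrow> 'a set \<Rightarrow> 'a set" where
  "generated_subalgebra A S = generate_ring A (S \<union> {c \<odot>\<^bsub>A\<^esub> \<one>\<^bsub>A\<^esub> | c. True})"

definition End_algebra :: "(complex \<Rightarrow> 'v::ab_group_add \<Rightarrow> 'v) \<Rightarrow> ('v \<Rightarrow> 'v) calgebra" where
  "End_algebra scale =
    \<lparr>carrier = {f. Vector_Spaces.linear scale scale f},
     mult = (\<lambda>f g. f \<circ> g),
     one = id,
     zero = (\<lambda>v. 0),
     add = (\<lambda>f g v. f v + g v),
     smult = (\<lambda>c f v. scale c (f v))\<rparr>"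

definition algebra_representation ::
    "'a calgebra \<Rightarrow> (complex \<Rightarrow> 'v::ab_group_add \<Rightarrow> 'v) \<Rightarrow> ('a \<Rightarrow> 'v \<Rightarrow> 'v) \<Rightarrow> bool" where
  "algebra_representation A scale \<rho> \<longleftrightarrow>
    \<rho> \<in> ring_hom A (End_algebra scale) \<and>
    (\<forall>c. \<forall>a\<in>carrier A. \<rho> (c \<odot>\<^bsub>A\<^esub> a) = c \<odot>\<^bsub>End_algebra scale\<^esub> \<rho> a)"

section \<open>The extended affine braid group\<close>

datatype braid_gen = TGen nat | XGen nat

definition T_word :: "nat \<Rightarrow> braid_gen word" where
  "T_word i = [(TGen i, True)]"

definition x_word :: "nat \<Rightarrow> braid_gen word" where
  "x_word i = [(XGen i, True)]"

definition braid_gens :: "nat \<Rightarrow> braid_gen set" where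
  "braid_gens n = TGen ` {1..<n} \<union> XGen ` {1..n}"

definition braid_relations :: "nat \<Rightarrow> (braid_gen word \<times> braid_gen word) set" where
  "braid_relations n =
    {(T_word i @ T_word (i+1) @ T_word i, T_word (i+1) @ T_word i @ T_word (i+1)) | i.
       1 \<le> i \<and> i + 1 < n} \<union>
    {(T_word i @ T_word j, T_word j @ T_word i) | i j.
       i \<in> {1..<n} \<and> j \<in> {1..<n} \<and> \<bar>int i - int j\<bar> > 1} \<union>
    {(x_word i @ x_word j, x_word j @ x_word i) | i j.
       i \<in> {1..n} \<and> j \<in> {1..n}} \<union>
    {(T_word i @ x_word i @ T_word i, x_word (i+1)) | i.
       i \<in> {1..<n}} \<union>
    {(T_word i @ x_word j, x_word j @ T_word i) | i j.
       i \<in> {1..<n} \<and> j \<in> {1..n} \<and> j \<noteq> i \<and> j \<noteq> i + 1}"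

definition braid_group :: "nat \<Rightarrow> braid_gen word set monoid" where
  "braid_group n = presented_group (braid_gens n) (braid_relations n)"

definition braid_class :: "nat \<Rightarrow> braid_gen word \<Rightarrow> braid_gen word set" where
  "braid_class n w = word_eq (braid_gens n) (braid_relations n) `` {w}"

section \<open>Affine and cyclotomic Hecke algebras\<close>

type_synonym braid_alg = "braid_gen word set \<Rightarrow> complex"

definition braid_algebra :: "nat \<Rightarrow> braid_alg calgebra" where
  "braid_algebra n = group_algebra (braid_group n)"

definition hecke_relators :: "complex \<Rightarrow> nat \<Rightarrow> braid_alg set" where
  "hecke_relators q n =
    (let A = braid_algebra n; T = (\<lambda>i. group_elem (braid_class n (T_word i))) in
     {(T i \<ominus>\<^bsub>A\<^esub> q \<odot>\<^bsub>A\<^esub> \<one>\<^bsub>A\<^esub>) \<otimes>\<^bsub>A\<^esub> (T i \<oplus>\<^bsub>A\<^esub> \<one>\<^bsub>A\<^esub>) | i. i \<in> {1..<n}})"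

definition hecke_ideal :: "complex \<Rightarrow> nat \<Rightarrow> braid_alg set" where
  "hecke_ideal q n = genideal (braid_algebra n) (hecke_relators q n)"

definition affine_hecke :: "complex \<Rightarrow> nat \<Rightarrow> braid_alg set calgebra" where
  "affine_hecke q n = quot_algebra (braid_algebra n) (hecke_ideal q n)"

definition braid_to_affine :: "complex \<Rightarrow> nat \<Rightarrow> braid_gen word set \<Rightarrow> braid_alg set" where
  "braid_to_affine q n g = hecke_ideal q n +>\<^bsub>braid_algebra n\<^esub> group_elem g"

definition X_elem :: "complex \<Rightarrow> nat \<Rightarrow> nat \<Rightarrow> braid_alg set" where
  "X_elem q n i =
    (q powi (1 - int i)) \<odot>\<^bsub>affine_hecke q n\<^esub> braid_to_affine q n (braid_class n (x_word i))"

definition cyclotomic_relator :: "complex \<Rightarrow> complex list \<Rightarrow> nat \<Rightarrow> braid_alg set" where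
  "cyclotomic_relator q Qs n =
    (let H = affine_hecke q n in
     foldr (\<lambda>Q a. (X_elem q n 1 \<ominus>\<^bsub>H\<^esub> Q \<odot>\<^bsub>H\<^esub> \<one>\<^bsub>H\<^esub>) \<otimes>\<^bsub>H\<^esub> a) Qs \<one>\<^bsub>H\<^esub>)"

definition cyclotomic_ideal :: "complex \<Rightarrow> complex list \<Rightarrow> nat \<Rightarrow> braid_alg set set" where
  "cyclotomic_ideal q Qs n = genideal (affine_hecke q n) {cyclotomic_relator q Qs n}"

definition cyclotomic_hecke :: "complex \<Rightarrow> complex list \<Rightarrow> nat \<Rightarrow> braid_alg set set calgebra" where
  "cyclotomic_hecke q Qs n = quot_algebra (affine_hecke q n) (cyclotomic_ideal q Qs n)"

text \<open>Pulling a representation of the cyclotomic Hecke algebra back to the affine Hecke algebra,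
  and a representation of the affine Hecke algebra back to the braid group.\<close>

definition to_affine_rep ::
    "complex \<Rightarrow> complex list \<Rightarrow> nat \<Rightarrow> (braid_alg set set \<Rightarrow> 'v \<Rightarrow> 'v) \<Rightarrow> braid_alg set \<Rightarrow> 'v \<Rightarrow> 'v" where
  "to_affine_rep q Qs n \<rho> a = \<rho> (cyclotomic_ideal q Qs n +>\<^bsub>affine_hecke q n\<^esub> a)"

definition to_braid_rep ::
    "complex \<Rightarrow> nat \<Rightarrow> (braid_alg set \<Rightarrow> 'v \<Rightarrow> 'v) \<Rightarrow> braid_gen word set \<Rightarrow> 'v \<Rightarrow> 'v" where
  "to_braid_rep q n \<sigma> g = \<sigma> (braid_to_affine q n g)"

section \<open>Unitary and calibrated representations\<close>

definition pos_def_hermitian ::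
    "(complex \<Rightarrow> 'v::ab_group_add \<Rightarrow> 'v) \<Rightarrow> ('v \<Rightarrow> 'v \<Rightarrow> complex) \<Rightarrow> bool" where
  "pos_def_hermitian scale h \<longleftrightarrow>
    (\<forall>w. Vector_Spaces.linear scale (*) (\<lambda>v. h v w)) \<and>
    (\<forall>v w. h w v = cnj (h v w)) \<and>
    (\<forall>v. v \<noteq> 0 \<longrightarrow> Re (h v v) > 0)"

definition unitary_rep ::
    "('g, 'b) monoid_scheme \<Rightarrow> (complex \<Rightarrow> 'v::ab_group_add \<Rightarrow> 'v) \<Rightarrow> ('g \<Rightarrow> 'v \<Rightarrow> 'v) \<Rightarrow> bool" where
  "unitary_rep G scale \<pi> \<longleftrightarrow>
    (\<exists>h. pos_def_hermitian scale h \<and> (\<forall>g\<in>carrier G. \<forall>v w. h (\<pi> g v) (\<pi> g w) = h v w))"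

definition invariant_subspace ::
    "(complex \<Rightarrow> 'v::ab_group_add \<Rightarrow> 'v) \<Rightarrow> ('v \<Rightarrow> 'v) set \<Rightarrow> 'v set \<Rightarrow> bool" where
  "invariant_subspace scale F W \<longleftrightarrow> module.subspace scale W \<and> (\<forall>f\<in>F. f ` W \<subseteq> W)"

definition acts_semisimply ::
    "(complex \<Rightarrow> 'v::ab_group_add \<Rightarrow> 'v) \<Rightarrow> ('v \<Rightarrow> 'v) set \<Rightarrow> bool" where
  "acts_semisimply scale F \<longleftrightarrow>
    (\<forall>W. invariant_subspace scale F W \<longrightarrow>
      (\<exists>U. invariant_subspace scale F U \<and> W \<inter> U = {0} \<and> {w + u | w u. w \<in> W \<and> u \<in> U} = UNIV))"

definition jucys_murphy :: "complex \<Rightarrow> nat \<Rightarrow> braid_alg set set" where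
  "jucys_murphy q n = generated_subalgebra (affine_hecke q n)
    (\<Union>i\<in>{1..n}. {X_elem q n i, inv\<^bsub>affine_hecke q n\<^esub> (X_elem q n i)})"

definition calibrated ::
    "complex \<Rightarrow> nat \<Rightarrow> (complex \<Rightarrow> 'v::ab_group_add \<Rightarrow> 'v) \<Rightarrow> (braid_alg set \<Rightarrow> 'v \<Rightarrow> 'v) \<Rightarrow> bool" where
  "calibrated q n scale \<sigma> \<longleftrightarrow> acts_semisimply scale (\<sigma> ` jucys_murphy q n)"

text \<open>Calibrated representations need not be completely reducible: for \<open>n = 2\<close> and any \<open>q \<notin> {0, 1}\<close>, the
  matrices \<open>X\<^sub>1 = diag(1, q)\<close>, \<open>X\<^sub>2 = diag(q, 1)\<close> and \<open>T\<^sub>1 = ((q, 0), (1, -1))\<close> (rows) satisfy all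
  relations with \<open>Q = (1, q)\<close>, and the invariant line spanned by the second basis vector has
  no invariant complement.\<close>

definition completely_reducible ::
    "'a calgebra \<Rightarrow> (complex \<Rightarrow> 'v::ab_group_add \<Rightarrow> 'v) \<Rightarrow> ('a \<Rightarrow> 'v \<Rightarrow> 'v) \<Rightarrow> bool" where
  "completely_reducible A scale \<rho> \<longleftrightarrow> acts_semisimply scale (\<rho> ` carrier A)"

end

theory Submission
  imports
    Defs
    "HOL-Combinatorics.Permutations"
    "HOL-Computational_Algebra.Fundamental_Theorem_Algebra"
begin

text \<open>
  A unitary representation is calibrated because the Jucys--Murphy operators \<open>X\<^sub>j\<close> are then unitary,
  and the inverse of each is in the Jucys--Murphy subalgebra: the subalgebra is closed under adjoints,
  and orthogonal complements of its invariant subspaces are invariant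
  (\<open>unitary_imp_calibrated\<close>).

  For the converse, let \<open>U\<close> be a minimal submodule of a calibrated module and \<open>v \<in> U\<close> a joint
  eigenvector of the \<open>X\<^sub>j\<close>, with eigenvalues \<open>a\<^sub>j\<close>: a vector of weight \<open>a\<close>. Each \<open>T\<^sub>i\<close> is the sum of the scalar
  \<open>f = (q - 1) b / (b - a)\<close>, where \<open>a, b\<close> are the neighbouring entries \<open>a\<^sub>i, a\<^sub>i\<^sub>+\<^sub>1\<close>, and of an
  intertwiner \<open>\<tau>\<^sub>i\<close> that takes weight vectors to weight vectors with these two entries exchanged. The
  entries are distinct, for otherwise \<open>X\<^sub>i\<close> would have a Jordan block (\<open>weight_entries_ne\<close>). The
  intertwiners satisfy the braid relations, so composing them along a path of adjacent
  transpositions, each creating a new inversion, gives, for every permutation \<open>p\<close>, a vector \<open>v\<^sub>p\<close> of weight \<open>a \<circ> p\<close> that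
  is independent of the path (\<open>transport_descent\<close>). These vectors span a submodule, hence \<open>U\<close>, and the
  nonzero ones have distinct weights, hence form a basis of \<open>U\<close>. Moreover \<open>\<tau>\<^sub>i\<^sup>2\<close> is the scalar
  \<open>q + f f'\<close>, with \<open>f'\<close> the constant of the exchanged pair.

  The cyclotomic relation forces all eigenvalues to be powers of \<open>q\<close> (\<open>weight_powers\<close>). They have
  absolute value \<open>1\<close>, so that \<open>q + f f' = q (1 - |f|\<^sup>2)\<close>. Since no power of \<open>q = exp (2 \<pi> \<i> / e)\<close>
  other than \<open>1\<close> is closer to \<open>1\<close> than \<open>q\<close> itself, \<open>|f| \<le> 1\<close> (\<open>hecke_coeff_norm_le_1\<close>). The form that makes
  the \<open>v\<^sub>p\<close> orthogonal, with squared length the product of \<open>1 - |f|\<^sup>2\<close> over the pairs that \<open>p\<close> inverts, is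
  therefore positive semidefinite, and on the span of \<open>v\<^sub>p\<close> and its neighbour every \<open>T\<^sub>i\<close> is a unitary
  two-by-two matrix. It is definite because \<open>v\<^sub>p = 0\<close> as soon as one factor vanishes: the
  transports that have passed such a point span a submodule that does not contain \<open>v\<close>, which minimality
  forces to be zero (\<open>transport_eq_0_if_degenerate\<close>).

  Complete reducibility extends these forms by zero to the whole module, and sums of them become
  definite (\<open>invariant_inner_product_exists\<close>). The rest translates between the quotient of the group
  algebra and the operators \<open>T\<^sub>i\<close> and \<open>X\<^sub>j\<close>.
\<close>


section \<open>Inversions of a permutation\<close>

abbreviation pinv :: "(nat \<Rightarrow> nat) \<Rightarrow> nat \<Rightarrow> nat" where
  "pinv p \<equiv> inv_into UNIV p"

text \<open>Inversions are recorded as pairs of values, not of positions: then \<open>p \<circ> adj i\<close> has one inversion more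
  or less than \<open>p\<close> and otherwise the same ones.\<close>

definition inversions :: "nat \<Rightarrow> (nat \<Rightarrow> nat) \<Rightarrow> (nat \<times> nat) set" where
  "inversions n p = {(x, y). x \<in> {1..n} \<and> y \<in> {1..n} \<and> x < y \<and> pinv p y < pinv p x}"

abbreviation adj :: "nat \<Rightarrow> nat \<Rightarrow> nat" where
  "adj i \<equiv> transpose i (i + 1)"

lemma finite_inversions: "finite (inversions n p)"
  by (rule finite_subset[of _ "{1..n} \<times> {1..n}"]) (auto simp: inversions_def)

lemma adj_permutes: "i \<in> {1..<n} \<Longrightarrow> adj i permutes {1..n}"
  by (rule permutes_swap_id) auto

lemma permutes_comp_adj: "p permutes {1..n} \<Longrightarrow> i \<in> {1..<n} \<Longrightarrow> p \<circ> adj i permutes {1..n}"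
  using adj_permutes permutes_compose by blast

lemma adj_adj: "p \<circ> adj i \<circ> adj i = p"
  by (simp add: comp_assoc)

lemma permutes_neighbours_ne: "p permutes {1..n} \<Longrightarrow> p i \<noteq> p (i + 1)" for p :: "nat \<Rightarrow> nat"
  by (simp add: permutes_inj inj_eq)

lemma inversions_comp_adj:
  assumes p: "p permutes {1..n}" and i: "i \<in> {1..<n}" and asc: "p i < p (i + 1)"
  shows "inversions n (p \<circ> adj i) = insert (p i, p (i + 1)) (inversions n p)"
    and "(p i, p (i + 1)) \<notin> inversions n p"
proof -
  have bp: "bij p" using p by (rule permutes_bij)
  have inv_eq: "pinv (p \<circ> adj i) = adj i \<circ> pinv p"
    using bp by (simp add: o_inv_distrib)
  have pi: "pinv p (p i) = i" "pinv p (p (i+1)) = i+1"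
    using bp by (simp_all add: bij_is_inj)
  have inp: "p i \<in> {1..n}" "p (i+1) \<in> {1..n}"
    using i permutes_in_image[OF p] by auto
  show "(p i, p (i + 1)) \<notin> inversions n p"
    using pi by (simp add: inversions_def)
  have ord: "adj i k < adj i j \<longleftrightarrow> (k < j \<and> \<not> (k = i \<and> j = i+1)) \<or> (k = i + 1 \<and> j = i)" for k j
    unfolding transpose_def by (cases "k = i"; cases "k = i + 1"; cases "j = i"; cases "j = i + 1") auto
  have pinv_iff: "pinv p x = k \<longleftrightarrow> x = p k" for x k
    using bp by (metis bij_inv_eq_iff)
  have "(x, y) \<in> inversions n (p \<circ> adj i) \<longleftrightarrow> (x, y) \<in> insert (p i, p (i + 1)) (inversions n p)" for x y
  proof -
    have "adj i (pinv p y) < adj i (pinv p x) \<longleftrightarrow>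
      (pinv p y < pinv p x \<and> \<not> (y = p i \<and> x = p (i+1))) \<or> (y = p (i+1) \<and> x = p i)"
      unfolding ord pinv_iff ..
    then show ?thesis
      unfolding inversions_def inv_eq using asc inp by auto
  qed
  then show "inversions n (p \<circ> adj i) = insert (p i, p (i + 1)) (inversions n p)"
    by (meson subset_antisym subrelI)
qed

lemma inversions_comp_adj_descent:
  assumes p: "p permutes {1..n}" and i: "i \<in> {1..<n}" and desc: "p (i + 1) < p i"
  shows "inversions n p = insert (p (i + 1), p i) (inversions n (p \<circ> adj i))"
    and "(p (i + 1), p i) \<notin> inversions n (p \<circ> adj i)"
proof -
  have e: "(p \<circ> adj i) i = p (i + 1)" "(p \<circ> adj i) (i + 1) = p i" by simp_all
  note * = inversions_comp_adj[OF permutes_comp_adj[OF p i] i, unfolded e adj_adj, OF desc]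
  show "inversions n p = insert (p (i + 1), p i) (inversions n (p \<circ> adj i))"
    and "(p (i + 1), p i) \<notin> inversions n (p \<circ> adj i)"
    using * by blast+
qed

lemma card_inversions_comp_adj:
  assumes "p permutes {1..n}" "i \<in> {1..<n}" "p (i + 1) < p i"
  shows "card (inversions n (p \<circ> adj i)) < card (inversions n p)"
  unfolding inversions_comp_adj_descent(1)[OF assms]
  using inversions_comp_adj_descent(2)[OF assms] finite_inversions by simp

lemma permutes_no_descent:
  fixes p :: "nat \<Rightarrow> nat"
  assumes p: "p permutes {1..n}" and asc: "\<And>i. i \<in> {1..<n} \<Longrightarrow> p i < p (i + 1)"
  shows "p = id"
proof -
  have ge: "j \<le> p j" if "1 \<le> j" "j \<le> n" for j
    using that
  proof (induction j rule: nat_induct_at_least)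
    case base
    then show ?case using permutes_in_image[OF p, of 1] by auto
  next
    case (Suc m)
    then show ?case using asc[of m] by auto
  qed
  have le: "p (n - k) \<le> n - k" if "k < n" for k
    using that
  proof (induction k)
    case 0
    then show ?case using permutes_in_image[OF p, of n] by auto
  next
    case (Suc k)
    have "p (n - Suc k) < p (n - Suc k + 1)" using Suc.prems by (intro asc) auto
    moreover have "n - Suc k + 1 = n - k" using Suc.prems by auto
    ultimately show ?case using Suc by fastforce
  qed
  have "p j = j" for j
  proof (cases "j \<in> {1..n}")
    case True
    then show ?thesis using ge[of j] le[of "n - j"] by auto
  next
    case False
    then show ?thesis using p by (simp add: permutes_def)
  qed
  then show ?thesis by auto
qed

text \<open>Sorting by exchanging neighbours, read backwards.\<close>

lemma permutes_ascent_induct [consumes 1, case_names id ascent]: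
  assumes p: "p permutes {1..n}" and id: "P id"
    and ascent: "\<And>p i. p permutes {1..n} \<Longrightarrow> i \<in> {1..<n} \<Longrightarrow> p i < p (i + 1) \<Longrightarrow> P p \<Longrightarrow> P (p \<circ> adj i)"
  shows "P p"
  using p
proof (induction "card (inversions n p)" arbitrary: p rule: less_induct)
  case less
  show ?case
  proof (cases "\<forall>i\<in>{1..<n}. p i < p (i + 1)")
    case True
    then show ?thesis using permutes_no_descent[OF less.prems] id by auto
  next
    case False
    then obtain i where i: "i \<in> {1..<n}" "\<not> p i < p (i + 1)" by auto
    moreover have "p i \<noteq> p (i + 1)"
      using permutes_neighbours_ne[OF less.prems] .
    ultimately have desc: "p (i + 1) < p i" by linarith
    have p': "p \<circ> adj i permutes {1..n}" using permutes_comp_adj less.prems i(1) .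
    have "P (p \<circ> adj i)"
      using less.hyps[OF _ p'] card_inversions_comp_adj[OF less.prems i(1) desc] by blast
    then have "P (p \<circ> adj i \<circ> adj i)" using ascent[OF p' i(1)] desc by simp
    then show ?thesis by (simp only: adj_adj)
  qed
qed

lemma inversions_id: "inversions n id = {}"
  by (auto simp: inversions_def)

text \<open>A labelling of the points recovers the permutation as long as equally labelled points stay
  in order: at the first position where two candidates differ, one of them would have to bring a
  point forward past a smaller point with the same label.\<close>

lemma permutes_eq_if_labels_eq:
  fixes a :: "nat \<Rightarrow> 'b"
  assumes p: "p permutes {1..n}" and r: "r permutes {1..n}"
    and np: "\<And>x y. (x, y) \<in> inversions n p \<Longrightarrow> a x \<noteq> a y"
    and nr: "\<And>x y. (x, y) \<in> inversions n r \<Longrightarrow> a x \<noteq> a y"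
    and eq: "\<And>j. j \<in> {1..n} \<Longrightarrow> a (p j) = a (r j)"
  shows "p = r"
proof -
  have aux: "\<not> p j < r j"
    if p: "p permutes {1..n}" and r: "r permutes {1..n}"
      and nr: "\<And>x y. (x, y) \<in> inversions n r \<Longrightarrow> a x \<noteq> a y"
      and eq: "\<And>j. j \<in> {1..n} \<Longrightarrow> a (p j) = a (r j)"
      and j: "j \<in> {1..n}" and IH: "\<And>k. k < j \<Longrightarrow> k \<in> {1..n} \<Longrightarrow> p k = r k" for p r j
  proof
    assume less: "p j < r j"
    define k where "k = pinv r (p j)"
    have rk: "r k = p j" unfolding k_def using r by (simp add: permutes_inverses)
    have pj: "p j \<in> {1..n}" "r j \<in> {1..n}" 
      using j permutes_in_image[OF p, of j] permutes_in_image[OF r, of j] by simp_all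
    then have kin: "k \<in> {1..n}" using rk permutes_in_image[OF r, of k] by simp
    have "k \<noteq> j" using less rk by auto
    moreover have "\<not> k < j"
    proof
      assume "k < j"
      then have "p k = p j" using IH[OF _ kin] rk by simp
      then show False using \<open>k < j\<close> permutes_inj[OF p] by (auto dest: injD)
    qed
    ultimately have "j < k" by auto
    moreover have "pinv r (r j) = j" "pinv r (p j) = k"
      using r by (simp_all add: permutes_inverses k_def)
    ultimately have "(p j, r j) \<in> inversions n r"
      using pj less unfolding inversions_def by simp
    then show False using nr[of "p j" "r j"] eq[OF j] by simp
  qed
  have "p j = r j" if "j \<in> {1..n}" for j
    using that
  proof (induction j rule: less_induct)
    case (less j)
    show ?case
      using aux[OF p r nr eq less.prems less.IH]
        aux[OF r p np eq[symmetric] less.prems less.IH[symmetric]] by auto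
  qed
  moreover have "p j = r j" if "j \<notin> {1..n}" for j
    using that p r by (simp add: permutes_def)
  ultimately have "p j = r j" for j
    by (cases "j \<in> {1..n}") auto
  then show ?thesis by (rule ext)
qed

section \<open>Linear algebra over the complex numbers\<close>

locale complex_space = finite_dimensional_vector_space scale Basis
  for scale :: "complex \<Rightarrow> 'v::ab_group_add \<Rightarrow> 'v" (infixr \<open>*s\<close> 75) and Basis :: "'v set"
begin

abbreviation lin :: "('v \<Rightarrow> 'v) \<Rightarrow> bool" where
  "lin f \<equiv> Vector_Spaces.linear scale scale f"

lemma lin_add: "lin f \<Longrightarrow> f (x + y) = f x + f y"
  and lin_scale: "lin f \<Longrightarrow> f (c *s x) = c *s f x"
  by (auto simp: Vector_Spaces.linear_iff)

lemma lin_diff: "lin f \<Longrightarrow> f (x - y) = f x - f y"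
  and lin_zero: "lin f \<Longrightarrow> f 0 = 0"
  and lin_sum: "lin f \<Longrightarrow> f (sum g A) = (\<Sum>a\<in>A. f (g a))"
  unfolding module_hom_iff_linear[symmetric]
  by (rule module_hom.diff module_hom.zero module_hom.sum; assumption)+

lemma linI: "(\<And>x y. f (x + y) = f x + f y) \<Longrightarrow> (\<And>c x. f (c *s x) = c *s f x) \<Longrightarrow> lin f"
  using vector_space_axioms by (auto simp: Vector_Spaces.linear_iff)

lemma subspace_ker: "lin f \<Longrightarrow> subspace {v. f v = c *s v}"
  by (rule subspaceI) (auto simp: lin_add lin_scale lin_zero scale_right_distrib scale_left_commute)

lemma lin_span_subset: "lin f \<Longrightarrow> f ` B \<subseteq> span B \<Longrightarrow> f ` span B \<subseteq> span B"
  unfolding module_hom_iff_linear[symmetric]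
  by (metis module_hom.span_image span_minimal subspace_span)

subsection \<open>Eigenvectors\<close>

text \<open>Evaluation of a polynomial at the operator \<open>f\<close>, by Horner's scheme.\<close>

definition poly_op :: "('v \<Rightarrow> 'v) \<Rightarrow> complex poly \<Rightarrow> 'v \<Rightarrow> 'v" where
  "poly_op f p = fold_coeffs (\<lambda>c g v. c *s v + f (g v)) p (\<lambda>_. 0)"

context
  fixes f assumes f: "lin f"
begin

lemma poly_op_0 [simp]: "poly_op f 0 v = 0"
  by (simp add: poly_op_def)

lemma poly_op_pCons [simp]: "poly_op f (pCons c p) v = c *s v + f (poly_op f p v)"
proof (cases "c = 0 \<and> p = 0")
  case True
  then show ?thesis by (simp add: lin_zero[OF f])
next
  case False
  then show ?thesis by (auto simp: poly_op_def)
qed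

lemma poly_op_add: "poly_op f (p + r) v = poly_op f p v + poly_op f r v"
  by (induction p r rule: poly_induct2) (auto simp: lin_add[OF f] scale_left_distrib)

lemma poly_op_smult: "poly_op f (smult c p) v = c *s poly_op f p v"
  by (induction p) (auto simp: lin_scale[OF f] scale_right_distrib)

lemma poly_op_linear_factor: "poly_op f ([:-z, 1:] * p) v = f (poly_op f p v) - z *s poly_op f p v"
proof -
  have "[:-z, 1:] * p = smult (- z) p + pCons 0 p" by simp
  then show ?thesis by (simp only: poly_op_add poly_op_smult) (simp add: scale_minus_left)
qed

lemma poly_op_monom: "poly_op f (monom c i) v = c *s (f ^^ i) v"
  by (induction i) (auto simp: monom_0 monom_Suc lin_scale[OF f] lin_zero[OF f])

lemma poly_op_sum: "poly_op f (\<Sum>i\<in>I. p i) v = (\<Sum>i\<in>I. poly_op f (p i) v)"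
  by (induction I rule: infinite_finite_induct) (auto simp: poly_op_add)

text \<open>The vectors \<open>v, f v, f (f v), \<dots>\<close> cannot all be independent. Two of them may coincide, which a
  linear dependence of the set of these vectors does not detect.\<close>

lemma exists_annihilating_poly: "\<exists>p. p \<noteq> 0 \<and> poly_op f p v = 0"
proof -
  define g where "g i = (f ^^ i) v" for i
  show ?thesis
  proof (cases "inj g")
    case True
    define B where "B = g ` {..dimension}"
    have inj: "inj_on g {..dimension}" using True by (rule inj_on_subset) auto
    have "card B = Suc dimension" by (simp add: B_def card_image[OF inj])
    moreover have "card B \<le> dimension" if "independent B"
      using independent_card_le_dim[OF subset_UNIV that] by (simp add: dimension_def)
    ultimately have "dependent B" by auto
    moreover have "finite B" by (simp add: B_def)
    ultimately obtain u b where u: "b \<in> B" "u b \<noteq> 0" "(\<Sum>w\<in>B. u w *s w) = 0"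
      unfolding dependent_finite[OF \<open>finite B\<close>] by blast
    define p where "p = (\<Sum>i\<le>dimension. monom (u (g i)) i)"
    obtain k where k: "k \<le> dimension" "b = g k" using u(1) by (auto simp: B_def)
    have "coeff p k = u (g k)"
      using k(1) by (simp add: p_def coeff_sum)
    then have "p \<noteq> 0" using u(2) k(2) by auto
    moreover have "poly_op f p v = (\<Sum>i\<le>dimension. u (g i) *s g i)"
      by (simp add: p_def poly_op_sum poly_op_monom g_def)
    then have "poly_op f p v = 0"
      using u(3) by (simp add: B_def sum.reindex[OF inj])
    ultimately show ?thesis by blast
  next
    case False
    then obtain i j where ij: "i \<noteq> j" "g i = g j" by (auto simp: inj_def)
    define p where "p = monom (1::complex) i + monom (-1) j"
    have "coeff p i = 1" using ij(1) by (simp add: p_def)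
    then have "p \<noteq> 0" by auto
    moreover have "poly_op f p v = 0"
      using ij(2) by (simp add: p_def poly_op_add poly_op_monom g_def scale_minus_left)
    ultimately show ?thesis by blast
  qed
qed

lemma poly_op_mem: "subspace S \<Longrightarrow> f ` S \<subseteq> S \<Longrightarrow> v \<in> S \<Longrightarrow> poly_op f p v \<in> S"
  by (induction p) (auto intro!: subspace_0 subspace_add subspace_scale)

text \<open>A polynomial of least degree that annihilates \<open>v\<close> splits off a linear factor, and what remains,
  applied to \<open>v\<close>, is an eigenvector.\<close>

lemma exists_eigenvector:
  assumes S: "subspace S" "f ` S \<subseteq> S" and v: "v \<in> S" "v \<noteq> 0"
  shows "\<exists>z. \<exists>w\<in>S. w \<noteq> 0 \<and> f w = z *s w"
proof -
  define P where "P p \<longleftrightarrow> p \<noteq> 0 \<and> poly_op f p v = 0" for p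
  obtain p where p: "P p" and least: "\<And>r. P r \<Longrightarrow> degree p \<le> degree r"
    using exists_annihilating_poly[of v] ex_has_least_nat[of P _ degree] unfolding P_def by blast
  have "degree p \<noteq> 0"
  proof
    assume "degree p = 0"
    then obtain c where "p = [:c:]" by (metis degree_eq_zeroE)
    then show False using p v by (simp add: P_def lin_zero[OF f])
  qed
  then have "\<not> constant (poly p)" by (simp add: constant_degree)
  then obtain z where "poly p z = 0" using fundamental_theorem_of_algebra by blast
  then obtain r where r: "p = [:-z, 1:] * r" by (metis dvdE poly_eq_0_iff_dvd)
  have r0: "r \<noteq> 0" using p r by (auto simp: P_def)
  have "degree p = Suc (degree r)"
    using r0 by (subst r, subst degree_mult_eq) auto
  then have "\<not> P r" using least by fastforce
  then have "poly_op f r v \<noteq> 0" using r0 by (simp add: P_def)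
  moreover have "f (poly_op f r v) = z *s poly_op f r v"
    using p r by (simp add: P_def poly_op_linear_factor del: poly_op_pCons mult_pCons_left)
  ultimately show ?thesis using poly_op_mem[OF S v(1)] by blast
qed

lemma image_subspace_eq:
  assumes S: "subspace S" "f ` S \<subseteq> S" and inj: "inj f"
  shows "f ` S = S"
proof -
  interpret finite_dimensional_vector_space_pair_1 scale Basis scale
    by unfold_locales
  have "dim (f ` S) = dim S"
    using inj f by (intro dim_image_eq) (auto intro: inj_on_subset)
  moreover have "subspace (f ` S)"
    using f S(1) unfolding module_hom_iff_linear[symmetric] by (rule module_hom.subspace_image)
  ultimately show ?thesis using subspace_dim_equal[of "f ` S" S] S by simp
qed

end

text \<open>Each operator in turn has an eigenvector in the joint eigenspace of the previous ones, which is
  invariant under all of them.\<close>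

lemma exists_joint_eigenvector:
  fixes X :: "nat \<Rightarrow> 'v \<Rightarrow> 'v"
  assumes lin: "\<And>j. j \<in> {1..n} \<Longrightarrow> lin (X j)"
    and comm: "\<And>i j v. i \<in> {1..n} \<Longrightarrow> j \<in> {1..n} \<Longrightarrow> X i (X j v) = X j (X i v)"
    and S: "subspace S" "\<And>j. j \<in> {1..n} \<Longrightarrow> X j ` S \<subseteq> S" "S \<noteq> {0}"
  shows "\<exists>a. \<exists>v\<in>S. v \<noteq> 0 \<and> (\<forall>j\<in>{1..n}. X j v = a j *s v)"
proof -
  have "\<exists>R a. subspace R \<and> R \<subseteq> S \<and> (\<exists>v\<in>R. v \<noteq> 0) \<and> (\<forall>j\<in>{1..n}. X j ` R \<subseteq> R) \<and>
      (\<forall>j\<in>{1..k}. \<forall>v\<in>R. X j v = a j *s v)" if "k \<le> n" for k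
    using that
  proof (induction k)
    case 0
    then show ?case using S subspace_0[OF S(1)] by (intro exI[of _ S]) auto
  next
    case (Suc k)
    then obtain R a where R: "subspace R" "R \<subseteq> S" "\<exists>v\<in>R. v \<noteq> 0" "\<forall>j\<in>{1..n}. X j ` R \<subseteq> R"
      and a: "\<forall>j\<in>{1..k}. \<forall>v\<in>R. X j v = a j *s v" by auto
    have k: "Suc k \<in> {1..n}" using Suc.prems by auto
    obtain z w where w: "w \<in> R" "w \<noteq> 0" "X (Suc k) w = z *s w"
      using exists_eigenvector[OF lin[OF k] R(1)] R(3,4) k by metis
    define R' where "R' = R \<inter> {v. X (Suc k) v = z *s v}"
    have "X j v \<in> R'" if "j \<in> {1..n}" "v \<in> R'" for j v
      using that R(4) comm[OF k that(1), of v] lin_scale[OF lin[OF that(1)]]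
      unfolding R'_def by (auto simp: image_subset_iff)
    moreover have "subspace R'"
      unfolding R'_def using R(1) subspace_ker[OF lin[OF k]] by (rule subspace_inter)
    moreover have "X j v = (a(Suc k := z)) j *s v" if "j \<in> {1..Suc k}" "v \<in> R'" for j v
      using that a unfolding R'_def by (auto simp: le_Suc_eq)
    moreover have "R' \<subseteq> S" "w \<in> R'" using w R(2) by (auto simp: R'_def)
    ultimately show ?case
      using w(2) by (intro exI[of _ R'] exI[of _ "a(Suc k := z)"] conjI ballI image_subsetI) blast+
  qed
  from this[of n] show ?thesis by (metis order_refl subsetD)
qed

lemma joint_eigenvectors_independent:
  fixes X :: "'j \<Rightarrow> 'v \<Rightarrow> 'v" and u :: "'i \<Rightarrow> 'v"
  assumes lin: "\<And>j. j \<in> J \<Longrightarrow> lin (X j)" and "finite I"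
    and "\<And>i. i \<in> I \<Longrightarrow> u i \<noteq> 0"
    and "\<And>i j. i \<in> I \<Longrightarrow> j \<in> J \<Longrightarrow> X j (u i) = a i j *s u i"
    and "\<And>i i'. i \<in> I \<Longrightarrow> i' \<in> I \<Longrightarrow> i \<noteq> i' \<Longrightarrow> \<exists>j\<in>J. a i j \<noteq> a i' j"
    and "(\<Sum>i\<in>I. c i *s u i) = 0" and "i \<in> I"
  shows "c i = 0"
  using assms(2-)
proof (induction I arbitrary: c i rule: finite_induct)
  case empty
  then show ?case by simp
next
  case (insert k I)
  have sub: "c i' = 0" if i': "i' \<in> I" for i'
  proof -
    obtain j where j: "j \<in> J" "a k j \<noteq> a i' j"
      using insert.prems(3)[of k i'] insert.hyps(2) i' by auto
    have z: "c k *s u k + (\<Sum>i\<in>I. c i *s u i) = 0"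
      using insert.prems(4) insert.hyps by simp
    \<comment> \<open>apply \<open>X j - a k j\<close>, which kills the term of index \<open>k\<close>\<close>
    have "X j (c k *s u k + (\<Sum>i\<in>I. c i *s u i)) - a k j *s (c k *s u k + (\<Sum>i\<in>I. c i *s u i)) = 0"
      unfolding z by (simp add: lin_zero[OF lin[OF j(1)]])
    moreover have "X j (c k *s u k + (\<Sum>i\<in>I. c i *s u i)) = c k *s (a k j *s u k) + (\<Sum>i\<in>I. c i *s (a i j *s u i))"
      using insert.prems(2)[OF _ j(1)]
      by (simp add: lin_add[OF lin[OF j(1)]] lin_sum[OF lin[OF j(1)]] lin_scale[OF lin[OF j(1)]])
    ultimately have "(\<Sum>i\<in>I. (c i * (a i j - a k j)) *s u i) = 0"
      by (simp add: scale_right_distrib scale_sum_right scale_left_diff_distrib algebra_simps sum_subtractf)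
    then have "c i' * (a i' j - a k j) = 0"
      using insert.IH[where c = "\<lambda>i. c i * (a i j - a k j)"] insert.prems(1-3) i' by auto
    then show ?thesis using j(2) by simp
  qed
  then have "c k *s u k = 0"
    using insert.prems(4) insert.hyps by simp
  then have "c k = 0" using insert.prems(1) by simp
  then show ?case using sub insert.prems(5) by auto
qed

text \<open>For families rather than sets of vectors, since members of a family may coincide.\<close>

lemma span_image_finite_sum:
  assumes "finite I" "x \<in> span (u ` I)"
  shows "\<exists>c. x = (\<Sum>i\<in>I. c i *s u i)"
  using assms(2)
proof (induction rule: span_induct_alt)
  case base
  show ?case by (rule exI[of _ "\<lambda>_. 0"]) simp
next
  case (step k y z)
  then obtain j c where j: "j \<in> I" "y = u j" and z: "z = (\<Sum>i\<in>I. c i *s u i)" by blast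
  have "k *s y + z = (\<Sum>i\<in>I. (if i = j then k *s u i else 0) + c i *s u i)"
    using j assms(1) by (simp add: sum.distrib z)
  also have "\<dots> = (\<Sum>i\<in>I. (c(j := c j + k)) i *s u i)"
    by (intro sum.cong) (auto simp: scale_left_distrib)
  finally show ?case by blast
qed

lemma complement_projection:
  assumes U: "subspace U" "subspace W" and int: "U \<inter> W = {0}" and sum: "{u + w | u w. u \<in> U \<and> w \<in> W} = UNIV"
  shows "\<exists>\<pi>. lin \<pi> \<and> (\<forall>u\<in>U. \<pi> u = u) \<and> (\<forall>w\<in>W. \<pi> w = 0) \<and> (\<forall>v. \<pi> v \<in> U)"
proof -
  have "\<exists>u\<in>U. v - u \<in> W" for v
  proof -
    obtain u w where "v = u + w" "u \<in> U" "w \<in> W" using sum UNIV_I[of v] by blast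
    then show ?thesis by (intro bexI[of _ u]) simp_all
  qed
  then obtain \<pi> where \<pi>: "\<And>v. \<pi> v \<in> U" "\<And>v. v - \<pi> v \<in> W" by metis
  have uniq: "\<pi> v = u" if u: "u \<in> U" "v - u \<in> W" for u v
  proof -
    have "\<pi> v - u \<in> U" using \<pi>(1) u(1) U(1) by (intro subspace_diff)
    moreover have "\<pi> v - u = (v - u) - (v - \<pi> v)" by simp
    then have "\<pi> v - u \<in> W" using subspace_diff[OF U(2) u(2) \<pi>(2)[of v]] by simp
    ultimately have "\<pi> v - u = 0" using int by blast
    then show ?thesis by simp
  qed
  have "lin \<pi>"
  proof (rule linI)
    fix x y
    have "(x - \<pi> x) + (y - \<pi> y) \<in> W" using \<pi>(2) U(2) by (intro subspace_add)
    then show "\<pi> (x + y) = \<pi> x + \<pi> y"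
      using \<pi>(1) U(1) by (intro uniq subspace_add) (auto simp: algebra_simps)
  next
    fix c x
    have "c *s (x - \<pi> x) \<in> W" using \<pi>(2) U(2) by (intro subspace_scale)
    then show "\<pi> (c *s x) = c *s \<pi> x"
      using \<pi>(1) U(1) by (intro uniq subspace_scale) (auto simp: scale_right_diff_distrib)
  qed
  moreover have "\<pi> u = u" if "u \<in> U" for u
    using that subspace_0[OF U(2)] by (intro uniq) auto
  moreover have "\<pi> w = 0" if "w \<in> W" for w
    using that subspace_0[OF U(1)] by (intro uniq) auto
  ultimately show ?thesis using \<pi>(1) by blast
qed

subsection \<open>Hermitian forms\<close>

definition hermitian :: "('v \<Rightarrow> 'v \<Rightarrow> complex) \<Rightarrow> bool" where
  "hermitian h \<longleftrightarrow> (\<forall>u v w. h (u + v) w = h u w + h v w) \<and> (\<forall>c v w. h (c *s v) w = c * h v w) \<and>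
     (\<forall>v w. h w v = cnj (h v w))"

definition preserves :: "('v \<Rightarrow> 'v \<Rightarrow> complex) \<Rightarrow> ('v \<Rightarrow> 'v) \<Rightarrow> bool" where
  "preserves h f \<longleftrightarrow> (\<forall>v w. h (f v) (f w) = h v w)"

lemma pos_def_hermitian_iff:
  "pos_def_hermitian scale h \<longleftrightarrow> hermitian h \<and> (\<forall>v. v \<noteq> 0 \<longrightarrow> Re (h v v) > 0)"
proof -
  have "vector_space ((*) :: complex \<Rightarrow> complex \<Rightarrow> complex)"
    by unfold_locales (auto simp: algebra_simps)
  then have "(\<forall>w. Vector_Spaces.linear scale (*) (\<lambda>v. h v w)) \<longleftrightarrow>
      (\<forall>u v w. h (u + v) w = h u w + h v w) \<and> (\<forall>c v w. h (c *s v) w = c * h v w)"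
    using vector_space_axioms by (simp add: Vector_Spaces.linear_iff) blast
  then show ?thesis
    unfolding pos_def_hermitian_def hermitian_def by simp
qed

context
  fixes h assumes h: "hermitian h"
begin

lemma herm_add_left: "h (u + v) w = h u w + h v w"
  and herm_scale_left: "h (c *s v) w = c * h v w"
  and herm_cnj: "cnj (h v w) = h w v"
  using h unfolding hermitian_def by (blast, blast, metis)

lemma herm_add_right: "h w (u + v) = h w u + h w v"
  and herm_scale_right: "h w (c *s v) = cnj c * h w v"
  using herm_cnj[of "u + v" w] herm_cnj[of u w] herm_cnj[of v w] herm_cnj[of "c *s v" w]
  by (simp_all add: herm_add_left herm_scale_left)

lemma herm_zero_left: "h 0 w = 0" and herm_zero_right: "h w 0 = 0"
  using herm_scale_left[of 0 0 w] herm_scale_right[of w 0 0] by simp_all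

lemma herm_diff_left: "h (u - v) w = h u w - h v w"
  using herm_add_left[of "u - v" v w] by simp

lemma subspace_orthogonal: "subspace {u. \<forall>w\<in>W. h u w = 0}"
  by (rule subspaceI) (auto simp: herm_add_left herm_scale_left herm_zero_left)

lemma herm_real: "Im (h v v) = 0"
  using herm_cnj[of v v] by (metis complex_cnj_cancel_iff complex_cnj_zero_iff Reals_cnj_iff complex_is_Real_iff)

text \<open>Gram--Schmidt, one spanning vector at a time.\<close>

lemma orthogonal_projection_exists:
  assumes pos: "\<And>v. v \<noteq> 0 \<Longrightarrow> h v v \<noteq> 0" and "finite S"
  shows "\<exists>w\<in>span S. \<forall>s\<in>span S. h (v - w) s = 0"
  using \<open>finite S\<close>
proof (induction S arbitrary: v rule: finite_induct)
  case empty
  then show ?case by (auto simp: herm_zero_right)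
next
  case (insert x S)
  obtain y where y: "y \<in> span S" "\<forall>s\<in>span S. h (x - y) s = 0" using insert.IH by blast
  obtain w where w: "w \<in> span S" "\<forall>s\<in>span S. h (v - w) s = 0" using insert.IH by blast
  define x' where "x' = x - y"
  define c where "c = h (v - w) x' / h x' x'"
  have sub: "span S \<subseteq> span (insert x S)" by (rule span_mono) auto
  have x': "x' \<in> span (insert x S)"
    unfolding x'_def using y(1) sub by (auto intro: span_diff span_base)
  have c: "h (v - w) x' = c * h x' x'"
    using pos[of x'] by (cases "x' = 0") (auto simp: c_def herm_zero_right)
  have "h (v - (w + c *s x')) s = 0" if s_in: "s \<in> span (insert x S)" for s
  proof -
    obtain k where "s - k *s x \<in> span S" using s_in span_breakdown_eq by blast
    then have "s - k *s x + k *s y \<in> span S" using y(1) by (intro span_add span_scale)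
    moreover have "s - k *s x + k *s y = s - k *s x'"
      by (simp add: x'_def scale_right_diff_distrib)
    ultimately have sS: "s - k *s x' \<in> span S" by simp
    define t where "t = s - k *s x'"
    have s: "s = t + k *s x'" by (simp add: t_def)
    have "h (v - w) t = 0" "h x' t = 0" using sS w(2) y(2) by (auto simp: t_def x'_def)
    then have "h (v - w - c *s x') s = 0"
      unfolding herm_diff_left[of "v - w" "c *s x'"] herm_scale_left s herm_add_right herm_scale_right c
      by simp
    then show ?thesis by (simp add: diff_diff_eq)
  qed
  moreover have "w + c *s x' \<in> span (insert x S)"
    using w(1) x' sub by (auto intro: span_add span_scale)
  ultimately show ?case by blast
qed

end

lemma preserves_if_on_spanning:
  assumes h: "hermitian h" and f: "lin f" and B: "span B = UNIV"
    and eq: "\<And>x y. x \<in> B \<Longrightarrow> y \<in> B \<Longrightarrow> h (f x) (f y) = h x y"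
  shows "preserves h f"
proof -
  have 1: "h (f x) (f y) = h x y" if x: "x \<in> B" for x y
  proof -
    have "y \<in> span B" using B by simp
    then show ?thesis
      by (induction rule: span_induct_alt)
        (auto simp: lin_zero[OF f] lin_add[OF f] lin_scale[OF f] herm_zero_right[OF h] herm_add_right[OF h]
          herm_scale_right[OF h] eq[OF x])
  qed
  have "h (f x) (f y) = h x y" for x y
  proof -
    have "x \<in> span B" using B by simp
    then show ?thesis
      by (induction rule: span_induct_alt)
        (auto simp: lin_zero[OF f] lin_add[OF f] lin_scale[OF f] herm_zero_left[OF h] herm_add_left[OF h]
          herm_scale_left[OF h] 1)
  qed
  then show ?thesis by (simp add: preserves_def)
qed

text \<open>By positivity of \<open>h (c v + w) (c v + w)\<close> for all \<open>c\<close>, a null vector is orthogonal to everything.\<close>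

lemma null_vector_orthogonal:
  assumes h: "hermitian h" and psd: "\<And>v. Re (h v v) \<ge> 0" and null: "Re (h v v) = 0"
  shows "h v w = 0"
proof (rule ccontr)
  assume ne: "h v w \<noteq> 0"
  \<comment> \<open>chosen so that \<open>h (c v + w) (c v + w)\<close>, which is affine in \<open>r\<close>, takes the value \<open>- 1\<close>\<close>
  define r where "r = - (Re (h w w) + 1) / (2 * (cmod (h v w))\<^sup>2)"
  define c where "c = of_real r * cnj (h v w)"
  have vv: "h v v = 0" using herm_real[OF h, of v] null by (simp add: complex_eq_iff)
  have "h (c *s v + w) (c *s v + w) = c * h v w + cnj (c * h v w) + h w w"
    by (simp add: herm_add_left[OF h] herm_add_right[OF h] herm_scale_left[OF h] herm_scale_right[OF h] vv
        herm_cnj[OF h])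
  moreover have "c * h v w = of_real (r * (cmod (h v w))\<^sup>2)"
    unfolding c_def using complex_norm_square[of "h v w"] by (simp add: mult.assoc mult.commute)
  ultimately have "Re (h (c *s v + w) (c *s v + w)) = 2 * (r * (cmod (h v w))\<^sup>2) + Re (h w w)"
    by simp
  also have "r * (cmod (h v w))\<^sup>2 = - (Re (h w w) + 1) / 2" using ne by (simp add: r_def)
  finally show False using psd[of "c *s v + w"] by (simp add: field_simps)
qed

end

section \<open>The structure constants at a root of unity\<close>

text \<open>The diagonal entry of \<open>T\<^sub>i\<close> at a weight vector whose entries \<open>i\<close> and \<open>i + 1\<close> are \<open>a\<close> and \<open>b\<close>. At \<open>a = b\<close>, a case that
  arises only for vectors that turn out to be zero, division by zero gives \<open>0\<close>.\<close>

definition hecke_coeff :: "complex \<Rightarrow> complex \<Rightarrow> complex \<Rightarrow> complex" where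
  "hecke_coeff q a b = (q - 1) * b / (b - a)"

lemma hecke_coeff_refl [simp]: "hecke_coeff q a a = 0"
  by (simp add: hecke_coeff_def)

lemma hecke_coeff_sum: "a \<noteq> b \<Longrightarrow> hecke_coeff q a b + hecke_coeff q b a = q - 1"
  unfolding hecke_coeff_def by (simp add: divide_simps) (simp add: algebra_simps)

lemma hecke_coeff_braid:
  assumes "a \<noteq> b" "b \<noteq> c" "a \<noteq> c"
  shows "hecke_coeff q a c * (hecke_coeff q a b + hecke_coeff q b c - (q - 1)) = hecke_coeff q a b * hecke_coeff q b c"
  using assms unfolding hecke_coeff_def by (simp add: divide_simps) (simp add: algebra_simps)

text \<open>The right-hand side shows when an intertwiner squares to zero: if \<open>b = q a\<close> or \<open>a = q b\<close>.\<close>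

lemma hecke_coeff_mult:
  assumes "a \<noteq> b"
  shows "q + hecke_coeff q a b * hecke_coeff q b a = (q * b - a) * (b - q * a) / (b - a)\<^sup>2"
proof -
  have "hecke_coeff q a b * hecke_coeff q b a = - ((q - 1)\<^sup>2 * a * b) / (b - a)\<^sup>2"
    using assms unfolding hecke_coeff_def by (simp add: divide_simps) (simp add: power2_eq_square algebra_simps)
  then show ?thesis using assms
    by (simp add: divide_simps) (simp add: power2_eq_square algebra_simps)
qed

lemma cnj_hecke_coeff:
  assumes "a \<noteq> b" "cmod a = 1" "cmod b = 1" "cmod q = 1"
  shows "cnj (hecke_coeff q b a) = - hecke_coeff q a b / q"
proof -
  have c: "cnj z = 1 / z" if "cmod z = 1" for z
    using that by (metis complex_norm_square divide_self_if mult.commute nonzero_divide_eq_eq norm_eq_zero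
        of_real_1 one_power2 zero_neq_one)
  have nz: "a \<noteq> 0" "b \<noteq> 0" "q \<noteq> 0" using assms by auto
  have d: "1 / a - 1 / b = (b - a) / (a * b)"
    using nz by (simp add: field_simps)
  show ?thesis
    unfolding hecke_coeff_def using assms(1) nz
    by (simp add: c[OF assms(2)] c[OF assms(3)] c[OF assms(4)] d) (simp add: field_simps)
qed

text \<open>For unimodular \<open>a, b, q\<close> the square of the intertwiner becomes a length: by \<open>cnj_hecke_coeff\<close>, exchanging
  \<open>a\<close> and \<open>b\<close> amounts to conjugation up to the factor \<open>- q\<close>.\<close>

lemma hecke_coeff_norm:
  assumes "a \<noteq> b" "cmod a = 1" "cmod b = 1" "cmod q = 1"
  shows "q + hecke_coeff q a b * hecke_coeff q b a = q * of_real (1 - (cmod (hecke_coeff q a b))\<^sup>2)"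
proof -
  have q: "q \<noteq> 0" using assms by auto
  have "of_real ((cmod (hecke_coeff q a b))\<^sup>2) = hecke_coeff q a b * cnj (hecke_coeff q a b)"
    by (rule complex_norm_square)
  also have "\<dots> = - hecke_coeff q a b * hecke_coeff q b a / q"
    using cnj_hecke_coeff[of b a q] assms by simp
  finally show ?thesis using q by (simp add: field_simps)
qed

lemma hecke_coeff_norm_commute:
  "a \<noteq> b \<Longrightarrow> cmod a = 1 \<Longrightarrow> cmod b = 1 \<Longrightarrow> cmod q = 1 \<Longrightarrow>
    cmod (hecke_coeff q b a) = cmod (hecke_coeff q a b)"
  using cnj_hecke_coeff[of a b q] by (metis complex_mod_cnj div_by_1 norm_divide norm_minus_cancel)

text \<open>Among the powers of \<open>exp (2 \<pi> \<i> / e)\<close> other than \<open>1\<close>, none is closer to \<open>1\<close> than the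
  generator itself. For a primitive \<open>e\<close>-th root of unity \<open>q\<close> other than \<open>exp (\<plusminus> 2 \<pi> \<i> / e)\<close> this fails, and some
  structure constant has absolute value greater than \<open>1\<close>.\<close>

lemma root_of_unity_nearest:
  fixes e k :: int
  assumes e: "e > 1" and q: "q = exp (2 * of_real pi * \<i> / of_int e)" and ne: "q powi k \<noteq> 1"
  shows "cmod (q - 1) \<le> cmod (q powi k - 1)"
proof -
  define t where "t = 2 * pi / e"
  have qt: "q = cis t" by (simp add: q t_def cis_conv_exp mult_ac)
  have qk: "q powi m = cis (m * t)" for m :: int
    by (simp add: qt cis_power_int)
  have per: "q powi e = 1"
    using e by (simp add: qk t_def)
  define m where "m = k mod e"
  have "q powi k = q powi (e * (k div e) + m)" by (simp add: m_def)
  also have "\<dots> = q powi m"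
    using per by (simp add: qt power_int_add power_int_mult del: cis_power_int)
  finally have km: "q powi k = cis (m * t)" by (simp only: qk)
  have "m \<noteq> 0" using ne km by auto
  then have m: "1 \<le> m" "m \<le> e - 1"
    using e pos_mod_bound[of e k] pos_mod_sign[of e k] unfolding m_def by linarith+
  have t0: "t > 0" using e by (simp add: t_def)
  have et: "e * t = 2 * pi" using e by (simp add: t_def)
  have b: "t \<le> m * t" "m * t \<le> 2 * pi - t"
    using m t0 et mult_right_mono[of 1 "real_of_int m" t] mult_right_mono[of "real_of_int m" "e - 1" t]
    by (auto simp: algebra_simps)
  have "cos (m * t) \<le> cos t"
  proof (cases "m * t \<le> pi")
    case True
    then show ?thesis using b t0 by (intro cos_monotone_0_pi_le) auto
  next
    case False
    have "cos (m * t) = cos (2 * pi - m * t)" by (simp add: cos_diff)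
    also have "\<dots> \<le> cos t" using b t0 False by (intro cos_monotone_0_pi_le) auto
    finally show ?thesis .
  qed
  moreover have "(cmod (cis s - 1))\<^sup>2 = 2 - 2 * cos s" for s
  proof -
    have "(cmod (cis s - 1))\<^sup>2 = (cos s - 1)\<^sup>2 + (sin s)\<^sup>2" by (simp add: cmod_power2)
    then show ?thesis using sin_cos_squared_add[of s] by (simp add: power2_eq_square algebra_simps)
  qed
  ultimately have "(cmod (cis t - 1))\<^sup>2 \<le> (cmod (cis (m * t) - 1))\<^sup>2" by simp
  then show ?thesis unfolding km unfolding qt by (rule power2_le_imp_le) simp
qed

lemma hecke_coeff_norm_le_1:
  fixes e j k :: int
  assumes e: "e > 1" and q: "q = exp (2 * of_real pi * \<i> / of_int e)"
  shows "cmod (hecke_coeff q (q powi j) (q powi k)) \<le> 1"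
proof (cases "q powi j = q powi k")
  case True
  then show ?thesis by simp
next
  case False
  have q0: "q \<noteq> 0" and q1: "cmod q = 1" by (simp_all add: q)
  have un: "cmod (q powi i) = 1" for i by (simp add: norm_power_int q1)
  have jk: "q powi j = q powi k * q powi (j - k)"
    using q0 by (simp flip: power_int_add)
  have "cmod (q powi k - q powi j) = cmod (q powi k * (1 - q powi (j - k)))"
    unfolding jk by (simp add: algebra_simps)
  also have "\<dots> = cmod (q powi (j - k) - 1)"
    by (simp add: norm_mult un norm_minus_commute)
  finally have eq: "cmod (q powi k - q powi j) = cmod (q powi (j - k) - 1)" .
  have "q powi (j - k) \<noteq> 1" using False jk by auto
  then have "cmod (q - 1) \<le> cmod (q powi k - q powi j)"
    unfolding eq using root_of_unity_nearest[OF e q] by blast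
  then show ?thesis using False
    by (simp add: hecke_coeff_def norm_divide norm_mult un divide_simps)
qed

section \<open>Intertwiners on weight vectors\<close>

text \<open>The operators are normalised so that \<open>T\<^sub>i X\<^sub>i T\<^sub>i = q X\<^sub>i\<^sub>+\<^sub>1\<close>. The last assumption says that no \<open>X\<^sub>j\<close> has a
  Jordan block of size two or more; calibration enters in this form.\<close>

locale hecke_module = complex_space scale Basis
  for scale :: "complex \<Rightarrow> 'v::ab_group_add \<Rightarrow> 'v" (infixr \<open>*s\<close> 75) and Basis +
  fixes n :: nat and q :: complex and T X :: "nat \<Rightarrow> 'v \<Rightarrow> 'v"
  assumes q_nz: "q \<noteq> 0" and q_ne_1: "q \<noteq> 1"
    and T_lin: "i \<in> {1..<n} \<Longrightarrow> lin (T i)"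
    and X_lin: "j \<in> {1..n} \<Longrightarrow> lin (X j)"
    and X_inj: "j \<in> {1..n} \<Longrightarrow> inj (X j)"
    and T_T: "i \<in> {1..<n} \<Longrightarrow> T i (T i v) = (q - 1) *s T i v + q *s v"
    and T_braid: "i \<in> {1..<n} \<Longrightarrow> i + 1 \<in> {1..<n} \<Longrightarrow>
      T i (T (i + 1) (T i v)) = T (i + 1) (T i (T (i + 1) v))"
    and T_far: "i \<in> {1..<n} \<Longrightarrow> j \<in> {1..<n} \<Longrightarrow> i + 1 < j \<or> j + 1 < i \<Longrightarrow> T i (T j v) = T j (T i v)"
    and X_comm: "i \<in> {1..n} \<Longrightarrow> j \<in> {1..n} \<Longrightarrow> X i (X j v) = X j (X i v)"
    and T_X_T: "i \<in> {1..<n} \<Longrightarrow> T i (X i (T i v)) = q *s X (i + 1) v"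
    and T_X_far: "i \<in> {1..<n} \<Longrightarrow> j \<in> {1..n} \<Longrightarrow> j \<noteq> i \<Longrightarrow> j \<noteq> i + 1 \<Longrightarrow> T i (X j v) = X j (T i v)"
    and X_semisimple: "j \<in> {1..n} \<Longrightarrow> X j (X j v - c *s v) = c *s (X j v - c *s v) \<Longrightarrow> X j v = c *s v"
begin

lemma X_T:
  assumes i: "i \<in> {1..<n}"
  shows "X i (T i v) = T i (X (i + 1) v) - (q - 1) *s X (i + 1) v"
proof -
  have "T i (T i (X i (T i v))) = q *s T i (X (i + 1) v)"
    unfolding T_X_T[OF i] by (rule lin_scale[OF T_lin[OF i]])
  then have "(q - 1) *s (q *s X (i + 1) v) + q *s X i (T i v) = q *s T i (X (i + 1) v)"
    unfolding T_T[OF i] unfolding T_X_T[OF i] .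
  then have "q *s X i (T i v) = q *s (T i (X (i + 1) v) - (q - 1) *s X (i + 1) v)"
    by (simp add: scale_right_diff_distrib eq_diff_eq mult.commute add.commute)
  then show ?thesis using q_nz by simp
qed

lemma X_Suc_T:
  assumes i: "i \<in> {1..<n}"
  shows "X (i + 1) (T i v) = T i (X i v) + (q - 1) *s X (i + 1) v"
proof -
  have Xi: "lin (X i)" using i by (intro X_lin) auto
  have "q *s X (i + 1) (T i v) = T i (X i (T i (T i v)))" by (simp only: T_X_T[OF i])
  also have "\<dots> = (q - 1) *s T i (X i (T i v)) + q *s T i (X i v)"
    by (simp add: T_T[OF i] lin_add[OF Xi] lin_scale[OF Xi] lin_add[OF T_lin[OF i]] lin_scale[OF T_lin[OF i]])
  also have "\<dots> = q *s (T i (X i v) + (q - 1) *s X (i + 1) v)"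
    by (simp add: T_X_T[OF i] scale_right_distrib algebra_simps)
  finally show ?thesis using q_nz by simp
qed

text \<open>The zero vector has every weight. This lets statements about intertwiners and transports
  cover the case that they vanish.\<close>

definition weight :: "(nat \<Rightarrow> complex) \<Rightarrow> 'v \<Rightarrow> bool" where
  "weight a v \<longleftrightarrow> (\<forall>j\<in>{1..n}. X j v = a j *s v)"

text \<open>The intertwiner takes the two entries of the weight as arguments, because the vector alone does not
  determine them when it is zero.\<close>

definition tau :: "nat \<Rightarrow> complex \<Rightarrow> complex \<Rightarrow> 'v \<Rightarrow> 'v" where
  "tau i x y v = T i v - hecke_coeff q x y *s v"

lemma weight_0: "weight a 0"
  unfolding weight_def using X_lin lin_zero by auto

lemma tau_0: "i \<in> {1..<n} \<Longrightarrow> tau i x y 0 = 0"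
  by (simp add: tau_def lin_zero[OF T_lin])

text \<open>If two neighbouring entries of the weight of \<open>v\<close> agreed, \<open>T i v\<close> and \<open>v\<close> would span a
  Jordan block of \<open>X i\<close>.\<close>

lemma weight_entries_ne:
  assumes w: "weight a v" and v: "v \<noteq> 0" and i: "i \<in> {1..<n}"
  shows "a i \<noteq> a (i + 1)"
proof
  assume eq: "a i = a (i + 1)"
  have in1: "i \<in> {1..n}" and in2: "i + 1 \<in> {1..n}" using i by auto
  have Xv: "X i v = a i *s v" "X (i + 1) v = a i *s v" using w in1 in2 eq by (auto simp: weight_def)
  have "X i (T i v) - a i *s T i v = - ((q - 1) * a i) *s v"
    unfolding X_T[OF i] Xv by (simp add: lin_scale[OF T_lin[OF i]] scale_minus_left)
  moreover from this have "X i (X i (T i v) - a i *s T i v) = a i *s (X i (T i v) - a i *s T i v)"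
    by (simp add: lin_scale[OF X_lin[OF in1]] Xv mult.commute mult.left_commute del: scale_minus_left)
  ultimately have "((q - 1) * a i) *s v = 0"
    using X_semisimple[OF in1, of "T i v" "a i"] by (simp add: scale_minus_left)
  then have "a i = 0" using q_ne_1 v by simp
  then have "X i v = X i 0" using Xv lin_zero[OF X_lin[OF in1]] by simp
  then show False using X_inj[OF in1] v by (auto dest: injD)
qed

lemma weight_tau:
  assumes w: "weight a v" and i: "i \<in> {1..<n}"
  shows "weight (a \<circ> adj i) (tau i (a i) (a (i + 1)) v)"
proof (cases "v = 0")
  case True
  then show ?thesis by (simp add: tau_0[OF i] weight_0)
next
  case False
  then have ne: "a i \<noteq> a (i + 1)" using weight_entries_ne w i by blast
  have in1: "i \<in> {1..n}" and in2: "i + 1 \<in> {1..n}" using i by auto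
  have Xv: "X j v = a j *s v" if "j \<in> {1..n}" for j using w that by (auto simp: weight_def)
  let ?f = "hecke_coeff q (a i) (a (i + 1))"
  have f: "(q - 1) * a (i + 1) + ?f * a i = a (i + 1) * ?f" "(q - 1) * a (i + 1) - ?f * a (i + 1) = - (a i * ?f)"
    using ne unfolding hecke_coeff_def by (simp_all add: divide_simps) (simp_all add: algebra_simps)
  have "X i (tau i (a i) (a (i + 1)) v) = a (i + 1) *s T i v - ((q - 1) * a (i + 1) + ?f * a i) *s v"
    unfolding tau_def lin_diff[OF X_lin[OF in1]] lin_scale[OF X_lin[OF in1]] X_T[OF i] Xv[OF in1] Xv[OF in2]
    by (simp add: lin_scale[OF T_lin[OF i]] scale_left_distrib algebra_simps)
  then have 1: "X i (tau i (a i) (a (i + 1)) v) = a (i + 1) *s tau i (a i) (a (i + 1)) v"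
    unfolding f by (simp add: tau_def scale_right_diff_distrib)
  have "X (i + 1) (tau i (a i) (a (i + 1)) v) = a i *s T i v + ((q - 1) * a (i + 1) - ?f * a (i + 1)) *s v"
    unfolding tau_def lin_diff[OF X_lin[OF in2]] lin_scale[OF X_lin[OF in2]] X_Suc_T[OF i] Xv[OF in1] Xv[OF in2]
    by (simp add: lin_scale[OF T_lin[OF i]] scale_left_diff_distrib algebra_simps)
  then have 2: "X (i + 1) (tau i (a i) (a (i + 1)) v) = a i *s tau i (a i) (a (i + 1)) v"
    unfolding f by (simp add: tau_def scale_right_diff_distrib scale_minus_left)
  have 3: "X j (tau i (a i) (a (i + 1)) v) = a j *s tau i (a i) (a (i + 1)) v"
    if j: "j \<in> {1..n}" "j \<noteq> i" "j \<noteq> i + 1" for j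
    using Xv[OF j(1)]
    by (simp add: tau_def lin_diff[OF X_lin[OF j(1)]] lin_scale[OF X_lin[OF j(1)]] T_X_far[OF i j, symmetric]
        lin_scale[OF T_lin[OF i]] scale_right_diff_distrib mult.commute)
  show ?thesis
    unfolding weight_def using 1 2 3 by (auto simp: transpose_def)
qed

text \<open>The intertwiner of the exchanged pair has the constant \<open>q - 1 - f\<close>, so the linear terms of the quadratic
  relation for \<open>T i\<close> cancel.\<close>

lemma tau_tau:
  assumes w: "weight a v" and i: "i \<in> {1..<n}"
  shows "tau i (a (i + 1)) (a i) (tau i (a i) (a (i + 1)) v)
    = (q + hecke_coeff q (a i) (a (i + 1)) * hecke_coeff q (a (i + 1)) (a i)) *s v"
proof (cases "v = 0")
  case True
  then show ?thesis by (simp add: tau_0[OF i])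
next
  case False
  let ?f = "hecke_coeff q (a i) (a (i + 1))" and ?g = "hecke_coeff q (a (i + 1)) (a i)"
  have g: "?g = (q - 1) - ?f" using hecke_coeff_sum[OF weight_entries_ne[OF w False i], of q] by (simp add: eq_diff_eq add.commute)
  show ?thesis
    unfolding tau_def g
    by (simp add: lin_diff[OF T_lin[OF i]] lin_scale[OF T_lin[OF i]] T_T[OF i] algebra_simps scale_left_diff_distrib
        scale_left_distrib scale_right_diff_distrib scale_right_distrib)
qed

lemma tau_far:
  assumes ij: "i \<in> {1..<n}" "j \<in> {1..<n}" "i + 1 < j \<or> j + 1 < i"
  shows "tau i x y (tau j z w v) = tau j z w (tau i x y v)"
  unfolding tau_def
  by (simp add: lin_diff[OF T_lin[OF ij(1)]] lin_scale[OF T_lin[OF ij(1)]] lin_diff[OF T_lin[OF ij(2)]]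
      lin_scale[OF T_lin[OF ij(2)]] T_far[OF ij] scale_right_diff_distrib algebra_simps)

text \<open>For three distinct entries both sides, expanded in the \<open>T\<close>'s, agree by the addition formula for
  the structure constants. If the outer entries coincide, the first step on either side puts them
  next to each other and so gives \<open>0\<close>.\<close>

lemma tau_braid:
  assumes w: "weight a v" and i: "i \<in> {1..<n}" "i + 1 \<in> {1..<n}"
  shows "tau i (a (i + 1)) (a (i + 2)) (tau (i + 1) (a i) (a (i + 2)) (tau i (a i) (a (i + 1)) v))
    = tau (i + 1) (a i) (a (i + 1)) (tau i (a i) (a (i + 2)) (tau (i + 1) (a (i + 1)) (a (i + 2)) v))"
proof (cases "v = 0")
  case True
  then show ?thesis by (simp add: tau_0[OF i(1)] tau_0[OF i(2), simplified])
next
  case v: False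
  have ne: "a i \<noteq> a (i + 1)" "a (i + 1) \<noteq> a (i + 2)"
    using weight_entries_ne[OF w v i(1)] weight_entries_ne[OF w v i(2)] by simp_all
  show ?thesis
  proof (cases "a i = a (i + 2)")
    case True
    have "tau i (a i) (a (i + 1)) v = 0"
      using weight_entries_ne[OF weight_tau[OF w i(1)] _ i(2)] True by (auto simp: transpose_def)
    moreover have "tau (i + 1) (a (i + 1)) (a (i + 2)) v = 0"
      using weight_entries_ne[OF weight_tau[OF w i(2)] _ i(1)] True by (auto simp: transpose_def)
    ultimately show ?thesis using tau_0[OF i(1)] tau_0[OF i(2)] by simp
  next
    case False
    define S where "S = T (i + 1)"
    define f g h where "f = hecke_coeff q (a i) (a (i + 1))" and "g = hecke_coeff q (a (i + 1)) (a (i + 2))"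
      and "h = hecke_coeff q (a i) (a (i + 2))"
    have fgh: "h * (f + g - (q - 1)) = f * g"
      unfolding f_def g_def h_def by (rule hecke_coeff_braid) (use ne False in auto)
    note rules = lin_add lin_diff lin_scale
    have S: "lin S" "\<And>v. S (S v) = (q - 1) *s S v + q *s v" and T: "lin (T i)"
      using T_lin i T_T by (auto simp: S_def)
    have TST: "T i (S (T i v)) = S (T i (S v))" using T_braid[OF i] by (simp add: S_def)
    have L: "tau i (a (i + 1)) (a (i + 2)) (tau (i + 1) (a i) (a (i + 2)) (tau i (a i) (a (i + 1)) v))
      = S (T i (S v)) - f *s T i (S v) - g *s S (T i v) - (h * (q - 1) - f * h - g * h) *s T i v + (f * g) *s S v
        - (h * q + f * g * h) *s v"
      unfolding tau_def f_def[symmetric] g_def[symmetric] h_def[symmetric] S_def[symmetric]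
      by (simp add: rules[OF S(1)] rules[OF T] T_T[OF i(1)] TST algebra_simps scale_left_diff_distrib
        scale_left_distrib scale_right_diff_distrib scale_right_distrib)
    have R: "tau (i + 1) (a i) (a (i + 1)) (tau i (a i) (a (i + 2)) (tau (i + 1) (a (i + 1)) (a (i + 2)) v))
      = S (T i (S v)) - f *s T i (S v) - g *s S (T i v) - (h * (q - 1) - f * h - g * h) *s S v + (f * g) *s T i v
        - (h * q + f * g * h) *s v"
      unfolding tau_def f_def[symmetric] g_def[symmetric] h_def[symmetric] S_def[symmetric]
      by (simp add: rules[OF S(1)] rules[OF T] S(2) algebra_simps scale_left_diff_distrib
        scale_left_distrib scale_right_diff_distrib scale_right_distrib)
    have "h * (q - 1) - f * h - g * h = - (f * g)" using fgh by (simp add: algebra_simps)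
    then show ?thesis unfolding L R by (simp add: scale_minus_left)
  qed
qed

end

section \<open>Transport of a weight vector along permutations\<close>

context hecke_module
begin

context
  fixes a :: "nat \<Rightarrow> complex" and v\<^sub>0 :: 'v
begin

text \<open>An arbitrary descent is undone in each step; \<open>transport_descent\<close> shows that the choice does
  not matter.\<close>

function transport :: "(nat \<Rightarrow> nat) \<Rightarrow> 'v" where
  "transport p = (if p permutes {1..n} \<and> (\<exists>i\<in>{1..<n}. p (i + 1) < p i)
     then let i = (SOME i. i \<in> {1..<n} \<and> p (i + 1) < p i)
       in tau i (a (p (i + 1))) (a (p i)) (transport (p \<circ> adj i))
     else v\<^sub>0)"
  by auto
termination
proof (relation "measure (\<lambda>p. card (inversions n p))")
  fix p i
  assume *: "p permutes {1..n} \<and> (\<exists>i\<in>{1..<n}. p (i + 1) < p i)"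
    and i: "i = (SOME i. i \<in> {1..<n} \<and> p (i + 1) < p i)"
  have "\<exists>i. i \<in> {1..<n} \<and> p (i + 1) < p i" using * by blast
  from someI_ex[OF this] show "(p \<circ> adj i, p) \<in> measure (\<lambda>p. card (inversions n p))"
    unfolding i[symmetric] using * card_inversions_comp_adj by auto
qed auto

declare transport.simps [simp del]

end

lemma transport_id: "transport a v id = v"
  by (simp add: transport.simps)

lemma transport_some_descent:
  assumes "p permutes {1..n}" "i \<in> {1..<n}" "p (i + 1) < p i"
  shows "\<exists>j\<in>{1..<n}. p (j + 1) < p j \<and>
    transport a v p = tau j (a (p (j + 1))) (a (p j)) (transport a v (p \<circ> adj j))"
proof -
  define j where "j = (SOME i. i \<in> {1..<n} \<and> p (i + 1) < p i)"
  have "\<exists>i. i \<in> {1..<n} \<and> p (i + 1) < p i" using assms by blast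
  from someI_ex[OF this] have j: "j \<in> {1..<n}" "p (j + 1) < p j" unfolding j_def[symmetric] by auto
  have "p permutes {1..n} \<and> (\<exists>i\<in>{1..<n}. p (i + 1) < p i)" using assms by blast
  then have "transport a v p = tau j (a (p (j + 1))) (a (p j)) (transport a v (p \<circ> adj j))"
    unfolding transport.simps[of a v p] j_def Let_def by (simp only: if_True simp_thms)
  then show ?thesis using j by blast
qed

lemma weight_transport:
  assumes v: "weight a v" and p: "p permutes {1..n}"
  shows "weight (a \<circ> p) (transport a v p)"
  using p
proof (induction "card (inversions n p)" arbitrary: p rule: less_induct)
  case less
  show ?case
  proof (cases "\<exists>i\<in>{1..<n}. p (i + 1) < p i")
    case True
    then obtain j where j: "j \<in> {1..<n}" "p (j + 1) < p j"
      and t: "transport a v p = tau j (a (p (j + 1))) (a (p j)) (transport a v (p \<circ> adj j))"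
      using transport_some_descent[OF less.prems] by blast
    have "weight (a \<circ> (p \<circ> adj j)) (transport a v (p \<circ> adj j))"
      using less.hyps[OF card_inversions_comp_adj[OF less.prems j]] permutes_comp_adj[OF less.prems j(1)] by blast
    from weight_tau[OF this j(1)] show ?thesis
      unfolding t by (simp add: comp_assoc adj_adj[of "a \<circ> p" j, unfolded comp_assoc])
  next
    case False
    have "p i < p (i + 1)" if "i \<in> {1..<n}" for i
    proof -
      have "p i \<noteq> p (i + 1)" using permutes_neighbours_ne[OF less.prems] .
      moreover have "\<not> p (i + 1) < p i" using False that by blast
      ultimately show ?thesis by linarith
    qed
    then have "p = id" using permutes_no_descent less.prems by blast
    then show ?thesis using v by (simp add: transport_id)
  qed
qed

text \<open>The result does not depend on which descent is undone first. Two descents can be undone in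
  either order if they are far apart, and two neighbouring ones lead, along the two sides of the
  braid relation, to the same permutation with fewer inversions.\<close>

lemma transport_descent:
  assumes v: "weight a v" and p: "p permutes {1..n}" and i: "i \<in> {1..<n}" "p (i + 1) < p i"
  shows "transport a v p = tau i (a (p (i + 1))) (a (p i)) (transport a v (p \<circ> adj i))"
  using p i
proof (induction "card (inversions n p)" arbitrary: p i rule: less_induct)
  case less
  note p = less.prems(1) and i = less.prems(2,3)
  let ?V = "transport a v"
  have step: "?V (p \<circ> adj k) = tau l (a ((p \<circ> adj k) (l + 1))) (a ((p \<circ> adj k) l)) (?V (p \<circ> adj k \<circ> adj l))"
    if "k \<in> {1..<n}" "p (k + 1) < p k" "l \<in> {1..<n}" "(p \<circ> adj k) (l + 1) < (p \<circ> adj k) l" for k l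
    using less.hyps[OF card_inversions_comp_adj[OF p that(1,2)] permutes_comp_adj[OF p that(1)] that(3,4)] .
  have step2: "?V (p \<circ> adj k \<circ> adj l) = tau m (a ((p \<circ> adj k \<circ> adj l) (m + 1))) (a ((p \<circ> adj k \<circ> adj l) m))
      (?V (p \<circ> adj k \<circ> adj l \<circ> adj m))"
    if "k \<in> {1..<n}" "p (k + 1) < p k" "l \<in> {1..<n}" "(p \<circ> adj k) (l + 1) < (p \<circ> adj k) l" "m \<in> {1..<n}"
      "(p \<circ> adj k \<circ> adj l) (m + 1) < (p \<circ> adj k \<circ> adj l) m" for k l m
  proof -
    note p' = permutes_comp_adj[OF p that(1)]
    show ?thesis
      using less.hyps[OF less_trans[OF card_inversions_comp_adj[OF p' that(3,4)]
          card_inversions_comp_adj[OF p that(1,2)]] permutes_comp_adj[OF p' that(3)] that(5,6)] .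
  qed
  have neighbours: "tau k (a (p (k + 1))) (a (p k)) (?V (p \<circ> adj k))
      = tau (k + 1) (a (p (k + 2))) (a (p (k + 1))) (?V (p \<circ> adj (k + 1)))"
    if k: "k \<in> {1..<n}" "k + 1 \<in> {1..<n}" and desc: "p (k + 1) < p k" "p (k + 2) < p (k + 1)" for k
  proof -
    define r where "r = p \<circ> adj k \<circ> adj (k + 1) \<circ> adj k"
    have r_eq: "r = p \<circ> adj (k + 1) \<circ> adj k \<circ> adj (k + 1)"
      unfolding r_def by (auto simp: fun_eq_iff transpose_def)
    have r_perm: "r permutes {1..n}"
      unfolding r_def using p k by (intro permutes_comp_adj)
    have rk: "r k = p (k + 2)" "r (k + 1) = p (k + 1)" "r (k + 2) = p k"
      by (simp_all add: r_def transpose_def)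
    have w: "weight (a \<circ> r) (?V r)" using weight_transport[OF v r_perm] .
    have d: "p (k + 2) < p k" using desc by simp
    have "?V (p \<circ> adj k) = tau (k + 1) (a (p (k + 2))) (a (p k)) (?V (p \<circ> adj k \<circ> adj (k + 1)))"
      using step[of k "k + 1"] k desc d by (simp add: transpose_def)
    also have "?V (p \<circ> adj k \<circ> adj (k + 1)) = tau k (a (p (k + 2))) (a (p (k + 1))) (?V r)"
      using step2[of k "k + 1" k] k desc d by (simp add: transpose_def r_def)
    finally have 1: "?V (p \<circ> adj k) =
      tau (k + 1) (a (p (k + 2))) (a (p k)) (tau k (a (p (k + 2))) (a (p (k + 1))) (?V r))" .
    have "?V (p \<circ> adj (k + 1)) = tau k (a (p (k + 2))) (a (p k)) (?V (p \<circ> adj (k + 1) \<circ> adj k))"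
      using step[of "k + 1" k] k desc d by (simp add: transpose_def)
    also have "?V (p \<circ> adj (k + 1) \<circ> adj k) = tau (k + 1) (a (p (k + 1))) (a (p k)) (?V r)"
      using step2[of "k + 1" k "k + 1"] k desc d unfolding r_eq by (simp add: transpose_def)
    finally have 2: "?V (p \<circ> adj (k + 1)) =
      tau k (a (p (k + 2))) (a (p k)) (tau (k + 1) (a (p (k + 1))) (a (p k)) (?V r))" .
    show ?thesis
      unfolding 1 2 using tau_braid[OF w k] unfolding comp_apply rk .
  qed
  obtain j where j: "j \<in> {1..<n}" "p (j + 1) < p j"
    and t: "?V p = tau j (a (p (j + 1))) (a (p j)) (?V (p \<circ> adj j))"
    using transport_some_descent[OF p i] by blast
  consider "i = j" | "j = i + 1" | "i = j + 1" | "i + 1 < j \<or> j + 1 < i" by linarith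
  then show ?case
  proof cases
    case 1
    then show ?thesis using t by simp
  next
    case 2
    then show ?thesis using neighbours[of i] t i j by simp
  next
    case 3
    then show ?thesis using neighbours[of j] t i j by simp
  next
    case 4
    then have nat4: "i \<noteq> j" "i \<noteq> j + 1" "i + 1 \<noteq> j" by auto
    have eq: "p \<circ> adj i \<circ> adj j = p \<circ> adj j \<circ> adj i"
      using nat4 by (auto simp: fun_eq_iff transpose_def)
    have "?V (p \<circ> adj j) = tau i (a (p (i + 1))) (a (p i)) (?V (p \<circ> adj j \<circ> adj i))"
      using step[OF j i(1)] i nat4 by (simp add: transpose_def)
    moreover have "?V (p \<circ> adj i) = tau j (a (p (j + 1))) (a (p j)) (?V (p \<circ> adj i \<circ> adj j))"
      using step[OF i j(1)] j nat4 by (simp add: transpose_def)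
    ultimately show ?thesis unfolding t eq using tau_far[OF i(1) j(1) 4] by simp
  qed
qed

lemma transport_ascent:
  assumes v: "weight a v" and p: "p permutes {1..n}" and i: "i \<in> {1..<n}" "p i < p (i + 1)"
  shows "transport a v (p \<circ> adj i) = tau i (a (p i)) (a (p (i + 1))) (transport a v p)"
  using transport_descent[OF v permutes_comp_adj[OF p i(1)] i(1)] i(2) unfolding adj_adj by simp

lemma T_transport_ascent:
  assumes v: "weight a v" and p: "p permutes {1..n}" and i: "i \<in> {1..<n}" "p i < p (i + 1)"
  shows "T i (transport a v p) = hecke_coeff q (a (p i)) (a (p (i + 1))) *s transport a v p + transport a v (p \<circ> adj i)"
  unfolding transport_ascent[OF assms] by (simp add: tau_def)

lemma T_transport_descent:
  assumes v: "weight a v" and p: "p permutes {1..n}" and i: "i \<in> {1..<n}" "p (i + 1) < p i"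
  shows "T i (transport a v p) = hecke_coeff q (a (p i)) (a (p (i + 1))) *s transport a v p +
    (q + hecke_coeff q (a (p i)) (a (p (i + 1))) * hecke_coeff q (a (p (i + 1))) (a (p i))) *s transport a v (p \<circ> adj i)"
proof -
  have e: "(a \<circ> (p \<circ> adj i)) i = a (p (i + 1))" "(a \<circ> (p \<circ> adj i)) (i + 1) = a (p i)" by simp_all
  have "tau i (a (p i)) (a (p (i + 1))) (transport a v p) =
    (q + hecke_coeff q (a (p i)) (a (p (i + 1))) * hecke_coeff q (a (p (i + 1))) (a (p i))) *s transport a v (p \<circ> adj i)"
    using tau_tau[OF weight_transport[OF v permutes_comp_adj[OF p i(1)]] i(1)]
    unfolding e transport_descent[OF v p i] by (simp only: mult.commute)
  then show ?thesis unfolding tau_def by (simp only: diff_eq_eq add.commute)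
qed

text \<open>Entries of the weight that agree never change their order: just before they did, they would be
  neighbours.\<close>

lemma transport_inversion_labels:
  assumes v: "weight a v" and p: "p permutes {1..n}" and nz: "transport a v p \<noteq> 0"
    and xy: "(x, y) \<in> inversions n p"
  shows "a x \<noteq> a y"
  using p nz xy
proof (induction arbitrary: x y rule: permutes_ascent_induct)
  case id
  then show ?case unfolding inversions_id by blast
next
  case (ascent p i)
  have nz: "transport a v p \<noteq> 0"
    using ascent.prems(1) tau_0[OF ascent.hyps(2)] unfolding transport_ascent[OF v ascent.hyps] by auto
  have "a (p i) \<noteq> a (p (i + 1))"
    using weight_entries_ne[OF weight_transport[OF v ascent.hyps(1)] nz ascent.hyps(2)] by simp
  moreover have "(x, y) \<in> insert (p i, p (i + 1)) (inversions n p)"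
    using ascent.prems(2) unfolding inversions_comp_adj(1)[OF ascent.hyps] .
  ultimately show ?case using ascent.IH[OF nz] by blast
qed

lemma transports_independent:
  assumes v: "weight a v" and P: "finite P" "\<And>p. p \<in> P \<Longrightarrow> p permutes {1..n}" "\<And>p. p \<in> P \<Longrightarrow> transport a v p \<noteq> 0"
    and sum: "(\<Sum>p\<in>P. c p *s transport a v p) = 0" and p: "p \<in> P"
  shows "c p = 0"
proof (rule joint_eigenvectors_independent[where X = X and J = "{1..n}" and I = P
      and a = "\<lambda>p. a \<circ> p" and u = "transport a v" and c = c])
  show "X j (transport a v p) = (a \<circ> p) j *s transport a v p" if "p \<in> P" "j \<in> {1..n}" for p j
    using weight_transport[OF v P(2)[OF that(1)]] that(2) by (auto simp: weight_def)
  show "\<exists>j\<in>{1..n}. (a \<circ> p) j \<noteq> (a \<circ> r) j" if "p \<in> P" "r \<in> P" "p \<noteq> r" for p r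
  proof (rule ccontr)
    assume "\<not> ?thesis"
    then have "a (p j) = a (r j)" if "j \<in> {1..n}" for j using that by auto
    then have "p = r"
      using P that transport_inversion_labels[OF v]
      by (intro permutes_eq_if_labels_eq[of p n r a]) blast+
    then show False using that by blast
  qed
qed (use assms X_lin in auto)

definition submodule :: "'v set \<Rightarrow> bool" where
  "submodule W \<longleftrightarrow> subspace W \<and> (\<forall>i\<in>{1..<n}. T i ` W \<subseteq> W) \<and> (\<forall>j\<in>{1..n}. X j ` W \<subseteq> W)"

definition minimal_submodule :: "'v set \<Rightarrow> bool" where
  "minimal_submodule U \<longleftrightarrow> submodule U \<and> U \<noteq> {0} \<and> (\<forall>W. submodule W \<longrightarrow> W \<subseteq> U \<longrightarrow> W \<noteq> {0} \<longrightarrow> W = U)"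

lemma submodule_span_transports:
  assumes v: "weight a v" and P: "\<And>p. p \<in> P \<Longrightarrow> p permutes {1..n}"
    and closed: "\<And>p i. p \<in> P \<Longrightarrow> i \<in> {1..<n} \<Longrightarrow> T i (transport a v p) \<in> span (transport a v ` P)"
  shows "submodule (span (transport a v ` P))"
  unfolding submodule_def
proof (intro conjI ballI)
  fix i assume "i \<in> {1..<n}"
  then show "T i ` span (transport a v ` P) \<subseteq> span (transport a v ` P)"
    using closed by (intro lin_span_subset T_lin) auto
next
  fix j assume j: "j \<in> {1..n}"
  have "X j (transport a v p) \<in> span (transport a v ` P)" if "p \<in> P" for p
  proof -
    have "X j (transport a v p) = a (p j) *s transport a v p"
      using weight_transport[OF v P[OF that]] j by (auto simp: weight_def)
    then show ?thesis using that by (auto intro: span_scale span_base)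
  qed
  then show "X j ` span (transport a v ` P) \<subseteq> span (transport a v ` P)"
    using j by (intro lin_span_subset X_lin) auto
qed simp

text \<open>By minimality, any set of transports that is stable under the \<open>T\<^sub>i\<close> and not zero spans \<open>U\<close>; stability
  under the \<open>X\<^sub>j\<close> is automatic for weight vectors.\<close>

lemma minimal_submodule_eqI:
  assumes U: "minimal_submodule U" and v: "weight a v" "v \<in> U"
    and P: "\<And>p. p \<in> P \<Longrightarrow> p permutes {1..n}"
    and closed: "\<And>p i. p \<in> P \<Longrightarrow> i \<in> {1..<n} \<Longrightarrow> T i (transport a v p) \<in> span (transport a v ` P)"
    and nz: "\<exists>p\<in>P. transport a v p \<noteq> 0"
  shows "span (transport a v ` P) = U"
proof -
  have sub: "submodule U" using U by (simp add: minimal_submodule_def)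
  then have subU: "subspace U" by (simp add: submodule_def)
  have "transport a v p \<in> U" if "p permutes {1..n}" for p
    using that
  proof (induction rule: permutes_ascent_induct)
    case id
    show ?case unfolding transport_id by (rule v(2))
  next
    case (ascent p i)
    then have "T i (transport a v p) \<in> U" using sub unfolding submodule_def by blast
    then show ?case
      unfolding transport_ascent[OF v(1) ascent.hyps] tau_def
      using ascent.IH subU by (intro subspace_diff subspace_scale)
  qed
  then have "span (transport a v ` P) \<subseteq> U" using P subU by (intro span_minimal) auto
  moreover have "span (transport a v ` P) \<noteq> {0}" using nz span_base[of _ "transport a v ` P"] by blast
  ultimately show ?thesis
    using U submodule_span_transports[OF v(1) P closed] unfolding minimal_submodule_def by blast
qed

lemma minimal_submodule_spanned:
  assumes U: "minimal_submodule U" and v: "weight a v" "v \<in> U" "v \<noteq> 0"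
  shows "span (transport a v ` {p. p permutes {1..n}}) = U"
proof (rule minimal_submodule_eqI[OF U v(1,2)])
  fix p i assume p: "p \<in> {p. p permutes {1..n}}" and i: "i \<in> {1..<n}"
  have base: "transport a v r \<in> span (transport a v ` {p. p permutes {1..n}})" if "r permutes {1..n}" for r
    using that by (auto intro: span_base)
  have p': "p \<circ> adj i permutes {1..n}" using p i permutes_comp_adj by blast
  show "T i (transport a v p) \<in> span (transport a v ` {p. p permutes {1..n}})"
  proof (cases "p i < p (i + 1)")
    case True
    have pp: "p permutes {1..n}" using p by blast
    show ?thesis
      unfolding T_transport_ascent[OF v(1) pp i True] using base[OF pp] base[OF p'] by (intro span_add span_scale)
  next
    case False
    moreover have "p i \<noteq> p (i + 1)" using p permutes_neighbours_ne by blast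
    ultimately have desc: "p (i + 1) < p i" by linarith
    have pp: "p permutes {1..n}" using p by blast
    show ?thesis
      unfolding T_transport_descent[OF v(1) pp i desc] using base[OF pp] base[OF p'] by (intro span_add span_scale)
  qed
next
  show "\<exists>p\<in>{p. p permutes {1..n}}. transport a v p \<noteq> 0"
    by (rule bexI[of _ id]) (simp_all only: transport_id v(3) permutes_id mem_Collect_eq not_False_eq_True)
qed auto

text \<open>If the intertwiner exchanging \<open>x\<close> and \<open>y\<close> squares to zero, then the transports that have
  exchanged them span a submodule: there is no way back. It does not contain \<open>v\<close>, so minimality
  forces it to vanish.\<close>

lemma transport_eq_0_if_degenerate:
  assumes U: "minimal_submodule U" and v: "weight a v" "v \<in> U" "v \<noteq> 0"
    and p: "p permutes {1..n}" "(x, y) \<in> inversions n p"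
    and deg: "q + hecke_coeff q (a x) (a y) * hecke_coeff q (a y) (a x) = 0"
  shows "transport a v p = 0"
proof (rule ccontr)
  assume nz: "transport a v p \<noteq> 0"
  define P where "P = {p. p permutes {1..n} \<and> (x, y) \<in> inversions n p}"
  have fin: "finite P"
    by (rule finite_subset[OF _ finite_permutations[of "{1..n}"]]) (auto simp: P_def)
  have base: "transport a v r \<in> span (transport a v ` P)" if "r \<in> P" for r
    using that by (auto intro: span_base)
  have "span (transport a v ` P) = U"
  proof (rule minimal_submodule_eqI[OF U v(1,2)])
    fix p i assume p: "p \<in> P" and i: "i \<in> {1..<n}"
    have pp: "p permutes {1..n}" using p by (simp add: P_def)
    have p': "p \<circ> adj i permutes {1..n}" using pp i permutes_comp_adj by blast
    show "T i (transport a v p) \<in> span (transport a v ` P)"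
    proof (cases "p i < p (i + 1)")
      case True
      have "p \<circ> adj i \<in> P"
        using p p' inversions_comp_adj(1)[OF pp i True] unfolding P_def by blast
      then show ?thesis
        using T_transport_ascent[OF v(1) pp i True] base p by (auto intro: span_add span_scale)
    next
      case False
      moreover have "p i \<noteq> p (i + 1)" using permutes_neighbours_ne[OF pp] .
      ultimately have desc: "p (i + 1) < p i" by linarith
      have inv: "inversions n p = insert (p (i + 1), p i) (inversions n (p \<circ> adj i))"
        using inversions_comp_adj_descent(1)[OF pp i desc] .
      define c where "c = q + hecke_coeff q (a (p i)) (a (p (i + 1))) * hecke_coeff q (a (p (i + 1))) (a (p i))"
      have Tp: "T i (transport a v p) = hecke_coeff q (a (p i)) (a (p (i + 1))) *s transport a v p +
          c *s transport a v (p \<circ> adj i)"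
        unfolding c_def by (rule T_transport_descent[OF v(1) pp i desc])
      show ?thesis
      proof (cases "(x, y) = (p (i + 1), p i)")
        case True
        then have "c = 0" using deg by (simp add: c_def mult.commute)
        then show ?thesis using Tp base[OF p] by (auto intro: span_scale)
      next
        case False
        then have "p \<circ> adj i \<in> P" using p p' inv unfolding P_def by blast
        then show ?thesis unfolding Tp using base p by (intro span_add span_scale)
      qed
    qed
  next
    show "\<exists>p\<in>P. transport a v p \<noteq> 0" using nz p by (auto simp: P_def)
  qed (auto simp: P_def)
  then have "v \<in> span (transport a v ` P)" using v by simp
  then obtain c where c: "v = (\<Sum>p\<in>P. c p *s transport a v p)"
    using span_image_finite_sum[OF fin] by blast
  define Q where "Q = {p\<in>P. transport a v p \<noteq> 0}"
  have id: "id \<notin> Q" by (simp add: Q_def P_def inversions_id)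
  have finQ: "finite Q" using fin by (simp add: Q_def)
  have "v = (\<Sum>p\<in>Q. c p *s transport a v p)"
    unfolding Q_def by (subst c, rule sum.mono_neutral_right) (use fin in auto)
  moreover have "(\<Sum>p\<in>Q. (c(id := - 1)) p *s transport a v p) = (\<Sum>p\<in>Q. c p *s transport a v p)"
  proof (rule sum.cong[OF HOL.refl])
    fix r assume "r \<in> Q"
    then have "r \<noteq> id" using id by blast
    then show "(c(id := - 1)) r *s transport a v r = c r *s transport a v r"
      by (simp only: fun_upd_other not_False_eq_True)
  qed
  ultimately have "(c(id := - 1)) id *s transport a v id + (\<Sum>p\<in>Q. (c(id := - 1)) p *s transport a v p) = 0"
    unfolding transport_id fun_upd_same by (simp only: scale_minus_left scale_one add.left_inverse)
  then have "(\<Sum>p\<in>insert id Q. (c(id := - 1)) p *s transport a v p) = 0"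
    unfolding sum.insert[OF finQ id] .
  then have "(c(id := - 1)) id = 0"
  proof (rule transports_independent[OF v(1), rotated 3])
    show "r permutes {1..n}" if "r \<in> insert id Q" for r
      using that permutes_id by (auto simp: Q_def P_def simp del: id_apply)
    show "transport a v r \<noteq> 0" if "r \<in> insert id Q" for r
    proof (cases "r = id")
      case True
      show ?thesis unfolding True transport_id by (rule v(3))
    next
      case False
      then show ?thesis using that unfolding Q_def by blast
    qed
  qed (use finQ in simp_all)
  then show False by simp
qed

end

section \<open>The invariant form\<close>

text \<open>The cyclotomic relation enters through the eigenvalues of \<open>X\<^sub>1\<close>, the roots of the polynomial that it
  provides.\<close>

locale calibrated_module = hecke_module scale Basis n q T X
  for scale :: "complex \<Rightarrow> 'v::ab_group_add \<Rightarrow> 'v" (infixr \<open>*s\<close> 75) and Basis n q T X +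
  fixes e :: int
  assumes e_gt_1: "e > 1" and q_eq: "q = exp (2 * of_real pi * \<i> / of_int e)"
    and X_1_eigenvalue: "1 \<in> {1..n} \<Longrightarrow> X 1 v = c *s v \<Longrightarrow> v \<noteq> 0 \<Longrightarrow> \<exists>k::int. c = q powi k"
begin

lemma norm_q: "cmod q = 1"
  by (simp add: q_eq)

lemma norm_q_powi: "cmod (q powi k) = 1"
  by (simp add: norm_power_int norm_q)

text \<open>Intertwiners move an entry of the weight to the left, one place at a time, until it is an eigenvalue of
  \<open>X\<^sub>1\<close>. An intertwiner that vanishes stops it, but then the two entries differ by a factor \<open>q\<close>, up to inversion.\<close>

lemma weight_powers:
  assumes "weight a v" "v \<noteq> 0" "j \<in> {1..n}"
  shows "\<exists>k::int. a j = q powi k"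
proof -
  have "1 \<le> j" "j \<le> n" using assms by auto
  then show ?thesis
    using assms(1,2)
  proof (induction j arbitrary: a v rule: nat_induct_at_least)
    case base
    then have 1: "1 \<in> {1..n}" by simp
    then have "X 1 v = a 1 *s v" using base.prems(2) unfolding weight_def by blast
    then show ?case using X_1_eigenvalue[OF 1] base.prems(3) by blast
  next
    case (Suc j)
    then have j: "j \<in> {1..<n}" by auto
    note w = Suc.prems(2) and nz = Suc.prems(3)
    obtain k :: int where k: "a j = q powi k" using Suc.IH[OF _ w nz] Suc.prems(1) by auto
    let ?u = "tau j (a j) (a (j + 1)) v"
    show ?case
    proof (cases "?u = 0")
      case False
      have "\<exists>k::int. (a \<circ> adj j) j = q powi k"
        using Suc.IH[OF _ weight_tau[OF w j] False] Suc.prems(1) by auto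
      then show ?thesis by simp
    next
      case True
      have ne: "a j \<noteq> a (j + 1)" using weight_entries_ne[OF w nz j] .
      have "(q + hecke_coeff q (a j) (a (j + 1)) * hecke_coeff q (a (j + 1)) (a j)) *s v = 0"
        using tau_tau[OF w j] unfolding True tau_0[OF j] by simp
      then have "(q * a (j + 1) - a j) * (a (j + 1) - q * a j) = 0"
        unfolding hecke_coeff_mult[OF ne] using nz ne by simp
      then have "q * a (j + 1) - a j = 0 \<or> a (j + 1) - q * a j = 0" by (simp only: mult_eq_0_iff)
      then have "a (j + 1) = a j * q powi 1 \<or> a (j + 1) = a j * q powi (- 1)"
        using q_nz by (auto simp: field_simps power_int_minus)
      then show ?thesis
        unfolding k power_int_add[OF disjI1[OF q_nz], symmetric]
        by (metis Suc_eq_plus1)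
    qed
  qed
qed

text \<open>The squared length of the transport along \<open>p\<close>, relative to that of the original vector. Each
  factor is what a unitary \<open>T i\<close> leaves for the intertwiner: if \<open>T i u = f u + \<tau> u\<close> with \<open>u\<close> a unit vector and
  \<open>\<tau> u\<close> orthogonal to \<open>u\<close>, then \<open>\<tau> u\<close> has squared length \<open>1 - |f|\<^sup>2\<close>.\<close>

definition factor :: "(nat \<Rightarrow> complex) \<Rightarrow> nat \<Rightarrow> nat \<Rightarrow> real" where
  "factor a x y = 1 - (cmod (hecke_coeff q (a x) (a y)))\<^sup>2"

definition norm_sq :: "(nat \<Rightarrow> complex) \<Rightarrow> (nat \<Rightarrow> nat) \<Rightarrow> real" where
  "norm_sq a p = (\<Prod>(x, y)\<in>inversions n p. factor a x y)"

lemma norm_sq_ascent: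
  assumes "p permutes {1..n}" "i \<in> {1..<n}" "p i < p (i + 1)"
  shows "norm_sq a (p \<circ> adj i) = factor a (p i) (p (i + 1)) * norm_sq a p"
  unfolding norm_sq_def inversions_comp_adj(1)[OF assms]
  using inversions_comp_adj(2)[OF assms] finite_inversions by simp

lemma norm_sq_descent:
  assumes "p permutes {1..n}" "i \<in> {1..<n}" "p (i + 1) < p i"
  shows "norm_sq a p = factor a (p (i + 1)) (p i) * norm_sq a (p \<circ> adj i)"
  unfolding norm_sq_def inversions_comp_adj_descent(1)[OF assms]
  using inversions_comp_adj_descent(2)[OF assms] finite_inversions by simp

context
  fixes a :: "nat \<Rightarrow> complex" and v :: 'v and U :: "'v set"
  assumes U: "minimal_submodule U" and w: "weight a v" and v: "v \<in> U" "v \<noteq> 0"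
begin

lemma norm_a: "j \<in> {1..n} \<Longrightarrow> cmod (a j) = 1"
  using weight_powers[OF w v(2)] norm_q_powi by metis

lemma factor_nonneg: "x \<in> {1..n} \<Longrightarrow> y \<in> {1..n} \<Longrightarrow> factor a x y \<ge> 0"
proof -
  assume "x \<in> {1..n}" "y \<in> {1..n}"
  then have "cmod (hecke_coeff q (a x) (a y)) \<le> 1"
    using weight_powers[OF w v(2)] hecke_coeff_norm_le_1[OF e_gt_1 q_eq] by metis
  then show ?thesis by (simp add: factor_def power_le_one)
qed

lemma q_factor:
  "x \<in> {1..n} \<Longrightarrow> y \<in> {1..n} \<Longrightarrow> a x \<noteq> a y \<Longrightarrow>
    q + hecke_coeff q (a x) (a y) * hecke_coeff q (a y) (a x) = q * of_real (factor a x y)"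
  unfolding factor_def by (rule hecke_coeff_norm) (auto simp: norm_a norm_q)

lemma norm_sq_nonneg: "norm_sq a p \<ge> 0"
  unfolding norm_sq_def by (rule prod_nonneg) (auto simp: inversions_def intro: factor_nonneg)

lemma perm_range: "p permutes {1..n} \<Longrightarrow> i \<in> {1..<n} \<Longrightarrow> p i \<in> {1..n} \<and> p (i + 1) \<in> {1..n}"
  using permutes_in_image[of p "{1..n}" i] permutes_in_image[of p "{1..n}" "i + 1"] by simp

text \<open>If the transport vanishes, then some intertwiner on the way maps a nonzero weight vector to zero, so its
  square \<open>q (1 - |f|\<^sup>2)\<close> is zero. The converse is \<open>transport_eq_0_if_degenerate\<close>.\<close>

lemma transport_eq_0_iff:
  assumes p: "p permutes {1..n}"
  shows "transport a v p = 0 \<longleftrightarrow> norm_sq a p = 0"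
proof
  show "norm_sq a p = 0" if "transport a v p = 0"
    using p that
  proof (induction rule: permutes_ascent_induct)
    case id
    then show ?case using v(2) unfolding transport_id by blast
  next
    case (ascent p i)
    note hyps = ascent.hyps
    show ?case
    proof (cases "transport a v p = 0")
      case True
      then show ?thesis unfolding norm_sq_ascent[OF hyps] using ascent.IH by simp
    next
      case False
      have wp: "weight (a \<circ> p) (transport a v p)" using weight_transport[OF w hyps(1)] .
      have ne: "a (p i) \<noteq> a (p (i + 1))" using weight_entries_ne[OF wp False hyps(2)] by simp
      have "tau i (a (p i)) (a (p (i + 1))) (transport a v p) = 0"
        using ascent.prems unfolding transport_ascent[OF w hyps] .
      then have "(q + hecke_coeff q (a (p i)) (a (p (i + 1))) * hecke_coeff q (a (p (i + 1))) (a (p i)))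
          *s transport a v p = 0"
        using tau_tau[OF wp hyps(2)] tau_0[OF hyps(2)] unfolding comp_apply by metis
      then have "factor a (p i) (p (i + 1)) = 0"
        using False q_nz perm_range[OF hyps(1,2)] ne by (simp add: q_factor)
      then show ?thesis unfolding norm_sq_ascent[OF hyps] by simp
    qed
  qed
next
  assume "norm_sq a p = 0"
  then obtain x y where xy: "(x, y) \<in> inversions n p" "factor a x y = 0"
    unfolding norm_sq_def using finite_inversions[of n p] by auto
  show "transport a v p = 0"
  proof (rule ccontr)
    assume nz: "transport a v p \<noteq> 0"
    have "a x \<noteq> a y" using transport_inversion_labels[OF w p nz xy(1)] .
    moreover have "x \<in> {1..n}" "y \<in> {1..n}" using xy(1) by (auto simp: inversions_def)
    ultimately have "q + hecke_coeff q (a x) (a y) * hecke_coeff q (a y) (a x) = 0"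
      using xy(2) q_factor by simp
    then show False using transport_eq_0_if_degenerate[OF U w v p xy(1)] nz by blast
  qed
qed

text \<open>On the transports along \<open>p\<close> and \<open>p \<circ> adj i\<close>, the operator \<open>T i\<close> is a two-by-two matrix; the three
  lemmas on unitarity say that its columns are orthonormal when the squared lengths are given by
  \<open>norm_sq\<close>.\<close>

definition off_diag :: "nat \<Rightarrow> (nat \<Rightarrow> nat) \<Rightarrow> complex" where
  "off_diag i p = (if p i < p (i + 1) then 1 else q * of_real (factor a (p (i + 1)) (p i)))"

lemma T_transport:
  assumes p: "p permutes {1..n}" and i: "i \<in> {1..<n}"
  shows "T i (transport a v p) = hecke_coeff q (a (p i)) (a (p (i + 1))) *s transport a v p
    + off_diag i p *s transport a v (p \<circ> adj i)"
proof (cases "p i < p (i + 1)")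
  case True
  then show ?thesis unfolding T_transport_ascent[OF w p i True] off_diag_def by simp
next
  case False
  then have desc: "p (i + 1) < p i" using permutes_neighbours_ne[OF p, of i] by linarith
  have p': "p \<circ> adj i permutes {1..n}" using permutes_comp_adj[OF p i] .
  show ?thesis
  proof (cases "a (p i) = a (p (i + 1))")
    case True
    have "transport a v (p \<circ> adj i) = 0"
      using weight_entries_ne[OF weight_transport[OF w p'] _ i] True by fastforce
    then show ?thesis unfolding T_transport_descent[OF w p i desc] by simp
  next
    case ne: False
    have "q + hecke_coeff q (a (p i)) (a (p (i + 1))) * hecke_coeff q (a (p (i + 1))) (a (p i))
        = q * of_real (factor a (p (i + 1)) (p i))"
      using q_factor[of "p (i + 1)" "p i"] perm_range[OF p i] ne by (simp add: mult.commute)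
    then show ?thesis
      unfolding T_transport_descent[OF w p i desc] off_diag_def using False by simp
  qed
qed

lemma unitary_diagonal:
  assumes p: "p permutes {1..n}" and i: "i \<in> {1..<n}"
  shows "(cmod (hecke_coeff q (a (p i)) (a (p (i + 1)))))\<^sup>2 * norm_sq a p
    + (cmod (off_diag i p))\<^sup>2 * norm_sq a (p \<circ> adj i) = norm_sq a p"
proof (cases "p i < p (i + 1)")
  case True
  then show ?thesis
    unfolding norm_sq_ascent[OF p i True] off_diag_def factor_def by (simp add: algebra_simps)
next
  case False
  then have desc: "p (i + 1) < p i" using permutes_neighbours_ne[OF p, of i] by linarith
  have "cmod (hecke_coeff q (a (p i)) (a (p (i + 1)))) = cmod (hecke_coeff q (a (p (i + 1))) (a (p i)))"
    using hecke_coeff_norm_commute[of "a (p (i + 1))" "a (p i)" q] perm_range[OF p i] norm_a norm_q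
    by (cases "a (p (i + 1)) = a (p i)") auto
  then have "(cmod (hecke_coeff q (a (p i)) (a (p (i + 1)))))\<^sup>2 = 1 - factor a (p (i + 1)) (p i)"
    by (simp add: factor_def)
  moreover have "(cmod (off_diag i p))\<^sup>2 = (factor a (p (i + 1)) (p i))\<^sup>2"
    using False by (simp add: off_diag_def norm_mult norm_q)
  ultimately show ?thesis
    unfolding norm_sq_descent[OF p i desc] by (simp only:) (simp add: power2_eq_square algebra_simps)
qed

lemma unitary_off_diagonal_ascent:
  assumes p: "p permutes {1..n}" and i: "i \<in> {1..<n}" and asc: "p i < p (i + 1)"
  shows "hecke_coeff q (a (p i)) (a (p (i + 1))) * cnj (off_diag i (p \<circ> adj i)) * norm_sq a p
    + off_diag i p * cnj (hecke_coeff q (a (p (i + 1))) (a (p i))) * norm_sq a (p \<circ> adj i) = 0"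
proof -
  have od: "off_diag i (p \<circ> adj i) = q * of_real (factor a (p i) (p (i + 1)))" "off_diag i p = 1"
    using asc by (simp_all add: off_diag_def)
  have "hecke_coeff q (a (p i)) (a (p (i + 1))) * cnj q + cnj (hecke_coeff q (a (p (i + 1))) (a (p i))) = 0"
  proof (cases "a (p i) = a (p (i + 1))")
    case False
    have "cnj q = 1 / q"
      using complex_norm_square[of q] norm_q q_nz by (simp add: field_simps)
    then show ?thesis
      using cnj_hecke_coeff[of "a (p i)" "a (p (i + 1))" q] False perm_range[OF p i] norm_a norm_q by simp
  qed simp
  then have "(hecke_coeff q (a (p i)) (a (p (i + 1))) * cnj q + cnj (hecke_coeff q (a (p (i + 1))) (a (p i))))
      * (factor a (p i) (p (i + 1)) * norm_sq a p) = 0"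
    by simp
  then show ?thesis
    unfolding norm_sq_ascent[OF p i asc] od by (simp add: algebra_simps)
qed

lemma unitary_off_diagonal:
  assumes p: "p permutes {1..n}" and i: "i \<in> {1..<n}"
  shows "hecke_coeff q (a (p i)) (a (p (i + 1))) * cnj (off_diag i (p \<circ> adj i)) * norm_sq a p
    + off_diag i p * cnj (hecke_coeff q (a (p (i + 1))) (a (p i))) * norm_sq a (p \<circ> adj i) = 0"
proof (cases "p i < p (i + 1)")
  case True
  then show ?thesis using unitary_off_diagonal_ascent[OF p i] by blast
next
  case False
  have p': "p \<circ> adj i permutes {1..n}" using permutes_comp_adj[OF p i] .
  have "(p \<circ> adj i) i < (p \<circ> adj i) (i + 1)"
    using permutes_neighbours_ne[OF p, of i] False by simp
  note asc = unitary_off_diagonal_ascent[OF p' i this]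
  have e: "(p \<circ> adj i) i = p (i + 1)" "(p \<circ> adj i) (i + 1) = p i" by simp_all
  from arg_cong[OF asc, of cnj] show ?thesis
    unfolding adj_adj e complex_cnj_add complex_cnj_mult complex_cnj_cnj complex_cnj_complex_of_real
      complex_cnj_zero
    by (simp only: mult.commute add.commute)
qed

text \<open>The form is the one in which the transports are orthogonal with squared lengths \<open>norm_sq\<close>, composed with the
  projection onto \<open>U\<close> along the invariant complement \<open>W\<close>. It is written with coordinates in the basis of
  nonzero transports, but evaluated on all of them: for a transport that is zero, \<open>norm_sq\<close> is zero too.\<close>

lemma invariant_form_exists:
  assumes W: "submodule W" and int: "U \<inter> W = {0}" and sum: "{u + w | u w. u \<in> U \<and> w \<in> W} = UNIV"
  shows "\<exists>h. hermitian h \<and> (\<forall>v. Re (h v v) \<ge> 0) \<and> (\<forall>i\<in>{1..<n}. preserves h (T i)) \<and>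
    (\<forall>j\<in>{1..n}. preserves h (X j)) \<and> (\<forall>u\<in>U. u \<noteq> 0 \<longrightarrow> Re (h u u) > 0)"
proof -
  define t where "t = transport a v"
  define S where "S = {p. p permutes {1..n}}"
  define P where "P = {p\<in>S. t p \<noteq> 0}"
  have finS: "finite S" unfolding S_def by (rule finite_permutations) simp
  have finP: "finite P" using finS by (simp add: P_def)
  have subU: "subspace U" and subW: "subspace W"
    using U W by (auto simp: minimal_submodule_def submodule_def)
  have spanS: "span (t ` S) = U"
    unfolding t_def S_def by (rule minimal_submodule_spanned[OF U w v])
  have tS: "t ` S \<subseteq> insert 0 (t ` P)" by (auto simp: P_def)
  have spanP: "span (t ` P) = U"
  proof
    show "span (t ` P) \<subseteq> U" unfolding spanS[symmetric] by (rule span_mono) (auto simp: P_def)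
    show "U \<subseteq> span (t ` P)" unfolding spanS[symmetric] using span_mono[OF tS] by simp
  qed
  have indep: "c p = 0" if "(\<Sum>p\<in>P. c p *s t p) = 0" "p \<in> P" for c p
  proof (rule transports_independent[OF w finP _ _ _ that(2)])
    show "(\<Sum>p\<in>P. c p *s transport a v p) = 0" using that(1) unfolding t_def .
  qed (auto simp: P_def S_def t_def)
  have inj: "inj_on t P"
  proof (rule inj_onI, rule ccontr)
    fix p r assume pr: "p \<in> P" "r \<in> P" "t p = t r" "p \<noteq> r"
    \<comment> \<open>the coefficients of the relation \<open>t p - t r = 0\<close>\<close>
    let ?c = "\<lambda>x. (if x = p then 1 else 0) - (if x = r then 1 else 0) :: complex"
    have "(\<Sum>x\<in>P. ?c x *s t x) = 0"
      using pr finP by (simp add: scale_left_diff_distrib sum_subtractf if_distrib[of "\<lambda>c. c *s _"] cong: if_cong)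
    then have "?c p = 0" by (rule indep) (rule pr(1))
    then show False using pr(4) by simp
  qed
  have ind: "independent (t ` P)"
  proof (rule independent_if_scalars_zero)
    show "finite (t ` P)" using finP by simp
    fix f x assume "(\<Sum>x\<in>t ` P. f x *s x) = 0" and x: "x \<in> t ` P"
    then have "(\<Sum>p\<in>P. f (t p) *s t p) = 0" by (simp add: sum.reindex[OF inj])
    then have "f (t p) = 0" if "p \<in> P" for p by (rule indep) (rule that)
    then show "f x = 0" using x by blast
  qed
  obtain \<pi> where \<pi>: "lin \<pi>" "\<And>u. u \<in> U \<Longrightarrow> \<pi> u = u" "\<And>w. w \<in> W \<Longrightarrow> \<pi> w = 0" "\<And>x. \<pi> x \<in> U"
    using complement_projection[OF subU subW int sum] by blast
  define c where "c p x = representation (t ` P) (\<pi> x) (t p)" for p x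
  have \<pi>_span: "\<pi> x \<in> span (t ` P)" for x using \<pi>(4) spanP by simp
  have c_add: "c p (x + y) = c p x + c p y" and c_scale: "c p (k *s x) = k * c p x" for p x y k
    unfolding c_def lin_add[OF \<pi>(1)] lin_scale[OF \<pi>(1)]
    using representation_add[OF ind \<pi>_span \<pi>_span] representation_scale[OF ind \<pi>_span] by simp_all
  have c_t: "c p (t r) = (if p = r then 1 else 0)" if "p \<in> P" "r \<in> S" for p r
  proof (cases "r \<in> P")
    case True
    have "t r \<in> U" using span_base[of "t r" "t ` S"] that spanS by auto
    then have "c p (t r) = (if t p = t r then 1 else 0)"
      unfolding c_def using representation_basis[OF ind, of "t r"] True by (simp add: \<pi>(2))
    then show ?thesis using inj that(1) True by (auto dest: inj_onD)
  next
    case False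
    then have "t r = 0" using that by (simp add: P_def)
    then show ?thesis
      using c_scale[of p 0 0] False that by auto
  qed
  have c_W: "c p x = 0" if "x \<in> W" for p x
    unfolding c_def \<pi>(3)[OF that] by (simp add: representation_zero)
  define h where "h x y = (\<Sum>p\<in>P. of_real (norm_sq a p) * c p x * cnj (c p y))" for x y
  have herm: "hermitian h"
    unfolding hermitian_def
  proof (intro conjI allI)
    show "h (x + y) z = h x z + h y z" for x y z
      unfolding h_def c_add sum.distrib[symmetric] by (simp only: distrib_left distrib_right)
    show "h (k *s x) y = k * h x y" for k x y
      unfolding h_def c_scale sum_distrib_left by (simp only: mult_ac)
    show "h y x = cnj (h x y)" for x y
      unfolding h_def cnj_sum by (simp add: mult_ac)
  qed
  have h_self: "h x x = of_real (\<Sum>p\<in>P. norm_sq a p * (cmod (c p x))\<^sup>2)" for x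
    unfolding h_def by (simp add: complex_norm_square mult.assoc flip: of_real_power)
  have h_t: "h (t p) (t r) = (if p = r then of_real (norm_sq a p) else 0)" if "p \<in> S" "r \<in> S" for p r
  proof -
    have "h (t p) (t r) = (\<Sum>x\<in>P. if x = p \<and> p = r then of_real (norm_sq a p) else 0)"
      unfolding h_def by (rule sum.cong[OF HOL.refl]) (use that in \<open>auto simp: c_t\<close>)
    also have "\<dots> = (if p = r \<and> p \<in> P then of_real (norm_sq a p) else 0)"
      using finP by (cases "p = r") simp_all
    also have "\<dots> = (if p = r then of_real (norm_sq a p) else 0)"
      using that transport_eq_0_iff[of p] unfolding P_def S_def t_def by auto
    finally show ?thesis .
  qed
  have h_W: "h x y = 0" if "x \<in> W \<or> y \<in> W" for x y
    unfolding h_def using that c_W by (auto intro!: sum.neutral)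
  have span_all: "span (t ` S \<union> W) = UNIV"
    unfolding span_Un spanS span_eq_iff[THEN iffD2, OF subW] using sum .
  have preserves_if: "preserves h f"
    if f: "lin f" "f ` W \<subseteq> W" and eq: "\<And>p r. p \<in> S \<Longrightarrow> r \<in> S \<Longrightarrow> h (f (t p)) (f (t r)) = h (t p) (t r)" for f
  proof (rule preserves_if_on_spanning[OF herm f(1) span_all])
    fix x y assume "x \<in> t ` S \<union> W" "y \<in> t ` S \<union> W"
    then consider "x \<in> W \<or> y \<in> W" | "x \<in> t ` S" "y \<in> t ` S" by blast
    then show "h (f x) (f y) = h x y"
    proof cases
      case 1
      then have "f x \<in> W \<or> f y \<in> W" using f(2) by blast
      then show ?thesis using 1 h_W by metis
    next
      case 2
      then show ?thesis using eq by blast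
    qed
  qed
  have "preserves h (T i)" if i: "i \<in> {1..<n}" for i
  proof (rule preserves_if)
    fix p r assume p: "p \<in> S" and r: "r \<in> S"
    have perm: "p permutes {1..n}" "r permutes {1..n}" using p r by (auto simp: S_def)
    have s: "p \<circ> adj i \<in> S" "r \<circ> adj i \<in> S" using perm permutes_comp_adj i by (auto simp: S_def)
    let ?\<alpha> = "\<lambda>p. hecke_coeff q (a (p i)) (a (p (i + 1)))"
    have ne: "x \<noteq> x \<circ> adj i" if "x \<in> S" for x
    proof
      assume "x = x \<circ> adj i"
      then have "x i = x (i + 1)" by (metis comp_apply transpose_apply_first)
      then show False using permutes_neighbours_ne[of x n i] that by (simp add: S_def)
    qed
    have T_t: "T i (t x) = ?\<alpha> x *s t x + off_diag i x *s t (x \<circ> adj i)" if "x \<in> S" for x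
      using T_transport[OF _ i, of x] that unfolding t_def S_def by blast
    have expand: "h (T i (t p)) (T i (t r)) =
        ?\<alpha> p * cnj (?\<alpha> r) * h (t p) (t r) + ?\<alpha> p * cnj (off_diag i r) * h (t p) (t (r \<circ> adj i))
        + off_diag i p * cnj (?\<alpha> r) * h (t (p \<circ> adj i)) (t r)
        + off_diag i p * cnj (off_diag i r) * h (t (p \<circ> adj i)) (t (r \<circ> adj i))"
      unfolding T_t[OF p] T_t[OF r] herm_add_left[OF herm] herm_add_right[OF herm]
        herm_scale_left[OF herm] herm_scale_right[OF herm]
      by (simp only: algebra_simps)
    consider "p = r" | "r = p \<circ> adj i" | "p \<noteq> r" "r \<noteq> p \<circ> adj i" by blast
    then show "h (T i (t p)) (T i (t r)) = h (t p) (t r)"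
    proof cases
      case 1
      have "h (T i (t p)) (T i (t r)) =
          of_real ((cmod (?\<alpha> p))\<^sup>2 * norm_sq a p + (cmod (off_diag i p))\<^sup>2 * norm_sq a (p \<circ> adj i))"
        unfolding expand unfolding 1[symmetric] using p s(1) ne[OF p] ne[OF p, symmetric]
        by (simp only: h_t if_True if_False) (simp add: complex_norm_square flip: of_real_power)
      then show ?thesis
        unfolding unitary_diagonal[OF perm(1) i] 1[symmetric] h_t[OF p p] by simp
    next
      case 2
      have rr: "r \<circ> adj i = p" unfolding 2 adj_adj ..
      have "?\<alpha> r = hecke_coeff q (a (p (i + 1))) (a (p i))" unfolding 2 by simp
      moreover have "p \<noteq> r" "r \<noteq> p" using ne[OF p] 2 by auto
      ultimately have "h (T i (t p)) (T i (t r)) = 0"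
        unfolding expand rr unfolding 2[symmetric]
        using unitary_off_diagonal[OF perm(1) i, folded 2] p r by (simp add: h_t)
      then show ?thesis using \<open>p \<noteq> r\<close> h_t[OF p r] by simp
    next
      case 3
      then have "p \<noteq> r \<circ> adj i" "p \<circ> adj i \<noteq> r" "p \<circ> adj i \<noteq> r \<circ> adj i"
        by (metis adj_adj)+
      then show ?thesis
        unfolding expand using 3 p r s by (simp only: h_t if_False mult_zero_right add_0_right)
    qed
  qed (use W i T_lin in \<open>auto simp: submodule_def\<close>)
  moreover have "preserves h (X j)" if j: "j \<in> {1..n}" for j
  proof (rule preserves_if)
    fix p r assume p: "p \<in> S" and r: "r \<in> S"
    have X_t: "X j (t x) = a (x j) *s t x" if "x \<in> S" for x
      using weight_transport[OF w, of x] that j by (auto simp: weight_def S_def t_def)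
    have "p j \<in> {1..n}" using p j permutes_in_image[of p "{1..n}" j] by (simp add: S_def)
    then have "a (p j) * cnj (a (p j)) = 1"
      using complex_norm_square[of "a (p j)"] norm_a by simp
    then show "h (X j (t p)) (X j (t r)) = h (t p) (t r)"
      unfolding X_t[OF p] X_t[OF r] herm_scale_left[OF herm] herm_scale_right[OF herm] h_t[OF p r]
      by (cases "p = r") (simp_all add: mult.assoc[symmetric] mult.commute[of "cnj _"])
  qed (use W j X_lin in \<open>auto simp: submodule_def\<close>)
  moreover have "Re (h u u) > 0" if u: "u \<in> U" "u \<noteq> 0" for u
  proof -
    have "\<exists>p\<in>P. c p u \<noteq> 0"
    proof (rule ccontr)
      assume none: "\<not> ?thesis"
      have "u = (\<Sum>b\<in>t ` P. representation (t ` P) u b *s b)"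
        using sum_representation_eq[OF ind, of u "t ` P"] u(1) spanP finP by simp
      also have "\<dots> = (\<Sum>p\<in>P. c p u *s t p)"
        by (simp add: sum.reindex[OF inj] c_def \<pi>(2)[OF u(1)])
      also have "\<dots> = 0" using none by (intro sum.neutral) auto
      finally show False using u(2) by simp
    qed
    then obtain p where p: "p \<in> P" "c p u \<noteq> 0" by blast
    have "norm_sq a p > 0"
      using norm_sq_nonneg[of p] transport_eq_0_iff[of p] p(1) unfolding P_def S_def t_def by force
    then have "(\<Sum>p\<in>P. norm_sq a p * (cmod (c p u))\<^sup>2) > 0"
      using finP p norm_sq_nonneg by (intro sum_pos2[of P p]) auto
    then show ?thesis unfolding h_self by simp
  qed
  moreover have "Re (h x x) \<ge> 0" for x
    unfolding h_self using norm_sq_nonneg by (auto intro!: sum_nonneg)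
  ultimately show ?thesis using herm by blast
qed

end

lemma exists_minimal_submodule:
  assumes "submodule R" "R \<noteq> {0}"
  shows "\<exists>U. minimal_submodule U \<and> U \<subseteq> R"
proof -
  define Q where "Q W \<longleftrightarrow> submodule W \<and> W \<noteq> {0} \<and> W \<subseteq> R" for W
  obtain U where U: "Q U" and least: "\<And>W. Q W \<Longrightarrow> dim U \<le> dim W"
    using ex_has_least_nat[of Q R dim] assms unfolding Q_def by blast
  have "W = U" if "submodule W" "W \<subseteq> U" "W \<noteq> {0}" for W
  proof -
    have "Q W" using that U by (auto simp: Q_def)
    then show ?thesis
      using that U least[of W] subspace_dim_equal[of W U] by (simp add: Q_def submodule_def)
  qed
  then show ?thesis using U by (auto simp: Q_def minimal_submodule_def)
qed

text \<open>Among the invariant positive semidefinite forms, take one whose radical has least dimension. If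
  the radical were not zero it would contain a minimal submodule, and adding the form that is
  definite there would shrink it.\<close>

theorem invariant_inner_product_exists:
  assumes complement: "\<And>U. submodule U \<Longrightarrow>
      \<exists>W. submodule W \<and> U \<inter> W = {0} \<and> {u + w | u w. u \<in> U \<and> w \<in> W} = UNIV"
  shows "\<exists>h. pos_def_hermitian scale h \<and> (\<forall>i\<in>{1..<n}. preserves h (T i)) \<and> (\<forall>j\<in>{1..n}. preserves h (X j))"
proof -
  define good where "good h \<longleftrightarrow> hermitian h \<and> (\<forall>v. Re (h v v) \<ge> 0) \<and> (\<forall>i\<in>{1..<n}. preserves h (T i)) \<and>
    (\<forall>j\<in>{1..n}. preserves h (X j))" for h
  define rad where "rad h = {v. \<forall>w\<in>UNIV. h v w = 0}" for h :: "'v \<Rightarrow> 'v \<Rightarrow> complex"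
  have "good (\<lambda>_ _. 0)" by (simp add: good_def hermitian_def preserves_def)
  then obtain h where h: "good h" and least: "\<And>g. good g \<Longrightarrow> dim (rad h) \<le> dim (rad g)"
    using ex_has_least_nat[of good _ "\<lambda>h. dim (rad h)"] by blast
  have herm: "hermitian h" and psd: "\<And>v. Re (h v v) \<ge> 0" using h by (auto simp: good_def)
  have sub_rad: "subspace (rad g)" if "good g" for g
    unfolding rad_def using that by (intro subspace_orthogonal) (simp add: good_def)
  have null: "x \<in> rad h" if "Re (h x x) = 0" for x
    unfolding rad_def using null_vector_orthogonal[OF herm psd that] by blast
  have closed: "f ` rad h \<subseteq> rad h" if f: "lin f" "inj f" "preserves h f" for f
  proof
    fix y assume "y \<in> f ` rad h"
    then obtain x where x: "y = f x" "x \<in> rad h" by blast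
    have "h y w = 0" for w
    proof -
      obtain w' where "w = f w'" using image_subspace_eq[OF f(1) subspace_UNIV _ f(2)] by blast
      then show ?thesis using x f(3) by (simp add: preserves_def rad_def)
    qed
    then show "y \<in> rad h" by (simp add: rad_def)
  qed
  have T_inj: "inj (T i)" if i: "i \<in> {1..<n}" for i
  proof (rule injI)
    fix x y assume eq: "T i x = T i y"
    then have "T i (T i x) = T i (T i y)" by simp
    then have "(q - 1) *s T i x + q *s x = (q - 1) *s T i y + q *s y" unfolding T_T[OF i] .
    then have "q *s x = q *s y" unfolding eq by simp
    then show "x = y" using q_nz by simp
  qed
  have "submodule (rad h)"
    unfolding submodule_def using sub_rad[OF h] closed T_lin T_inj X_lin X_inj h by (auto simp: good_def)
  moreover have "rad h = {0}"
  proof (rule ccontr)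
    assume "rad h \<noteq> {0}"
    then obtain U where U: "minimal_submodule U" "U \<subseteq> rad h"
      using exists_minimal_submodule \<open>submodule (rad h)\<close> by blast
    have sub: "submodule U" and subU: "subspace U" and U0: "U \<noteq> {0}"
      using U(1) by (auto simp: minimal_submodule_def submodule_def)
    obtain a v where v: "weight a v" "v \<in> U" "v \<noteq> 0"
    proof -
      have "\<exists>a. \<exists>v\<in>U. v \<noteq> 0 \<and> (\<forall>j\<in>{1..n}. X j v = a j *s v)"
        using sub by (intro exists_joint_eigenvector X_lin X_comm subU U0) (auto simp: submodule_def)
      then show ?thesis using that unfolding weight_def by blast
    qed
    obtain W where W: "submodule W" "U \<inter> W = {0}" "{u + w | u w. u \<in> U \<and> w \<in> W} = UNIV"
      using complement[OF sub] by blast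
    obtain g where g: "good g" and pos: "\<And>u. u \<in> U \<Longrightarrow> u \<noteq> 0 \<Longrightarrow> Re (g u u) > 0"
      using invariant_form_exists[OF U(1) v W] unfolding good_def by blast
    define k where "k x y = h x y + g x y" for x y
    have k: "good k"
    proof -
      have hg: "hermitian g" using g by (simp add: good_def)
      have "hermitian k"
        unfolding hermitian_def k_def
      proof (intro conjI allI)
        show "h (x + y) z + g (x + y) z = h x z + g x z + (h y z + g y z)" for x y z
          by (simp add: herm_add_left[OF herm] herm_add_left[OF hg])
        show "h (c *s x) y + g (c *s x) y = c * (h x y + g x y)" for c x y
          by (simp add: herm_scale_left[OF herm] herm_scale_left[OF hg] distrib_left)
        show "h y x + g y x = cnj (h x y + g x y)" for x y
          by (simp add: herm_cnj[OF herm] herm_cnj[OF hg])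
      qed
      moreover have "preserves k f" if "preserves h f" "preserves g f" for f
        using that by (simp add: preserves_def k_def)
      ultimately show ?thesis using h g by (simp add: good_def k_def)
    qed
    have "rad k \<subseteq> rad h"
    proof
      fix x assume "x \<in> rad k"
      then have "h x x + g x x = 0" by (simp add: rad_def k_def)
      then have "Re (h x x) + Re (g x x) = 0" by (metis plus_complex.sel(1) zero_complex.sel(1))
      moreover have "Re (g x x) \<ge> 0" using g by (simp add: good_def)
      ultimately show "x \<in> rad h" using psd[of x] by (intro null) linarith
    qed
    moreover have "v \<in> rad h" "v \<notin> rad k"
    proof -
      show "v \<in> rad h" using v U(2) by blast
      show "v \<notin> rad k"
      proof
        assume "v \<in> rad k"
        then have "h v v + g v v = 0" by (simp add: rad_def k_def)
        then have "Re (h v v) + Re (g v v) = 0" by (metis plus_complex.sel(1) zero_complex.sel(1))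
        then show False using pos[OF v(2,3)] psd[of v] by linarith
      qed
    qed
    ultimately show False
      using least[OF k] subspace_dim_equal[OF sub_rad[OF k] sub_rad[OF h]] by blast
  qed
  then have "Re (h v v) > 0" if "v \<noteq> 0" for v
    using null[of v] psd[of v] that by fastforce
  then show ?thesis
    using h by (auto simp: good_def pos_def_hermitian_iff)
qed

end

section \<open>Presented groups, group algebras and quotient algebras\<close>

context
  fixes S :: "'a set" and R :: "('a word \<times> 'a word) set"
  assumes R_words: "R \<subseteq> words S \<times> words S"
begin

lemma words_append: "u \<in> words S \<Longrightarrow> v \<in> words S \<Longrightarrow> u @ v \<in> words S"
  by (simp add: words_def)

lemma word_eq_words: "(u, v) \<in> word_eq S R \<Longrightarrow> u \<in> words S \<and> v \<in> words S"
proof (induction rule: word_eq.induct)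
  case (cancel u v s b)
  then show ?case by (auto simp: words_def)
next
  case (relation u v l r)
  then show ?case using R_words words_append by blast
qed auto

lemma equiv_word_eq: "equiv (words S) (word_eq S R)"
  by (rule equivI)
    (auto simp: refl_on_def sym_def trans_def dest: word_eq_words intro: word_eq.intros)

lemma word_eq_append_left: "(u, v) \<in> word_eq S R \<Longrightarrow> w \<in> words S \<Longrightarrow> (w @ u, w @ v) \<in> word_eq S R"
proof (induction rule: word_eq.induct)
  case (cancel u v s b)
  then show ?case using word_eq.cancel[OF words_append[OF cancel.prems cancel.hyps(1)]] by simp
next
  case (relation u v l r)
  then show ?case using word_eq.relation[OF words_append[OF relation.prems relation.hyps(1)]] by simp
qed (auto intro: words_append word_eq.intros)

lemma word_eq_append_right: "(u, v) \<in> word_eq S R \<Longrightarrow> w \<in> words S \<Longrightarrow> (u @ w, v @ w) \<in> word_eq S R"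
proof (induction rule: word_eq.induct)
  case (cancel u v s b)
  then show ?case using word_eq.cancel[OF cancel.hyps(1) words_append[OF cancel.hyps(2) cancel.prems]] by simp
next
  case (relation u v l r)
  then show ?case using word_eq.relation[OF relation.hyps(1) words_append[OF relation.hyps(2) relation.prems]] by simp
qed (auto intro: words_append word_eq.intros)

lemma word_eq_append: "(u, u') \<in> word_eq S R \<Longrightarrow> (v, v') \<in> word_eq S R \<Longrightarrow> (u @ v, u' @ v') \<in> word_eq S R"
  by (meson word_eq.trans word_eq_append_left word_eq_append_right word_eq_words)

lemma word_class_eq_iff:
  "u \<in> words S \<Longrightarrow> v \<in> words S \<Longrightarrow> word_eq S R `` {u} = word_eq S R `` {v} \<longleftrightarrow> (u, v) \<in> word_eq S R"
  using eq_equiv_class_iff[OF equiv_word_eq] .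

lemma presented_group_mult:
  assumes "u \<in> words S" "v \<in> words S"
  shows "word_eq S R `` {u} \<otimes>\<^bsub>presented_group S R\<^esub> word_eq S R `` {v} = word_eq S R `` {u @ v}"
proof -
  define C where "C = word_eq S R `` {u @ v}"
  have class_eq: "word_eq S R `` {u' @ v'} = C"
    if "u' \<in> word_eq S R `` {u}" "v' \<in> word_eq S R `` {v}" for u' v'
    unfolding C_def using that equiv_class_eq[OF equiv_word_eq word_eq_append, symmetric] by blast
  have ne: "u \<in> word_eq S R `` {u}" "v \<in> word_eq S R `` {v}"
    using assms by (auto intro: word_eq.refl)
  have "(\<Union>u'\<in>word_eq S R `` {u}. \<Union>v'\<in>word_eq S R `` {v}. word_eq S R `` {u' @ v'})
      = (\<Union>u'\<in>word_eq S R `` {u}. \<Union>v'\<in>word_eq S R `` {v}. C)"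
    by (intro SUP_cong HOL.refl class_eq)
  also have "\<dots> = C" using ne by blast
  finally show ?thesis by (simp add: presented_group_def C_def)
qed

lemma in_presented_group_iff:
  "g \<in> carrier (presented_group S R) \<longleftrightarrow> (\<exists>w\<in>words S. g = word_eq S R `` {w})"
  by (auto simp: presented_group_def quotient_def)

definition inverse_word :: "'a word \<Rightarrow> 'a word" where
  "inverse_word w = map (\<lambda>(s, b). (s, \<not> b)) (rev w)"

lemma inverse_word_words: "w \<in> words S \<Longrightarrow> inverse_word w \<in> words S"
  by (auto simp: inverse_word_def words_def)

lemma inverse_word_cancel: "w \<in> words S \<Longrightarrow> (inverse_word w @ w, []) \<in> word_eq S R"
proof (induction w)
  case Nil
  then show ?case by (auto simp: inverse_word_def words_def intro: word_eq.refl)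
next
  case (Cons l w)
  obtain s b where l: "l = (s, b)" by fastforce
  have w: "w \<in> words S" "s \<in> S" using Cons.prems l by (auto simp: words_def)
  have "inverse_word (l # w) @ l # w = inverse_word w @ [(s, \<not> b), (s, \<not> \<not> b)] @ w"
    by (simp add: inverse_word_def l)
  then show ?case
    using word_eq.cancel[OF inverse_word_words[OF w(1)] w(1,2), of "\<not> b" R] Cons.IH[OF w(1)] word_eq.trans
    by metis
qed

lemma group_presented_group: "group (presented_group S R)"
proof (rule groupI)
  let ?G = "presented_group S R"
  have nil: "[] \<in> words S" by (simp add: words_def)
  have one: "one ?G = word_eq S R `` {[]}" by (simp add: presented_group_def)
  show "\<one>\<^bsub>?G\<^esub> \<in> carrier ?G" unfolding in_presented_group_iff one using nil by blast
  fix x assume "x \<in> carrier ?G"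
  then obtain u where u: "u \<in> words S" "x = word_eq S R `` {u}" unfolding in_presented_group_iff by blast
  show "\<one>\<^bsub>?G\<^esub> \<otimes>\<^bsub>?G\<^esub> x = x" unfolding one u(2) presented_group_mult[OF nil u(1)] by simp
  have "word_eq S R `` {inverse_word u} \<otimes>\<^bsub>?G\<^esub> x = \<one>\<^bsub>?G\<^esub>"
    unfolding one u(2) presented_group_mult[OF inverse_word_words[OF u(1)] u(1)]
    using word_class_eq_iff[OF words_append[OF inverse_word_words[OF u(1)] u(1)] nil] inverse_word_cancel[OF u(1)]
    by blast
  then show "\<exists>y\<in>carrier ?G. y \<otimes>\<^bsub>?G\<^esub> x = \<one>\<^bsub>?G\<^esub>"
    using inverse_word_words[OF u(1)] in_presented_group_iff by blast
  fix y assume "y \<in> carrier ?G"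
  then obtain v where v: "v \<in> words S" "y = word_eq S R `` {v}" unfolding in_presented_group_iff by blast
  show "x \<otimes>\<^bsub>?G\<^esub> y \<in> carrier ?G"
    unfolding u(2) v(2) presented_group_mult[OF u(1) v(1)] in_presented_group_iff
    using words_append[OF u(1) v(1)] by blast
  fix z assume "z \<in> carrier ?G"
  then obtain w where w: "w \<in> words S" "z = word_eq S R `` {w}" unfolding in_presented_group_iff by blast
  show "x \<otimes>\<^bsub>?G\<^esub> y \<otimes>\<^bsub>?G\<^esub> z = x \<otimes>\<^bsub>?G\<^esub> (y \<otimes>\<^bsub>?G\<^esub> z)"
    unfolding u(2) v(2) w(2)
    by (simp add: presented_group_mult u(1) v(1) w(1) words_append)
qed

end

locale complex_algebra = ring A for A :: "'a calgebra" (structure) +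
  assumes smult_closed: "a \<in> carrier A \<Longrightarrow> c \<odot> a \<in> carrier A"
    and smult_add: "a \<in> carrier A \<Longrightarrow> b \<in> carrier A \<Longrightarrow> c \<odot> (a \<oplus> b) = c \<odot> a \<oplus> c \<odot> b"
    and smult_smult: "a \<in> carrier A \<Longrightarrow> c \<odot> (d \<odot> a) = (c * d) \<odot> a"
    and smult_one: "a \<in> carrier A \<Longrightarrow> 1 \<odot> a = a"
    and smult_mult_left: "a \<in> carrier A \<Longrightarrow> b \<in> carrier A \<Longrightarrow> c \<odot> (a \<otimes> b) = (c \<odot> a) \<otimes> b"
    and smult_mult_right: "a \<in> carrier A \<Longrightarrow> b \<in> carrier A \<Longrightarrow> c \<odot> (a \<otimes> b) = a \<otimes> (c \<odot> b)"

text \<open>The sums in the definition of the product may range over any finite sets that contain the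
  supports, so that products of different elements can be compared term by term.\<close>

lemma group_algebra_mult_eq:
  assumes "finite F" "{a. f a \<noteq> 0} \<subseteq> F" "finite H" "{b. h b \<noteq> 0} \<subseteq> H"
  shows "(f \<otimes>\<^bsub>group_algebra G\<^esub> h) g = (\<Sum>a\<in>F. \<Sum>b\<in>H. if a \<otimes>\<^bsub>G\<^esub> b = g then f a * h b else 0)"
proof -
  have "(\<Sum>b\<in>{b. h b \<noteq> 0}. if a \<otimes>\<^bsub>G\<^esub> b = g then f a * h b else 0) = (\<Sum>b\<in>H. if a \<otimes>\<^bsub>G\<^esub> b = g then f a * h b else 0)" for a
    using assms(3,4) by (intro sum.mono_neutral_left) auto
  moreover have "(\<Sum>a\<in>{a. f a \<noteq> 0}. \<Sum>b\<in>H. if a \<otimes>\<^bsub>G\<^esub> b = g then f a * h b else 0) =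
      (\<Sum>a\<in>F. \<Sum>b\<in>H. if a \<otimes>\<^bsub>G\<^esub> b = g then f a * h b else 0)"
    using assms(1,2) by (intro sum.mono_neutral_left) (auto intro!: sum.neutral split: if_splits)
  ultimately show ?thesis by (simp add: group_algebra_def)
qed

lemma group_algebra_simps:
  "f \<in> carrier (group_algebra G) \<longleftrightarrow> finite {g. f g \<noteq> 0} \<and> {g. f g \<noteq> 0} \<subseteq> carrier G"
  "\<one>\<^bsub>group_algebra G\<^esub> = group_elem \<one>\<^bsub>G\<^esub>"
  "\<zero>\<^bsub>group_algebra G\<^esub> = (\<lambda>_. 0)"
  "f \<oplus>\<^bsub>group_algebra G\<^esub> h = (\<lambda>g. f g + h g)"
  "c \<odot>\<^bsub>group_algebra G\<^esub> f = (\<lambda>g. c * f g)"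
  by (simp_all add: group_algebra_def group_elem_def)

context group
begin

lemma group_elem_carrier: "a \<in> carrier G \<Longrightarrow> group_elem a \<in> carrier (group_algebra G)"
  by (auto simp: group_algebra_simps group_elem_def)

lemma group_elem_mult: "group_elem a \<otimes>\<^bsub>group_algebra G\<^esub> group_elem b = group_elem (a \<otimes> b)"
proof
  fix g
  have "(group_elem a \<otimes>\<^bsub>group_algebra G\<^esub> group_elem b) g =
      (\<Sum>x\<in>{a}. \<Sum>y\<in>{b}. if x \<otimes> y = g then group_elem a x * group_elem b y else 0)"
    by (rule group_algebra_mult_eq) (auto simp: group_elem_def)
  then show "(group_elem a \<otimes>\<^bsub>group_algebra G\<^esub> group_elem b) g = group_elem (a \<otimes> b) g"
    by (simp add: group_elem_def)
qed

lemma group_algebra_mult_closed: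
  assumes f: "f \<in> carrier (group_algebra G)" and h: "h \<in> carrier (group_algebra G)"
  shows "f \<otimes>\<^bsub>group_algebra G\<^esub> h \<in> carrier (group_algebra G)"
    and "{g. (f \<otimes>\<^bsub>group_algebra G\<^esub> h) g \<noteq> 0} \<subseteq> (\<lambda>(a, b). a \<otimes> b) ` ({a. f a \<noteq> 0} \<times> {b. h b \<noteq> 0})"
proof -
  let ?F = "{a. f a \<noteq> 0}" and ?H = "{b. h b \<noteq> 0}"
  have fin: "finite ?F" "finite ?H" and sub: "?F \<subseteq> carrier G" "?H \<subseteq> carrier G"
    using f h by (auto simp: group_algebra_simps)
  show *: "{g. (f \<otimes>\<^bsub>group_algebra G\<^esub> h) g \<noteq> 0} \<subseteq> (\<lambda>(a, b). a \<otimes> b) ` (?F \<times> ?H)"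
  proof (rule subsetI, rule ccontr)
    fix g assume g: "g \<in> {g. (f \<otimes>\<^bsub>group_algebra G\<^esub> h) g \<noteq> 0}" and no: "g \<notin> (\<lambda>(a, b). a \<otimes> b) ` (?F \<times> ?H)"
    have "(f \<otimes>\<^bsub>group_algebra G\<^esub> h) g = 0"
      unfolding group_algebra_mult_eq[OF fin(1) subset_refl fin(2) subset_refl] using no
      by (intro sum.neutral ballI) auto
    then show False using g by simp
  qed
  have "finite ((\<lambda>(a, b). a \<otimes> b) ` (?F \<times> ?H))" using fin by simp
  moreover have "(\<lambda>(a, b). a \<otimes> b) ` (?F \<times> ?H) \<subseteq> carrier G" using sub by auto
  ultimately show "f \<otimes>\<^bsub>group_algebra G\<^esub> h \<in> carrier (group_algebra G)"
    unfolding group_algebra_simps using finite_subset[OF *] subset_trans[OF *] by blast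
qed

lemma group_algebra_mult_mult:
  assumes f: "f \<in> carrier (group_algebra G)" and h: "h \<in> carrier (group_algebra G)" and k: "k \<in> carrier (group_algebra G)"
  shows "((f \<otimes>\<^bsub>group_algebra G\<^esub> h) \<otimes>\<^bsub>group_algebra G\<^esub> k) g =
      (\<Sum>a\<in>{a. f a \<noteq> 0}. \<Sum>b\<in>{b. h b \<noteq> 0}. \<Sum>d\<in>{d. k d \<noteq> 0}. if (a \<otimes> b) \<otimes> d = g then f a * h b * k d else 0)"
    and "(f \<otimes>\<^bsub>group_algebra G\<^esub> (h \<otimes>\<^bsub>group_algebra G\<^esub> k)) g =
      (\<Sum>a\<in>{a. f a \<noteq> 0}. \<Sum>b\<in>{b. h b \<noteq> 0}. \<Sum>d\<in>{d. k d \<noteq> 0}. if a \<otimes> (b \<otimes> d) = g then f a * h b * k d else 0)"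
proof -
  let ?F = "{a. f a \<noteq> 0}" and ?H = "{b. h b \<noteq> 0}" and ?K = "{d. k d \<noteq> 0}"
  have fin: "finite ?F" "finite ?H" "finite ?K" using f h k by (auto simp: group_algebra_simps)
  define M where "M = (\<lambda>(a, b). a \<otimes> b) ` (?F \<times> ?H)"
  have finM: "finite M" using fin by (simp add: M_def)
  have "((f \<otimes>\<^bsub>group_algebra G\<^esub> h) \<otimes>\<^bsub>group_algebra G\<^esub> k) g
      = (\<Sum>c\<in>M. \<Sum>d\<in>?K. if c \<otimes> d = g then (f \<otimes>\<^bsub>group_algebra G\<^esub> h) c * k d else 0)"
    using group_algebra_mult_closed(2)[OF f h] finM fin by (intro group_algebra_mult_eq) (auto simp: M_def)
  also have "\<dots> = (\<Sum>c\<in>M. \<Sum>d\<in>?K. \<Sum>a\<in>?F. \<Sum>b\<in>?H. if a \<otimes> b = c then (if c \<otimes> d = g then f a * h b * k d else 0) else 0)"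
    unfolding group_algebra_mult_eq[OF fin(1) subset_refl fin(2) subset_refl]
  proof (intro sum.cong HOL.refl)
    fix c d
    show "(if c \<otimes> d = g then (\<Sum>a\<in>?F. \<Sum>b\<in>?H. if a \<otimes> b = c then f a * h b else 0) * k d else 0) =
        (\<Sum>a\<in>?F. \<Sum>b\<in>?H. if a \<otimes> b = c then (if c \<otimes> d = g then f a * h b * k d else 0) else 0)"
      by (cases "c \<otimes> d = g") (auto simp: sum_distrib_right intro!: sum.cong cong: if_cong)
  qed
  also have "\<dots> = (\<Sum>d\<in>?K. \<Sum>a\<in>?F. \<Sum>b\<in>?H. \<Sum>c\<in>M. if a \<otimes> b = c then (if c \<otimes> d = g then f a * h b * k d else 0) else 0)"
    by (subst sum.swap, rule sum.cong[OF HOL.refl], subst sum.swap, rule sum.cong[OF HOL.refl], subst sum.swap, rule HOL.refl)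
  also have "\<dots> = (\<Sum>d\<in>?K. \<Sum>a\<in>?F. \<Sum>b\<in>?H. if (a \<otimes> b) \<otimes> d = g then f a * h b * k d else 0)"
    using finM by (intro sum.cong HOL.refl) (auto simp: M_def)
  also have "\<dots> = (\<Sum>a\<in>?F. \<Sum>b\<in>?H. \<Sum>d\<in>?K. if (a \<otimes> b) \<otimes> d = g then f a * h b * k d else 0)"
    by (subst sum.swap, rule sum.cong[OF HOL.refl], subst sum.swap, rule HOL.refl)
  finally show "((f \<otimes>\<^bsub>group_algebra G\<^esub> h) \<otimes>\<^bsub>group_algebra G\<^esub> k) g =
      (\<Sum>a\<in>?F. \<Sum>b\<in>?H. \<Sum>d\<in>?K. if (a \<otimes> b) \<otimes> d = g then f a * h b * k d else 0)" .
  define N where "N = (\<lambda>(a, b). a \<otimes> b) ` (?H \<times> ?K)"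
  have finN: "finite N" using fin by (simp add: N_def)
  have "(f \<otimes>\<^bsub>group_algebra G\<^esub> (h \<otimes>\<^bsub>group_algebra G\<^esub> k)) g
      = (\<Sum>a\<in>?F. \<Sum>c\<in>N. if a \<otimes> c = g then f a * (h \<otimes>\<^bsub>group_algebra G\<^esub> k) c else 0)"
    using group_algebra_mult_closed(2)[OF h k] finN fin by (intro group_algebra_mult_eq) (auto simp: N_def)
  also have "\<dots> = (\<Sum>a\<in>?F. \<Sum>c\<in>N. \<Sum>b\<in>?H. \<Sum>d\<in>?K. if b \<otimes> d = c then (if a \<otimes> c = g then f a * h b * k d else 0) else 0)"
    unfolding group_algebra_mult_eq[OF fin(2) subset_refl fin(3) subset_refl]
  proof (intro sum.cong HOL.refl)
    fix a c
    show "(if a \<otimes> c = g then f a * (\<Sum>b\<in>?H. \<Sum>d\<in>?K. if b \<otimes> d = c then h b * k d else 0) else 0) =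
        (\<Sum>b\<in>?H. \<Sum>d\<in>?K. if b \<otimes> d = c then (if a \<otimes> c = g then f a * h b * k d else 0) else 0)"
      by (cases "a \<otimes> c = g") (auto simp: sum_distrib_left mult.assoc intro!: sum.cong cong: if_cong)
  qed
  also have "\<dots> = (\<Sum>a\<in>?F. \<Sum>b\<in>?H. \<Sum>d\<in>?K. \<Sum>c\<in>N. if b \<otimes> d = c then (if a \<otimes> c = g then f a * h b * k d else 0) else 0)"
    by (rule sum.cong[OF HOL.refl], subst sum.swap, rule sum.cong[OF HOL.refl], subst sum.swap, rule HOL.refl)
  also have "\<dots> = (\<Sum>a\<in>?F. \<Sum>b\<in>?H. \<Sum>d\<in>?K. if a \<otimes> (b \<otimes> d) = g then f a * h b * k d else 0)"
    using finN by (intro sum.cong HOL.refl) (auto simp: N_def)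
  finally show "(f \<otimes>\<^bsub>group_algebra G\<^esub> (h \<otimes>\<^bsub>group_algebra G\<^esub> k)) g =
      (\<Sum>a\<in>?F. \<Sum>b\<in>?H. \<Sum>d\<in>?K. if a \<otimes> (b \<otimes> d) = g then f a * h b * k d else 0)" .
qed

lemma group_algebra_add_closed:
  assumes "f \<in> carrier (group_algebra G)" "h \<in> carrier (group_algebra G)"
  shows "f \<oplus>\<^bsub>group_algebra G\<^esub> h \<in> carrier (group_algebra G)"
proof -
  have "{g. f g + h g \<noteq> 0} \<subseteq> {g. f g \<noteq> 0} \<union> {g. h g \<noteq> 0}" by auto
  then show ?thesis using assms unfolding group_algebra_simps by (auto dest: finite_subset)
qed

lemma group_algebra_smult_closed:
  assumes "f \<in> carrier (group_algebra G)"
  shows "c \<odot>\<^bsub>group_algebra G\<^esub> f \<in> carrier (group_algebra G)"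
proof -
  have "{g. c * f g \<noteq> 0} \<subseteq> {g. f g \<noteq> 0}" by auto
  then show ?thesis using assms unfolding group_algebra_simps by (auto dest: finite_subset)
qed

theorem complex_algebra_group_algebra: "complex_algebra (group_algebra G)"
proof -
  let ?A = "group_algebra G"
  have one: "\<one>\<^bsub>?A\<^esub> \<in> carrier ?A" by (simp add: group_algebra_simps(2) group_elem_carrier)
  have grp: "abelian_group ?A"
  proof (rule abelian_groupI)
    fix f assume f: "f \<in> carrier ?A"
    show "\<exists>h\<in>carrier ?A. h \<oplus>\<^bsub>?A\<^esub> f = \<zero>\<^bsub>?A\<^esub>"
      using group_algebra_smult_closed[OF f, of "- 1"]
      by (rule bexI[rotated]) (simp add: group_algebra_simps)
  next
    show "f \<oplus>\<^bsub>?A\<^esub> h \<in> carrier ?A" if "f \<in> carrier ?A" "h \<in> carrier ?A" for f h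
      using that by (rule group_algebra_add_closed)
  qed (simp_all add: group_algebra_simps ac_simps)
  have one_mult: "\<one>\<^bsub>?A\<^esub> \<otimes>\<^bsub>?A\<^esub> f = f \<and> f \<otimes>\<^bsub>?A\<^esub> \<one>\<^bsub>?A\<^esub> = f" if f: "f \<in> carrier ?A" for f
  proof (intro conjI ext)
    let ?F = "{g. f g \<noteq> 0}"
    have F: "finite ?F" "?F \<subseteq> carrier G" using f by (auto simp: group_algebra_simps)
    fix g
    have "(\<one>\<^bsub>?A\<^esub> \<otimes>\<^bsub>?A\<^esub> f) g = (\<Sum>a\<in>{\<one>}. \<Sum>b\<in>?F. if a \<otimes> b = g then group_elem \<one> a * f b else 0)"
      unfolding group_algebra_simps(2) using F(1) by (intro group_algebra_mult_eq) (auto simp: group_elem_def)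
    also have "\<dots> = (\<Sum>b\<in>?F. if b = g then f b else 0)"
      using F(2) by (auto simp: group_elem_def intro!: sum.cong)
    finally show "(\<one>\<^bsub>?A\<^esub> \<otimes>\<^bsub>?A\<^esub> f) g = f g" using F(1) by auto
    have "(f \<otimes>\<^bsub>?A\<^esub> \<one>\<^bsub>?A\<^esub>) g = (\<Sum>a\<in>?F. \<Sum>b\<in>{\<one>}. if a \<otimes> b = g then f a * group_elem \<one> b else 0)"
      unfolding group_algebra_simps(2) using F(1) by (intro group_algebra_mult_eq) (auto simp: group_elem_def)
    also have "\<dots> = (\<Sum>a\<in>?F. if a = g then f a else 0)"
      using F(2) by (auto simp: group_elem_def intro!: sum.cong)
    finally show "(f \<otimes>\<^bsub>?A\<^esub> \<one>\<^bsub>?A\<^esub>) g = f g" using F(1) by auto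
  qed
  have assoc: "(f \<otimes>\<^bsub>?A\<^esub> h) \<otimes>\<^bsub>?A\<^esub> k = f \<otimes>\<^bsub>?A\<^esub> (h \<otimes>\<^bsub>?A\<^esub> k)"
    if "f \<in> carrier ?A" "h \<in> carrier ?A" "k \<in> carrier ?A" for f h k
  proof
    fix g
    have "(a \<otimes> b) \<otimes> d = a \<otimes> (b \<otimes> d)" if "f a \<noteq> 0" "h b \<noteq> 0" "k d \<noteq> 0" for a b d
      using that \<open>f \<in> carrier ?A\<close> \<open>h \<in> carrier ?A\<close> \<open>k \<in> carrier ?A\<close>
      by (intro m_assoc) (auto simp: group_algebra_simps)
    then show "((f \<otimes>\<^bsub>?A\<^esub> h) \<otimes>\<^bsub>?A\<^esub> k) g = (f \<otimes>\<^bsub>?A\<^esub> (h \<otimes>\<^bsub>?A\<^esub> k)) g"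
      unfolding group_algebra_mult_mult[OF that] by (intro sum.cong HOL.refl) simp
  qed
  have "monoid ?A"
    using one one_mult assoc by (intro monoidI) (auto intro: group_algebra_mult_closed(1))
  moreover have "(f \<oplus>\<^bsub>?A\<^esub> h) \<otimes>\<^bsub>?A\<^esub> k = f \<otimes>\<^bsub>?A\<^esub> k \<oplus>\<^bsub>?A\<^esub> h \<otimes>\<^bsub>?A\<^esub> k"
    and "k \<otimes>\<^bsub>?A\<^esub> (f \<oplus>\<^bsub>?A\<^esub> h) = k \<otimes>\<^bsub>?A\<^esub> f \<oplus>\<^bsub>?A\<^esub> k \<otimes>\<^bsub>?A\<^esub> h"
    if fhk: "f \<in> carrier ?A" "h \<in> carrier ?A" "k \<in> carrier ?A" for f h k
  proof -
    define F where "F = {g. f g \<noteq> 0} \<union> {g. h g \<noteq> 0} \<union> {g. k g \<noteq> 0}"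
    have F: "finite F" using fhk by (simp add: F_def group_algebra_simps)
    note conv = group_algebra_mult_eq[OF F _ F]
    have sub: "{g. f g \<noteq> 0} \<subseteq> F" "{g. h g \<noteq> 0} \<subseteq> F" "{g. k g \<noteq> 0} \<subseteq> F" "{g. f g + h g \<noteq> 0} \<subseteq> F"
      by (auto simp: F_def)
    show "(f \<oplus>\<^bsub>?A\<^esub> h) \<otimes>\<^bsub>?A\<^esub> k = f \<otimes>\<^bsub>?A\<^esub> k \<oplus>\<^bsub>?A\<^esub> h \<otimes>\<^bsub>?A\<^esub> k"
      unfolding group_algebra_simps(4)
      unfolding fun_eq_iff conv[OF sub(4,3)] conv[OF sub(1,3)] conv[OF sub(2,3)] sum.distrib[symmetric]
      by (intro allI sum.cong HOL.refl) (simp add: distrib_right)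
    show "k \<otimes>\<^bsub>?A\<^esub> (f \<oplus>\<^bsub>?A\<^esub> h) = k \<otimes>\<^bsub>?A\<^esub> f \<oplus>\<^bsub>?A\<^esub> k \<otimes>\<^bsub>?A\<^esub> h"
      unfolding group_algebra_simps(4)
      unfolding fun_eq_iff conv[OF sub(3,4)] conv[OF sub(3,1)] conv[OF sub(3,2)] sum.distrib[symmetric]
      by (intro allI sum.cong HOL.refl) (simp add: distrib_left)
  qed
  ultimately have "ring ?A" using grp by (intro ringI) auto
  moreover have smult: "c \<odot>\<^bsub>?A\<^esub> (f \<otimes>\<^bsub>?A\<^esub> h) = (c \<odot>\<^bsub>?A\<^esub> f) \<otimes>\<^bsub>?A\<^esub> h \<and> c \<odot>\<^bsub>?A\<^esub> (f \<otimes>\<^bsub>?A\<^esub> h) = f \<otimes>\<^bsub>?A\<^esub> (c \<odot>\<^bsub>?A\<^esub> h)"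
    if fh: "f \<in> carrier ?A" "h \<in> carrier ?A" for f h c
  proof -
    define F where "F = {g. f g \<noteq> 0} \<union> {g. h g \<noteq> 0}"
    have F: "finite F" using fh by (simp add: F_def group_algebra_simps)
    note conv = group_algebra_mult_eq[OF F _ F]
    have sub: "{g. f g \<noteq> 0} \<subseteq> F" "{g. h g \<noteq> 0} \<subseteq> F" "{g. c * f g \<noteq> 0} \<subseteq> F" "{g. c * h g \<noteq> 0} \<subseteq> F"
      by (auto simp: F_def)
    show ?thesis
      unfolding group_algebra_simps(5)
      unfolding fun_eq_iff conv[OF sub(1,2)] conv[OF sub(3,2)] conv[OF sub(1,4)] sum_distrib_left
      by (intro conjI allI sum.cong HOL.refl) simp_all
  qed
  moreover have "complex_algebra_axioms ?A"
  proof
    fix f h c d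
    assume f: "f \<in> carrier ?A"
    show "c \<odot>\<^bsub>?A\<^esub> f \<in> carrier ?A" using group_algebra_smult_closed[OF f] .
    show "c \<odot>\<^bsub>?A\<^esub> (d \<odot>\<^bsub>?A\<^esub> f) = (c * d) \<odot>\<^bsub>?A\<^esub> f" "1 \<odot>\<^bsub>?A\<^esub> f = f"
      by (simp_all add: group_algebra_simps(5) mult.assoc)
    assume h: "h \<in> carrier ?A"
    show "c \<odot>\<^bsub>?A\<^esub> (f \<oplus>\<^bsub>?A\<^esub> h) = c \<odot>\<^bsub>?A\<^esub> f \<oplus>\<^bsub>?A\<^esub> c \<odot>\<^bsub>?A\<^esub> h"
      by (simp add: group_algebra_simps(4,5) distrib_left)
    show "c \<odot>\<^bsub>?A\<^esub> (f \<otimes>\<^bsub>?A\<^esub> h) = (c \<odot>\<^bsub>?A\<^esub> f) \<otimes>\<^bsub>?A\<^esub> h" using smult[OF f h] by blast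
    show "c \<odot>\<^bsub>?A\<^esub> (f \<otimes>\<^bsub>?A\<^esub> h) = f \<otimes>\<^bsub>?A\<^esub> (c \<odot>\<^bsub>?A\<^esub> h)" using smult[OF f h] by blast
  qed
  ultimately show ?thesis by (intro complex_algebra.intro)
qed

end

context complex_algebra
begin

lemma ideal_smult: "ideal I A \<Longrightarrow> a \<in> I \<Longrightarrow> c \<odot> a \<in> I"
proof -
  assume I: "ideal I A" and a: "a \<in> I"
  then have aA: "a \<in> carrier A" using ideal.Icarr by fast
  have "c \<odot> a = (c \<odot> \<one>) \<otimes> a"
    using smult_mult_left[OF one_closed aA, of c] aA by simp
  then show ?thesis using ideal.I_l_closed[OF I a smult_closed[OF one_closed]] by simp
qed

lemma quot_algebra_simps:
  "carrier (quot_algebra A I) = carrier (A Quot I)" "monoid.mult (quot_algebra A I) = monoid.mult (A Quot I)"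
  "one (quot_algebra A I) = one (A Quot I)" "zero (quot_algebra A I) = zero (A Quot I)"
  "add (quot_algebra A I) = add (A Quot I)"
  by (simp_all add: quot_algebra_def)

text \<open>Ideals are closed under scalars, being closed under multiplication by multiples of \<open>1\<close>; so the
  union that defines the scalar multiple of a coset is a single coset.\<close>

lemma quot_smult:
  assumes I: "ideal I A" and a: "a \<in> carrier A"
  shows "c \<odot>\<^bsub>quot_algebra A I\<^esub> (I +> a) = I +> (c \<odot> a)"
proof -
  interpret ideal I A by fact
  have coset_eq: "I +> (c \<odot> x) = I +> (c \<odot> a)" if "x \<in> I +> a" for x
  proof -
    obtain i where i: "i \<in> I" "x = i \<oplus> a" using \<open>x \<in> I +> a\<close> by (auto simp: a_r_coset_def')
    have "c \<odot> x = c \<odot> i \<oplus> c \<odot> a" using i a Icarr by (simp add: smult_add)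
    moreover have "c \<odot> i \<in> I" using ideal_smult[OF I i(1)] .
    ultimately have "c \<odot> x \<in> I +> (c \<odot> a)" by (auto simp: a_r_coset_def')
    then show ?thesis using smult_closed[OF a] a_repr_independence' by simp
  qed
  have "(\<Union>x\<in>I +> a. I +> (c \<odot> x)) = (\<Union>x\<in>I +> a. I +> (c \<odot> a))"
    by (intro SUP_cong HOL.refl coset_eq)
  also have "\<dots> = I +> (c \<odot> a)" using a_rcos_self[OF a] by blast
  finally show ?thesis by (simp add: quot_algebra_def)
qed

lemma quot_carrier: "carrier (quot_algebra A I) = {I +> a | a. a \<in> carrier A}"
  by (auto simp: quot_algebra_def FactRing_def A_RCOSETS_def')

lemma quot_hom: "ideal I A \<Longrightarrow> (+>) I \<in> ring_hom A (quot_algebra A I)"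
  using ideal.rcos_ring_hom[of I A] by (simp add: ring_hom_def quot_algebra_simps)

lemma complex_algebra_quot:
  assumes I: "ideal I A"
  shows "complex_algebra (quot_algebra A I)"
proof -
  interpret Q: ring "A Quot I" using I by (rule ideal.quotient_is_ring)
  let ?B = "quot_algebra A I"
  have "abelian_group ?B"
    by (rule abelian_groupI)
      (use Q.a_assoc Q.a_comm Q.l_neg Q.a_inv_closed in \<open>auto simp: quot_algebra_simps\<close>)
  moreover have "monoid ?B"
    by (rule monoidI) (auto simp: quot_algebra_simps Q.m_assoc)
  ultimately have "ring ?B"
    by (intro ringI) (auto simp: quot_algebra_simps Q.l_distr Q.r_distr)
  moreover note hom = ring_hom_memE(2,3)[OF quot_hom[OF I], symmetric]
  have "complex_algebra_axioms ?B"
    unfolding complex_algebra_axioms_def quot_carrier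
    by (auto simp: quot_smult[OF I] hom smult_closed smult_add smult_smult smult_one
        intro: smult_closed)
      (auto simp: smult_mult_left, auto simp: smult_mult_left[symmetric] smult_mult_right)
  ultimately show ?thesis by (intro complex_algebra.intro)
qed

end

section \<open>Representations as systems of operators\<close>

locale algebra_rep = complex_algebra A + complex_space scale Basis
  for A :: "'a calgebra" (structure) and scale :: "complex \<Rightarrow> 'v::ab_group_add \<Rightarrow> 'v" (infixr \<open>*s\<close> 75)
    and Basis :: "'v set" +
  fixes \<rho> :: "'a \<Rightarrow> 'v \<Rightarrow> 'v"
  assumes rep: "algebra_representation A scale \<rho>"
begin

lemma rep_hom: "\<rho> \<in> ring_hom A (End_algebra scale)"
  using rep by (simp add: algebra_representation_def)

lemma rep_lin: "a \<in> carrier A \<Longrightarrow> lin (\<rho> a)"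
  using ring_hom_memE(1)[OF rep_hom] by (simp add: End_algebra_def)

lemma rep_mult: "a \<in> carrier A \<Longrightarrow> b \<in> carrier A \<Longrightarrow> \<rho> (a \<otimes> b) v = \<rho> a (\<rho> b v)"
  using ring_hom_memE(2)[OF rep_hom] by (simp add: End_algebra_def)

lemma rep_add: "a \<in> carrier A \<Longrightarrow> b \<in> carrier A \<Longrightarrow> \<rho> (a \<oplus> b) v = \<rho> a v + \<rho> b v"
  using ring_hom_memE(3)[OF rep_hom] by (simp add: End_algebra_def)

lemma rep_one: "\<rho> \<one> v = v"
  using ring_hom_memE(4)[OF rep_hom] by (simp add: End_algebra_def)

lemma rep_smult: "a \<in> carrier A \<Longrightarrow> \<rho> (c \<odot> a) v = c *s \<rho> a v"
  using rep by (simp add: algebra_representation_def End_algebra_def)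

lemma rep_zero: "\<rho> \<zero> v = 0"
  using rep_add[of \<zero> \<zero> v] by simp

lemma rep_uminus: "a \<in> carrier A \<Longrightarrow> \<rho> (\<ominus> a) v = - \<rho> a v"
  using rep_add[of a "\<ominus> a" v] rep_zero by (simp add: r_neg eq_neg_iff_add_eq_0 add.commute)

lemma rep_minus: "a \<in> carrier A \<Longrightarrow> b \<in> carrier A \<Longrightarrow> \<rho> (a \<ominus> b) v = \<rho> a v - \<rho> b v"
  by (simp add: a_minus_def rep_add rep_uminus)

end

lemma (in complex_algebra) quot_rep:
  assumes I: "ideal I A" and \<rho>: "algebra_representation (quot_algebra A I) scale \<rho>"
  shows "algebra_representation A scale (\<lambda>a. \<rho> (I +> a))"
proof -
  have "\<rho> \<in> ring_hom (quot_algebra A I) (End_algebra scale)" using \<rho> by (simp add: algebra_representation_def)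
  from ring_hom_trans[OF quot_hom[OF I] this] have "(\<lambda>a. \<rho> (I +> a)) \<in> ring_hom A (End_algebra scale)"
    by (simp add: comp_def)
  moreover have "\<rho> (I +> (c \<odot> a)) = c \<odot>\<^bsub>End_algebra scale\<^esub> \<rho> (I +> a)" if "a \<in> carrier A" for c a
    using \<rho> that unfolding quot_smult[OF I that, symmetric] algebra_representation_def quot_carrier by blast
  ultimately show ?thesis by (simp add: algebra_representation_def)
qed

lemma (in complex_algebra) quot_rep_zero:
  assumes I: "ideal I A" and \<rho>: "algebra_representation (quot_algebra A I) scale \<rho>"
    and V: "complex_space scale Basis" and a: "a \<in> I"
  shows "\<rho> (I +> a) v = 0"
proof -
  interpret Q: algebra_rep "quot_algebra A I" scale Basis \<rho>
    using complex_algebra_quot[OF I] V \<rho> by (intro algebra_rep.intro algebra_rep_axioms.intro)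
  have "I +> a = \<zero>\<^bsub>quot_algebra A I\<^esub>"
    using a_coset_join2[OF _ _ a] ideal.Icarr[OF I a] ideal.axioms(1)[OF I]
    unfolding quot_algebra_simps by (simp add: FactRing_def additive_subgroup.a_subgroup)
  then show ?thesis using Q.rep_zero by simp
qed

lemma braid_relations_words: "braid_relations n \<subseteq> words (braid_gens n) \<times> words (braid_gens n)"
  by (auto simp: braid_relations_def T_word_def x_word_def words_def braid_gens_def)

text \<open>A representation of the cyclotomic algebra, its pullbacks \<open>\<sigma>\<close> to the affine Hecke algebra, \<open>\<Phi>\<close> to the
  group algebra and \<open>\<pi>\<close> to the braid group, and the operators \<open>op w\<close> by which words act.\<close>

locale cyclotomic_rep = complex_space scale Basis
  for scale :: "complex \<Rightarrow> 'v::ab_group_add \<Rightarrow> 'v" (infixr \<open>*s\<close> 75) and Basis :: "'v set" +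
  fixes e :: int and n :: nat and s :: "int list" and q :: complex and Qs :: "complex list"
    and \<rho> :: "braid_alg set set \<Rightarrow> 'v \<Rightarrow> 'v"
  assumes e_gt_1: "e > 1" and n_ge_1: "n \<ge> 1"
    and q_eq: "q = exp (2 * of_real pi * \<i> / of_int e)"
    and Qs_eq: "Qs = map (\<lambda>k. q powi k) s"
    and rep: "algebra_representation (cyclotomic_hecke q Qs n) scale \<rho>"
begin

abbreviation "W \<equiv> words (braid_gens n)"
abbreviation "\<sigma> \<equiv> to_affine_rep q Qs n \<rho>"
abbreviation "\<pi> \<equiv> to_braid_rep q n \<sigma>"

sublocale G: group "braid_group n"
  unfolding braid_group_def by (rule group_presented_group[OF braid_relations_words])

sublocale B: complex_algebra "braid_algebra n"
  unfolding braid_algebra_def by (rule G.complex_algebra_group_algebra)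

lemma braid_class_carrier: "w \<in> W \<Longrightarrow> braid_class n w \<in> carrier (braid_group n)"
  unfolding braid_group_def braid_class_def in_presented_group_iff[OF braid_relations_words] by blast

lemma braid_class_elem: "w \<in> W \<Longrightarrow> group_elem (braid_class n w) \<in> carrier (braid_algebra n)"
  unfolding braid_algebra_def using G.group_elem_carrier braid_class_carrier by blast

lemma T_word_W: "i \<in> {1..<n} \<Longrightarrow> [(TGen i, b)] \<in> W"
  and x_word_W: "j \<in> {1..n} \<Longrightarrow> [(XGen j, b)] \<in> W"
  and nil_W: "[] \<in> W"
  by (auto simp: words_def braid_gens_def)

lemma hecke_relators_carrier: "hecke_relators q n \<subseteq> carrier (braid_algebra n)"
  unfolding hecke_relators_def Let_def
  using braid_class_elem[OF T_word_W] by (auto simp: T_word_def B.smult_closed)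

lemma ideal_hecke: "ideal (hecke_ideal q n) (braid_algebra n)"
  unfolding hecke_ideal_def by (rule B.genideal_ideal[OF hecke_relators_carrier])

sublocale H: complex_algebra "affine_hecke q n"
  unfolding affine_hecke_def by (rule B.complex_algebra_quot[OF ideal_hecke])

lemma braid_to_affine_carrier: "w \<in> W \<Longrightarrow> braid_to_affine q n (braid_class n w) \<in> carrier (affine_hecke q n)"
  unfolding affine_hecke_def braid_to_affine_def B.quot_carrier using braid_class_elem by blast

lemma X_elem_carrier: "j \<in> {1..n} \<Longrightarrow> X_elem q n j \<in> carrier (affine_hecke q n)"
  unfolding X_elem_def x_word_def by (intro H.smult_closed braid_to_affine_carrier x_word_W)

lemma cyclotomic_relator_carrier: "cyclotomic_relator q Ps n \<in> carrier (affine_hecke q n)"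
proof -
  have "1 \<in> {1..n}" using n_ge_1 by simp
  note * = X_elem_carrier[OF this]
  show ?thesis
    unfolding cyclotomic_relator_def Let_def by (induction Ps) (simp_all add: *[simplified] H.smult_closed)
qed

lemma ideal_cyclotomic: "ideal (cyclotomic_ideal q Qs n) (affine_hecke q n)"
  unfolding cyclotomic_ideal_def using cyclotomic_relator_carrier by (intro H.genideal_ideal) simp

sublocale C: complex_algebra "cyclotomic_hecke q Qs n"
  unfolding cyclotomic_hecke_def by (rule H.complex_algebra_quot[OF ideal_cyclotomic])

sublocale CR: algebra_rep "cyclotomic_hecke q Qs n" scale Basis \<rho>
  by unfold_locales (rule rep)

sublocale HR: algebra_rep "affine_hecke q n" scale Basis \<sigma>
  using H.quot_rep[OF ideal_cyclotomic rep[unfolded cyclotomic_hecke_def]]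
  by unfold_locales (simp add: to_affine_rep_def[abs_def])

definition \<Phi> :: "braid_alg \<Rightarrow> 'v \<Rightarrow> 'v" where
  "\<Phi> a = \<sigma> (hecke_ideal q n +>\<^bsub>braid_algebra n\<^esub> a)"

sublocale BR: algebra_rep "braid_algebra n" scale Basis \<Phi>
  using B.quot_rep[OF ideal_hecke HR.rep[unfolded affine_hecke_def]]
  by unfold_locales (simp add: \<Phi>_def[abs_def])

lemma \<pi>_eq: "\<pi> g = \<Phi> (group_elem g)"
  by (simp add: to_braid_rep_def \<Phi>_def braid_to_affine_def)

definition op :: "braid_gen word \<Rightarrow> 'v \<Rightarrow> 'v" where
  "op w = \<pi> (braid_class n w)"

lemma op_lin: "w \<in> W \<Longrightarrow> lin (op w)"
  unfolding op_def \<pi>_eq by (rule BR.rep_lin[OF braid_class_elem])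

lemma op_append: "u \<in> W \<Longrightarrow> w \<in> W \<Longrightarrow> op (u @ w) v = op u (op w v)"
proof -
  assume u: "u \<in> W" and w: "w \<in> W"
  have "braid_class n (u @ w) = braid_class n u \<otimes>\<^bsub>braid_group n\<^esub> braid_class n w"
    unfolding braid_group_def braid_class_def using presented_group_mult[OF braid_relations_words u w] by simp
  then have "group_elem (braid_class n (u @ w)) =
      group_elem (braid_class n u) \<otimes>\<^bsub>braid_algebra n\<^esub> group_elem (braid_class n w)"
    unfolding braid_algebra_def G.group_elem_mult by simp
  then show ?thesis
    unfolding op_def \<pi>_eq using BR.rep_mult[OF braid_class_elem[OF u] braid_class_elem[OF w]] by simp
qed

lemma op_Nil: "op [] v = v"
proof -
  have "group_elem (braid_class n []) = \<one>\<^bsub>braid_algebra n\<^esub>"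
    unfolding braid_algebra_def group_algebra_simps(2)
    by (simp add: braid_class_def braid_group_def presented_group_def)
  then show ?thesis unfolding op_def \<pi>_eq using BR.rep_one by simp
qed

lemma op_eqI: "(u, w) \<in> word_eq (braid_gens n) (braid_relations n) \<Longrightarrow> op u = op w"
  unfolding op_def braid_class_def
  using equiv_class_eq[OF equiv_word_eq[OF braid_relations_words]] by metis

lemma op_relation: "(l, r) \<in> braid_relations n \<Longrightarrow> op l = op r"
  using word_eq.relation[of "[]" "braid_gens n" "[]" l r "braid_relations n"] nil_W by (intro op_eqI) simp

lemma op_cancel: "[(g, b)] \<in> W \<Longrightarrow> op [(g, b)] (op [(g, \<not> b)] v) = v"
proof -
  assume g: "[(g, b)] \<in> W"
  then have g': "[(g, \<not> b)] \<in> W" "g \<in> braid_gens n" by (auto simp: words_def)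
  have "op ([(g, b)] @ [(g, \<not> b)]) = op []"
    using word_eq.cancel[of "[]" "braid_gens n" "[]" g b "braid_relations n"] nil_W g' by (intro op_eqI) simp
  then show ?thesis using op_append[OF g g'(1)] op_Nil by metis
qed

lemma op_inj: "[(g, b)] \<in> W \<Longrightarrow> inj (op [(g, b)])"
proof (rule inj_on_inverseI[where g = "op [(g, \<not> b)]"])
  fix v assume "[(g, b)] \<in> W"
  then have "[(g, \<not> b)] \<in> W" by (auto simp: words_def)
  from op_cancel[OF this] show "op [(g, \<not> b)] (op [(g, b)] v) = v" by simp
qed

definition T :: "nat \<Rightarrow> 'v \<Rightarrow> 'v" where "T i = op (T_word i)"
definition x :: "nat \<Rightarrow> 'v \<Rightarrow> 'v" where "x j = op (x_word j)"
definition X :: "nat \<Rightarrow> 'v \<Rightarrow> 'v" where "X j = \<sigma> (X_elem q n j)"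

lemma norm_q: "cmod q = 1" and q_nz: "q \<noteq> 0"
  by (simp_all add: q_eq)

lemma q_ne_1: "q \<noteq> 1"
proof
  assume "q = 1"
  moreover have "q = cis (2 * pi / e)" unfolding q_eq cis_conv_exp by (simp add: mult.commute mult.left_commute)
  ultimately have "cos (2 * pi / e) = 1" by (metis cis.sel(1) one_complex.sel(1))
  then obtain k :: int where "2 * pi / e = real_of_int k * 2 * pi" unfolding cos_one_2pi_int by blast
  then have "1 = real_of_int (k * e)" using e_gt_1 by (simp add: field_simps)
  then have "k * e = 1" by linarith
  then show False using e_gt_1 by (auto simp: zmult_eq_1_iff)
qed

lemma X_eq: "j \<in> {1..n} \<Longrightarrow> X j v = (q powi (1 - int j)) *s x j v"
  unfolding X_def X_elem_def x_def op_def x_word_def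
  by (simp add: HR.rep_smult[OF braid_to_affine_carrier[OF x_word_W]] to_braid_rep_def)

lemma x_eq: "j \<in> {1..n} \<Longrightarrow> x j v = (q powi (int j - 1)) *s X j v"
  using q_nz by (simp add: X_eq flip: power_int_add)

lemma T_W: "i \<in> {1..<n} \<Longrightarrow> T_word i \<in> W" and x_W: "j \<in> {1..n} \<Longrightarrow> x_word j \<in> W"
  using T_word_W x_word_W by (simp_all add: T_word_def x_word_def)

lemma T_quadratic: 
  assumes i: "i \<in> {1..<n}"
  shows "T i (T i v) = (q - 1) *s T i v + q *s v"
proof -
  let ?t = "group_elem (braid_class n (T_word i))" and ?B = "braid_algebra n"
  have t: "?t \<in> carrier ?B" using braid_class_elem[OF T_W[OF i]] .
  let ?r = "(?t \<ominus>\<^bsub>?B\<^esub> q \<odot>\<^bsub>?B\<^esub> \<one>\<^bsub>?B\<^esub>) \<otimes>\<^bsub>?B\<^esub> (?t \<oplus>\<^bsub>?B\<^esub> \<one>\<^bsub>?B\<^esub>)"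
  have "?r \<in> hecke_relators q n" using i by (auto simp: hecke_relators_def Let_def)
  then have "?r \<in> hecke_ideal q n"
    unfolding hecke_ideal_def using B.genideal_self[OF hecke_relators_carrier] by blast
  then have "\<Phi> ?r v = 0"
    unfolding \<Phi>_def
    using B.quot_rep_zero[OF ideal_hecke HR.rep[unfolded affine_hecke_def] complex_space_axioms] by blast
  then have "T i (T i v + v) - q *s (T i v + v) = 0"
    unfolding T_def op_def \<pi>_eq
    using t by (simp add: BR.rep_mult BR.rep_minus BR.rep_add BR.rep_smult BR.rep_one B.smult_closed)
  then show ?thesis
    using lin_add[OF op_lin[OF T_W[OF i]]]
    by (simp add: T_def scale_right_distrib scale_left_diff_distrib algebra_simps)
qed

text \<open>The product of the \<open>X\<^sub>1 - Q\<close> acts as zero, and on an eigenvector as the product of the \<open>c - Q\<close>.\<close>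

lemma X_1_eigenvalue:
  assumes v: "X 1 v = c *s v" "v \<noteq> 0"
  shows "\<exists>k::int. c = q powi k"
proof -
  let ?H = "affine_hecke q n"
  have 1: "1 \<in> {1..n}" using n_ge_1 by simp
  note X1 = X_elem_carrier[OF this]
  have prod: "\<sigma> (cyclotomic_relator q Ps n) v = (\<Prod>Q\<leftarrow>Ps. c - Q) *s v" for Ps
  proof (induction Ps)
    case Nil
    then show ?case by (simp add: cyclotomic_relator_def Let_def HR.rep_one)
  next
    case (Cons Q Ps)
    let ?r = "cyclotomic_relator q Ps n"
    note r = cyclotomic_relator_carrier[of Ps]
    have "cyclotomic_relator q (Q # Ps) n = (X_elem q n 1 \<ominus>\<^bsub>?H\<^esub> Q \<odot>\<^bsub>?H\<^esub> \<one>\<^bsub>?H\<^esub>) \<otimes>\<^bsub>?H\<^esub> ?r"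
      by (simp add: cyclotomic_relator_def Let_def)
    then have "\<sigma> (cyclotomic_relator q (Q # Ps) n) v = X 1 (\<sigma> ?r v) - Q *s \<sigma> ?r v"
      using X1 r by (simp add: HR.rep_mult HR.rep_minus HR.rep_smult HR.rep_one H.smult_closed X_def)
    also have "\<dots> = (\<Prod>Q\<leftarrow>Ps. c - Q) *s (c *s v) - Q *s ((\<Prod>Q\<leftarrow>Ps. c - Q) *s v)"
      unfolding Cons.IH using lin_scale[OF HR.rep_lin[OF X1]] v(1) by (simp add: X_def)
    finally show ?case by (simp add: scale_left_diff_distrib algebra_simps)
  qed
  have "cyclotomic_relator q Qs n \<in> cyclotomic_ideal q Qs n"
    unfolding cyclotomic_ideal_def using H.genideal_self' cyclotomic_relator_carrier by blast
  then have "\<sigma> (cyclotomic_relator q Qs n) v = 0"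
    unfolding to_affine_rep_def
    using H.quot_rep_zero[OF ideal_cyclotomic rep[unfolded cyclotomic_hecke_def] complex_space_axioms] by blast
  then have "(\<Prod>Q\<leftarrow>Qs. c - Q) = 0" using prod v(2) by simp
  then have "0 \<in> set (map (\<lambda>Q. c - Q) Qs)" by (simp only: prod_list_zero_iff)
  then show ?thesis unfolding Qs_eq by auto
qed

lemma T_lin: "i \<in> {1..<n} \<Longrightarrow> lin (T i)" and x_lin: "j \<in> {1..n} \<Longrightarrow> lin (x j)"
  unfolding T_def x_def by (simp_all add: op_lin T_W x_W)

lemma X_lin: "j \<in> {1..n} \<Longrightarrow> lin (X j)"
  unfolding X_def by (rule HR.rep_lin[OF X_elem_carrier])

lemma T_inj: "i \<in> {1..<n} \<Longrightarrow> inj (T i)" and x_inj: "j \<in> {1..n} \<Longrightarrow> inj (x j)"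
  unfolding T_def x_def T_word_def x_word_def by (simp_all add: op_inj T_word_W x_word_W)

lemma X_inj: "j \<in> {1..n} \<Longrightarrow> inj (X j)"
  using x_inj q_nz by (auto simp: inj_def X_eq)

lemma rel2:
  assumes "(u @ w, u' @ w') \<in> braid_relations n" "u \<in> W" "w \<in> W" "u' \<in> W" "w' \<in> W"
  shows "op u (op w v) = op u' (op w' v)"
  using op_relation[OF assms(1)] op_append[OF assms(2,3)] op_append[OF assms(4,5)] by metis

lemma T_braid:
  assumes i: "i \<in> {1..<n}" "i + 1 \<in> {1..<n}"
  shows "T i (T (i + 1) (T i v)) = T (i + 1) (T i (T (i + 1) v))"
proof -
  have "(T_word i @ (T_word (i+1) @ T_word i), T_word (i+1) @ (T_word i @ T_word (i+1))) \<in> braid_relations n"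
    using i unfolding braid_relations_def by auto
  from rel2[OF this] show ?thesis
    using T_W[OF i(1)] T_W[OF i(2)] by (simp add: T_def op_append words_append[OF braid_relations_words])
qed

lemma T_far:
  assumes "i \<in> {1..<n}" "j \<in> {1..<n}" "i + 1 < j \<or> j + 1 < i"
  shows "T i (T j v) = T j (T i v)"
proof -
  have "(T_word i @ T_word j, T_word j @ T_word i) \<in> braid_relations n"
  proof -
    have "\<bar>int i - int j\<bar> > 1" using assms(3) by linarith
    then show ?thesis using assms(1,2) unfolding braid_relations_def by blast
  qed
  from rel2[OF this] show ?thesis using T_W assms by (simp add: T_def)
qed

lemma x_comm:
  assumes "i \<in> {1..n}" "j \<in> {1..n}"
  shows "x i (x j v) = x j (x i v)"
proof -
  have "(x_word i @ x_word j, x_word j @ x_word i) \<in> braid_relations n"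
    using assms unfolding braid_relations_def by blast
  from rel2[OF this] show ?thesis using x_W assms by (simp add: x_def)
qed

lemma T_x_T:
  assumes i: "i \<in> {1..<n}"
  shows "T i (x i (T i v)) = x (i + 1) v"
proof -
  have "(T_word i @ x_word i @ T_word i, x_word (i+1)) \<in> braid_relations n"
    using i unfolding braid_relations_def by blast
  moreover have "T_word i \<in> W" "x_word i \<in> W" using i T_W x_W by auto
  ultimately show ?thesis
    using op_relation op_append words_append[OF braid_relations_words] unfolding T_def x_def by metis
qed

lemma T_x_far:
  assumes "i \<in> {1..<n}" "j \<in> {1..n}" "j \<noteq> i" "j \<noteq> i + 1"
  shows "T i (x j v) = x j (T i v)"
proof -
  have "(T_word i @ x_word j, x_word j @ T_word i) \<in> braid_relations n"
    using assms unfolding braid_relations_def by blast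
  from rel2[OF this] show ?thesis using T_W x_W assms by (simp add: T_def x_def)
qed

lemma calibrated_moduleI:
  assumes ss: "\<And>j v c. j \<in> {1..n} \<Longrightarrow> X j (X j v - c *s v) = c *s (X j v - c *s v) \<Longrightarrow> X j v = c *s v"
  shows "calibrated_module scale Basis n q T X e"
proof
  fix i j v c
  assume i: "i \<in> {1..<n}"
  then have i': "i \<in> {1..n}" "i + 1 \<in> {1..n}" by auto
  show "T i (X i (T i v)) = q *s X (i + 1) v"
  proof -
    have "q powi (1 - int i) = q * q powi (1 - int (i + 1))"
      using power_int_add[of q 1 "- int i"] q_nz by simp
    then show ?thesis
      unfolding X_eq[OF i'(1)] X_eq[OF i'(2)] T_x_T[OF i, symmetric] lin_scale[OF T_lin[OF i]] by simp
  qed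
  show "T i (X j v) = X j (T i v)" if "j \<in> {1..n}" "j \<noteq> i" "j \<noteq> i + 1"
    unfolding X_eq[OF that(1)] lin_scale[OF T_lin[OF i]] T_x_far[OF i that] ..
  show "T i (T (i + 1) (T i v)) = T (i + 1) (T i (T (i + 1) v))" if "i + 1 \<in> {1..<n}"
    using T_braid[OF i that] .
next
  fix i j v
  assume i: "i \<in> {1..n}" and j: "j \<in> {1..n}"
  show "X i (X j v) = X j (X i v)"
    unfolding X_eq[OF i] X_eq[OF j] lin_scale[OF x_lin[OF i]] lin_scale[OF x_lin[OF j]] x_comm[OF i j]
    by (simp add: mult.commute)
qed (rule lin_add[OF T_lin] lin_scale[OF T_lin] lin_add[OF X_lin] lin_scale[OF X_lin] X_inj T_quadratic T_far
    X_1_eigenvalue ss q_nz q_ne_1 e_gt_1 q_eq; assumption)+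

end

section \<open>Unitarity and calibration\<close>

context cyclotomic_rep
begin

subsection \<open>Invariant subspaces\<close>

text \<open>The inverse of a letter needs an argument: a subspace of finite dimension that an injective
  operator maps into itself is mapped onto itself.\<close>

lemma op_letter_invariant:
  assumes Z: "subspace Z" "\<And>i. i \<in> {1..<n} \<Longrightarrow> T i ` Z \<subseteq> Z" "\<And>j. j \<in> {1..n} \<Longrightarrow> X j ` Z \<subseteq> Z"
    and g: "[(g, b)] \<in> W" and v: "v \<in> Z"
  shows "op [(g, b)] v \<in> Z"
proof -
  have gT: "[(g, True)] \<in> W" and gF: "[(g, False)] \<in> W" using g by (auto simp: words_def)
  have sub: "op [(g, True)] ` Z \<subseteq> Z"
  proof (cases g)
    case (TGen i)
    then have "i \<in> {1..<n}" using g by (auto simp: words_def braid_gens_def)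
    then show ?thesis using Z(2) TGen by (simp add: T_def T_word_def)
  next
    case (XGen j)
    then have j: "j \<in> {1..n}" using g by (auto simp: words_def braid_gens_def)
    then have "x j ` Z \<subseteq> Z" using Z(3)[OF j] subspace_scale[OF Z(1)] by (auto simp: x_eq)
    then show ?thesis using XGen by (simp add: x_def x_word_def)
  qed
  show ?thesis
  proof (cases b)
    case True
    then have "op [(g, b)] v \<in> op [(g, True)] ` Z" using v by simp
    then show ?thesis using sub by (rule subsetD[rotated])
  next
    case False
    have "v \<in> op [(g, True)] ` Z"
      unfolding image_subspace_eq[OF op_lin[OF gT] Z(1) sub op_inj[OF gT]] by (rule v)
    then obtain u where u: "u \<in> Z" "v = op [(g, True)] u" by (rule imageE)
    then show ?thesis using op_cancel[OF gF, of u] False by simp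
  qed
qed

lemma op_invariant:
  assumes Z: "subspace Z" "\<And>i. i \<in> {1..<n} \<Longrightarrow> T i ` Z \<subseteq> Z" "\<And>j. j \<in> {1..n} \<Longrightarrow> X j ` Z \<subseteq> Z"
    and w: "w \<in> W" and v: "v \<in> Z"
  shows "op w v \<in> Z"
  using w
proof (induction w)
  case Nil
  then show ?case using v by (simp add: op_Nil)
next
  case (Cons l w)
  obtain g b where l: "l = (g, b)" by fastforce
  have "[(g, b)] \<in> W" "w \<in> W" using Cons.prems l by (auto simp: words_def)
  then show ?case
    using op_letter_invariant[OF Z _ Cons.IH] op_append[of "[(g, b)]" w v] l by simp
qed

lemma \<Phi>_invariant:
  assumes Z: "subspace Z" "\<And>i. i \<in> {1..<n} \<Longrightarrow> T i ` Z \<subseteq> Z" "\<And>j. j \<in> {1..n} \<Longrightarrow> X j ` Z \<subseteq> Z"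
    and f: "f \<in> carrier (braid_algebra n)" and v: "v \<in> Z"
  shows "\<Phi> f v \<in> Z"
  using f
proof (induction "card {g. f g \<noteq> 0}" arbitrary: f rule: less_induct)
  case less
  note car = less.prems[unfolded braid_algebra_def group_algebra_simps(1)]
  show ?case
  proof (cases "\<exists>g. f g \<noteq> 0")
    case False
    then have "f = \<zero>\<^bsub>braid_algebra n\<^esub>" by (auto simp: braid_algebra_def group_algebra_simps)
    then show ?thesis using BR.rep_zero subspace_0[OF Z(1)] by simp
  next
    case True
    then obtain g where g: "f g \<noteq> 0" by blast
    then have gG: "g \<in> carrier (braid_group n)" using car by blast
    then obtain w where w: "w \<in> W" "g = braid_class n w"
      unfolding braid_group_def in_presented_group_iff[OF braid_relations_words] braid_class_def by blast
    define k where "k = f(g := 0)"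
    have supp: "{x. k x \<noteq> 0} = {x. f x \<noteq> 0} - {g}" by (auto simp: k_def)
    then have kB: "k \<in> carrier (braid_algebra n)"
      using car unfolding braid_algebra_def group_algebra_simps(1) by auto
    have "card {x. k x \<noteq> 0} < card {x. f x \<noteq> 0}"
      unfolding supp using car g by (intro card_Diff1_less) auto
    then have "\<Phi> k v \<in> Z" using less.hyps kB by blast
    moreover have "\<Phi> (group_elem g) v \<in> Z"
      using op_invariant[OF Z w(1) v] unfolding op_def \<pi>_eq w(2) .
    moreover have "f = k \<oplus>\<^bsub>braid_algebra n\<^esub> (f g \<odot>\<^bsub>braid_algebra n\<^esub> group_elem g)"
      by (auto simp: braid_algebra_def group_algebra_simps group_elem_def k_def fun_eq_iff)
    moreover have "group_elem g \<in> carrier (braid_algebra n)" using braid_class_elem w by blast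
    ultimately show ?thesis
      using BR.rep_add[OF kB B.smult_closed] BR.rep_smult subspace_add[OF Z(1)] subspace_scale[OF Z(1)] by metis
  qed
qed

text \<open>The algebra is spanned by the images of words, so invariance has to be checked on letters only; and the
  inverse letters come for free by \<open>op_letter_invariant\<close>.\<close>

lemma invariant_subspace_iff:
  "invariant_subspace scale (\<rho> ` carrier (cyclotomic_hecke q Qs n)) Z \<longleftrightarrow>
    subspace Z \<and> (\<forall>i\<in>{1..<n}. T i ` Z \<subseteq> Z) \<and> (\<forall>j\<in>{1..n}. X j ` Z \<subseteq> Z)"
proof
  assume Z: "invariant_subspace scale (\<rho> ` carrier (cyclotomic_hecke q Qs n)) Z"
  have \<sigma>: "\<sigma> b ` Z \<subseteq> Z" if "b \<in> carrier (affine_hecke q n)" for b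
  proof -
    have "cyclotomic_ideal q Qs n +>\<^bsub>affine_hecke q n\<^esub> b \<in> carrier (cyclotomic_hecke q Qs n)"
      unfolding cyclotomic_hecke_def H.quot_carrier using that by blast
    then show ?thesis using Z unfolding invariant_subspace_def to_affine_rep_def by blast
  qed
  have "T i ` Z \<subseteq> Z" if "i \<in> {1..<n}" for i
    using \<sigma>[OF braid_to_affine_carrier[OF T_W[OF that]]] by (simp add: T_def op_def to_braid_rep_def)
  moreover have "X j ` Z \<subseteq> Z" if "j \<in> {1..n}" for j
    using \<sigma>[OF X_elem_carrier[OF that]] by (simp add: X_def)
  ultimately show "subspace Z \<and> (\<forall>i\<in>{1..<n}. T i ` Z \<subseteq> Z) \<and> (\<forall>j\<in>{1..n}. X j ` Z \<subseteq> Z)"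
    using Z by (simp add: invariant_subspace_def)
next
  assume Z: "subspace Z \<and> (\<forall>i\<in>{1..<n}. T i ` Z \<subseteq> Z) \<and> (\<forall>j\<in>{1..n}. X j ` Z \<subseteq> Z)"
  have "\<rho> c v \<in> Z" if c: "c \<in> carrier (cyclotomic_hecke q Qs n)" and v: "v \<in> Z" for c v
  proof -
    obtain b where b: "c = cyclotomic_ideal q Qs n +>\<^bsub>affine_hecke q n\<^esub> b" "b \<in> carrier (affine_hecke q n)"
      using c unfolding cyclotomic_hecke_def H.quot_carrier by blast
    obtain f where f: "b = hecke_ideal q n +>\<^bsub>braid_algebra n\<^esub> f" "f \<in> carrier (braid_algebra n)"
      using b(2) unfolding affine_hecke_def B.quot_carrier by blast
    have "\<rho> c v = \<Phi> f v" unfolding b(1) f(1) \<Phi>_def to_affine_rep_def ..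
    then show ?thesis using \<Phi>_invariant[of Z f v] Z f(2) v by simp
  qed
  then show "invariant_subspace scale (\<rho> ` carrier (cyclotomic_hecke q Qs n)) Z"
    using Z unfolding invariant_subspace_def by blast
qed

subsection \<open>The Jucys--Murphy subalgebra\<close>

lemma X_elem_unit:
  assumes j: "j \<in> {1..n}"
  shows "X_elem q n j \<in> Units (affine_hecke q n)"
proof -
  let ?H = "affine_hecke q n"
  define y where "y b = braid_to_affine q n (braid_class n [(XGen j, b)])" for b
  have y: "y b \<in> carrier ?H" for b unfolding y_def by (rule braid_to_affine_carrier[OF x_word_W[OF j]])
  have mult: "y b \<otimes>\<^bsub>?H\<^esub> y (\<not> b) = \<one>\<^bsub>?H\<^esub>" for b
  proof -
    let ?u = "[(XGen j, b)]" and ?w = "[(XGen j, \<not> b)]"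
    have uw: "?u \<in> W" "?w \<in> W" using x_word_W[OF j] by auto
    note hom = ring_hom_memE[OF B.quot_hom[OF ideal_hecke, folded affine_hecke_def]]
    have "(?u @ ?w, []) \<in> word_eq (braid_gens n) (braid_relations n)"
      using word_eq.cancel[of "[]" "braid_gens n" "[]" "XGen j" b] nil_W j by (simp add: braid_gens_def)
    then have "braid_class n (?u @ ?w) = braid_class n []"
      unfolding braid_class_def by (rule equiv_class_eq[OF equiv_word_eq[OF braid_relations_words]])
    then have "braid_class n ?u \<otimes>\<^bsub>braid_group n\<^esub> braid_class n ?w = \<one>\<^bsub>braid_group n\<^esub>"
      using presented_group_mult[OF braid_relations_words uw]
      by (simp add: braid_group_def braid_class_def presented_group_def)
    then have "group_elem (braid_class n ?u) \<otimes>\<^bsub>braid_algebra n\<^esub> group_elem (braid_class n ?w) = \<one>\<^bsub>braid_algebra n\<^esub>"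
      unfolding braid_algebra_def G.group_elem_mult group_algebra_simps(2) by simp
    then show ?thesis
      unfolding y_def braid_to_affine_def
      using hom(2)[OF braid_class_elem[OF uw(1)] braid_class_elem[OF uw(2)]] hom(4) by simp
  qed
  let ?z = "(q powi (int j - 1)) \<odot>\<^bsub>?H\<^esub> y False"
  have prod: "(c \<odot>\<^bsub>?H\<^esub> y b) \<otimes>\<^bsub>?H\<^esub> (d \<odot>\<^bsub>?H\<^esub> y (\<not> b)) = \<one>\<^bsub>?H\<^esub>" if "d * c = 1" for b c d
    using y H.smult_closed[OF y] that
    by (simp add: H.smult_mult_right[symmetric] H.smult_mult_left[symmetric] mult H.smult_smult H.smult_one)
  have "q powi (int j - 1) * q powi (1 - int j) = 1"
    using q_nz by (simp flip: power_int_add)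
  then have "X_elem q n j \<otimes>\<^bsub>?H\<^esub> ?z = \<one>\<^bsub>?H\<^esub>" "?z \<otimes>\<^bsub>?H\<^esub> X_elem q n j = \<one>\<^bsub>?H\<^esub>"
    using prod[of "q powi (int j - 1)" "q powi (1 - int j)" True] prod[of "q powi (1 - int j)" "q powi (int j - 1)" False]
    by (simp_all add: X_elem_def x_word_def y_def mult.commute)
  then show ?thesis
    using X_elem_carrier[OF j] H.smult_closed[OF y] unfolding Units_def by blast
qed

definition Y :: "nat \<Rightarrow> 'v \<Rightarrow> 'v" where
  "Y j = \<sigma> (inv\<^bsub>affine_hecke q n\<^esub> (X_elem q n j))"

lemma X_Y: "j \<in> {1..n} \<Longrightarrow> X j (Y j v) = v" and Y_X: "j \<in> {1..n} \<Longrightarrow> Y j (X j v) = v"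
  unfolding X_def Y_def
  by (simp_all add: HR.rep_mult[symmetric] X_elem_unit HR.rep_one H.Units_closed)

lemma jucys_murphy_generators_carrier:
  "(\<Union>i\<in>{1..n}. {X_elem q n i, inv\<^bsub>affine_hecke q n\<^esub> (X_elem q n i)}) \<union>
    {c \<odot>\<^bsub>affine_hecke q n\<^esub> \<one>\<^bsub>affine_hecke q n\<^esub> | c. True} \<subseteq> carrier (affine_hecke q n)"
  using X_elem_unit by (auto intro: H.smult_closed H.Units_closed)

lemma jucys_murphy_carrier: "a \<in> jucys_murphy q n \<Longrightarrow> a \<in> carrier (affine_hecke q n)"
  unfolding jucys_murphy_def generated_subalgebra_def
  by (rule H.generate_ring_in_carrier[OF jucys_murphy_generators_carrier])

lemma jucys_murphy_intros:
  "j \<in> {1..n} \<Longrightarrow> X_elem q n j \<in> jucys_murphy q n"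
  "j \<in> {1..n} \<Longrightarrow> inv\<^bsub>affine_hecke q n\<^esub> (X_elem q n j) \<in> jucys_murphy q n"
  "c \<odot>\<^bsub>affine_hecke q n\<^esub> \<one>\<^bsub>affine_hecke q n\<^esub> \<in> jucys_murphy q n"
  "a \<in> jucys_murphy q n \<Longrightarrow> \<ominus>\<^bsub>affine_hecke q n\<^esub> a \<in> jucys_murphy q n"
  "a \<in> jucys_murphy q n \<Longrightarrow> b \<in> jucys_murphy q n \<Longrightarrow> a \<oplus>\<^bsub>affine_hecke q n\<^esub> b \<in> jucys_murphy q n"
  "a \<in> jucys_murphy q n \<Longrightarrow> b \<in> jucys_murphy q n \<Longrightarrow> a \<otimes>\<^bsub>affine_hecke q n\<^esub> b \<in> jucys_murphy q n"
  unfolding jucys_murphy_def generated_subalgebra_def by (blast intro: generate_ring.intros)+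

lemma jucys_murphy_induct [consumes 1, case_names X inv scalar uminus add mult]:
  assumes "a \<in> jucys_murphy q n"
    and "\<And>j. j \<in> {1..n} \<Longrightarrow> P (X_elem q n j)"
    and "\<And>j. j \<in> {1..n} \<Longrightarrow> P (inv\<^bsub>affine_hecke q n\<^esub> (X_elem q n j))"
    and scalar: "\<And>c. P (c \<odot>\<^bsub>affine_hecke q n\<^esub> \<one>\<^bsub>affine_hecke q n\<^esub>)"
    and "\<And>a. a \<in> jucys_murphy q n \<Longrightarrow> P a \<Longrightarrow> P (\<ominus>\<^bsub>affine_hecke q n\<^esub> a)"
    and "\<And>a b. a \<in> jucys_murphy q n \<Longrightarrow> b \<in> jucys_murphy q n \<Longrightarrow> P a \<Longrightarrow> P b \<Longrightarrow> P (a \<oplus>\<^bsub>affine_hecke q n\<^esub> b)"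
    and "\<And>a b. a \<in> jucys_murphy q n \<Longrightarrow> b \<in> jucys_murphy q n \<Longrightarrow> P a \<Longrightarrow> P b \<Longrightarrow> P (a \<otimes>\<^bsub>affine_hecke q n\<^esub> b)"
  shows "P a"
  using assms(1) unfolding jucys_murphy_def generated_subalgebra_def
proof (induction rule: generate_ring.induct)
  case one
  then show ?case using scalar[of 1] by (simp add: H.smult_one)
next
  case (incl h)
  then show ?case using assms(2-4) by blast
qed (use assms(5-7) in \<open>unfold jucys_murphy_def generated_subalgebra_def, blast+\<close>)

lemma jucys_murphy_commutes_X:
  assumes a: "a \<in> jucys_murphy q n" and j: "j \<in> {1..n}"
  shows "\<sigma> a (X j v) = X j (\<sigma> a v)"
  using a
proof (induction arbitrary: v rule: jucys_murphy_induct)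
  have X_X: "X i (X j v) = X j (X i v)" if i: "i \<in> {1..n}" for i v
    unfolding X_eq[OF i] X_eq[OF j] lin_scale[OF x_lin[OF i]] lin_scale[OF x_lin[OF j]] x_comm[OF i j]
    by (simp add: mult.commute)
  case (X i)
  then show ?case using X_X by (simp add: X_def)
next
  case (inv i)
  have X_X: "X i (X j v) = X j (X i v)" for v
    unfolding X_eq[OF inv] X_eq[OF j] lin_scale[OF x_lin[OF inv]] lin_scale[OF x_lin[OF j]] x_comm[OF inv j]
    by (simp add: mult.commute)
  have "Y i (X j (X i (Y i v))) = Y i (X i (X j (Y i v)))" unfolding X_X ..
  then show ?case unfolding X_Y[OF inv] Y_X[OF inv] unfolding Y_def .
next
  case (scalar c)
  then show ?case by (simp add: HR.rep_smult HR.rep_one lin_scale[OF X_lin[OF j]])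
next
  case (uminus a)
  then show ?case using lin_scale[OF X_lin[OF j], of "- 1"]
    by (simp add: HR.rep_uminus jucys_murphy_carrier scale_minus_left)
next
  case (add a b)
  then show ?case by (simp add: HR.rep_add jucys_murphy_carrier lin_add[OF X_lin[OF j]])
next
  case (mult a b)
  then show ?case by (simp add: HR.rep_mult jucys_murphy_carrier)
qed

text \<open>A complement of the eigenspace that is stable under \<open>X j\<close> contains no nonzero vector which
  \<open>X j - c\<close> maps into that eigenspace.\<close>

lemma calibrated_imp_X_semisimple:
  assumes cal: "calibrated q n scale \<sigma>" and j: "j \<in> {1..n}"
    and v: "X j (X j v - c *s v) = c *s (X j v - c *s v)"
  shows "X j v = c *s v"
proof -
  let ?F = "\<sigma> ` jucys_murphy q n"
  define K where "K = {v. X j v = c *s v}"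
  have "invariant_subspace scale ?F K"
    unfolding invariant_subspace_def
  proof (intro conjI ballI)
    show "subspace K" unfolding K_def by (rule subspace_ker[OF X_lin[OF j]])
    fix f assume "f \<in> ?F"
    then obtain a where a: "a \<in> jucys_murphy q n" "f = \<sigma> a" by blast
    show "f ` K \<subseteq> K"
      unfolding K_def a(2)
      using lin_scale[OF HR.rep_lin[OF jucys_murphy_carrier[OF a(1)]]]
      by (auto simp flip: jucys_murphy_commutes_X[OF a(1) j])
  qed
  from cal[unfolded calibrated_def acts_semisimply_def, rule_format, OF this]
  obtain U where U: "invariant_subspace scale ?F U" "K \<inter> U = {0}" "{k + u | k u. k \<in> K \<and> u \<in> U} = UNIV"
    by (elim exE conjE)
  have "v \<in> {k + u | k u. k \<in> K \<and> u \<in> U}" unfolding U(3) by (rule UNIV_I)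
  then obtain k u where ku: "v = k + u" "k \<in> K" "u \<in> U" by blast
  have subU: "subspace U" and XU: "X j ` U \<subseteq> U"
    using U(1) jucys_murphy_intros(1)[OF j] unfolding invariant_subspace_def X_def by blast+
  have "X j v - c *s v = X j u - c *s u"
    using ku(2) unfolding ku(1) K_def by (simp add: lin_add[OF X_lin[OF j]] scale_right_distrib)
  moreover have "X j u - c *s u \<in> U"
    using ku(3) XU subU by (intro subspace_diff subspace_scale) auto
  moreover have "X j v - c *s v \<in> K" using v by (simp add: K_def)
  ultimately have "X j v - c *s v \<in> K \<inter> U" by simp
  then show ?thesis unfolding U(2) by simp
qed

subsection \<open>Unitary representations are calibrated\<close>

text \<open>The Jucys--Murphy subalgebra is closed under adjoints: \<open>X\<^sub>j\<close> is unitary because \<open>x\<^sub>j\<close> and the factor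
  \<open>q\<^sup>1\<^sup>-\<^sup>j\<close> are. Hence orthogonal complements of invariant subspaces are invariant.\<close>

lemma unitary_imp_calibrated:
  assumes "unitary_rep (braid_group n) scale \<pi>"
  shows "calibrated q n scale \<sigma>"
proof -
  obtain h where pd: "pos_def_hermitian scale h"
    and inv: "\<And>g v w. g \<in> carrier (braid_group n) \<Longrightarrow> h (\<pi> g v) (\<pi> g w) = h v w"
    using assms unfolding unitary_rep_def by blast
  have herm: "hermitian h" and pos: "\<And>v. v \<noteq> 0 \<Longrightarrow> Re (h v v) > 0"
    using pd by (auto simp: pos_def_hermitian_iff)
  have X_pres: "h (X j v) (X j w) = h v w" if j: "j \<in> {1..n}" for j v w
  proof -
    let ?c = "q powi (1 - int j)"
    have "?c * cnj ?c = 1"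
      using complex_norm_square[of ?c] by (simp add: norm_power_int norm_q)
    moreover have "h (x j v) (x j w) = h v w"
      unfolding x_def op_def using inv braid_class_carrier[OF x_W[OF j]] .
    ultimately show ?thesis
      unfolding X_eq[OF j] herm_scale_left[OF herm] herm_scale_right[OF herm] by (simp add: mult.assoc[symmetric] mult.commute[of "cnj _ powi _"])
  qed
  have adjoint: "\<exists>b\<in>jucys_murphy q n. \<forall>v w. h (\<sigma> a v) w = h v (\<sigma> b w)" if "a \<in> jucys_murphy q n" for a
    using that
  proof (induction rule: jucys_murphy_induct)
    case (X j)
    have "h (X j v) w = h v (Y j w)" for v w
      using X_pres[OF X, of v "Y j w"] by (simp add: X_Y[OF X])
    then show ?case using jucys_murphy_intros(2)[OF X] unfolding X_def Y_def by blast
  next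
    case (inv j)
    have "h (Y j v) w = h v (X j w)" for v w
      using X_pres[OF inv, of "Y j v" w] by (simp add: X_Y[OF inv])
    then show ?case using jucys_murphy_intros(1)[OF inv] unfolding X_def Y_def by blast
  next
    case (scalar c)
    have "h (\<sigma> (c \<odot>\<^bsub>affine_hecke q n\<^esub> \<one>\<^bsub>affine_hecke q n\<^esub>) v) w
        = h v (\<sigma> (cnj c \<odot>\<^bsub>affine_hecke q n\<^esub> \<one>\<^bsub>affine_hecke q n\<^esub>) w)" for v w
      by (simp add: HR.rep_smult HR.rep_one herm_scale_left[OF herm] herm_scale_right[OF herm])
    then show ?case using jucys_murphy_intros(3) by blast
  next
    case (uminus a)
    then obtain b where b: "b \<in> jucys_murphy q n" "\<And>v w. h (\<sigma> a v) w = h v (\<sigma> b w)" by blast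
    have "h (- v) w = - h v w" "h v (- w) = - h v w" for v w
      using herm_scale_left[OF herm, of "- 1"] herm_scale_right[OF herm, of _ "- 1"] by (simp_all add: scale_minus_left)
    then have "h (\<sigma> (\<ominus>\<^bsub>affine_hecke q n\<^esub> a) v) w = h v (\<sigma> (\<ominus>\<^bsub>affine_hecke q n\<^esub> b) w)" for v w
      using uminus.hyps b by (simp add: HR.rep_uminus jucys_murphy_carrier)
    then show ?case using jucys_murphy_intros(4)[OF b(1)] by blast
  next
    case (add a a')
    then obtain b b' where b: "b \<in> jucys_murphy q n" "\<And>v w. h (\<sigma> a v) w = h v (\<sigma> b w)"
      "b' \<in> jucys_murphy q n" "\<And>v w. h (\<sigma> a' v) w = h v (\<sigma> b' w)" by blast
    have "h (\<sigma> (a \<oplus>\<^bsub>affine_hecke q n\<^esub> a') v) w = h v (\<sigma> (b \<oplus>\<^bsub>affine_hecke q n\<^esub> b') w)" for v w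
      using add.hyps b
      by (simp add: HR.rep_add jucys_murphy_carrier herm_add_left[OF herm] herm_add_right[OF herm])
    then show ?case using jucys_murphy_intros(5)[OF b(1,3)] by blast
  next
    case (mult a a')
    then obtain b b' where b: "b \<in> jucys_murphy q n" "\<And>v w. h (\<sigma> a v) w = h v (\<sigma> b w)"
      "b' \<in> jucys_murphy q n" "\<And>v w. h (\<sigma> a' v) w = h v (\<sigma> b' w)" by blast
    have "h (\<sigma> (a \<otimes>\<^bsub>affine_hecke q n\<^esub> a') v) w = h v (\<sigma> (b' \<otimes>\<^bsub>affine_hecke q n\<^esub> b) w)" for v w
      using mult.hyps b by (simp add: HR.rep_mult jucys_murphy_carrier)
    then show ?case using jucys_murphy_intros(6)[OF b(3,1)] by blast
  qed
  show ?thesis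
    unfolding calibrated_def acts_semisimply_def
  proof (intro allI impI)
    fix Z assume Z: "invariant_subspace scale (\<sigma> ` jucys_murphy q n) Z"
    define U where "U = {u. \<forall>z\<in>Z. h u z = 0}"
    have subZ: "subspace Z" using Z by (simp add: invariant_subspace_def)
    have subU: "subspace U" unfolding U_def by (rule subspace_orthogonal[OF herm])
    have "\<sigma> a u \<in> U" if a: "a \<in> jucys_murphy q n" and u: "u \<in> U" for a u
    proof -
      obtain b where b: "b \<in> jucys_murphy q n" "\<forall>v w. h (\<sigma> a v) w = h v (\<sigma> b w)" using adjoint[OF a] by blast
      have "\<sigma> b z \<in> Z" if "z \<in> Z" for z using Z b(1) that unfolding invariant_subspace_def by blast
      then show ?thesis using b(2) u by (simp add: U_def)
    qed
    then have "invariant_subspace scale (\<sigma> ` jucys_murphy q n) U"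
      using subU unfolding invariant_subspace_def by blast
    moreover have "Z \<inter> U = {0}"
      using pos subspace_0[OF subZ] subspace_0[OF subU] unfolding U_def by fastforce
    moreover have "{z + u | z u. z \<in> Z \<and> u \<in> U} = UNIV"
    proof -
      obtain S where S: "independent S" "span S = Z"
        using basis_subspace_exists[OF subZ] by metis
      have "v \<in> {z + u | z u. z \<in> Z \<and> u \<in> U}" for v
      proof -
        have nz: "h v v \<noteq> 0" if "v \<noteq> 0" for v using pos[OF that] by auto
        obtain z where z: "z \<in> span S" "\<forall>s\<in>span S. h (v - z) s = 0"
          using orthogonal_projection_exists[OF herm nz finiteI_independent[OF S(1)]] by blast
        have "v = z + (v - z)" by simp
        moreover have "v - z \<in> U" using z(2) S(2) by (simp add: U_def)
        ultimately show ?thesis using z(1) S(2) by blast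
      qed
      then show ?thesis by blast
    qed
    ultimately show "\<exists>U. invariant_subspace scale (\<sigma> ` jucys_murphy q n) U \<and> Z \<inter> U = {0} \<and>
        {z + u | z u. z \<in> Z \<and> u \<in> U} = UNIV" by blast
  qed
qed

subsection \<open>Completely reducible calibrated representations are unitary\<close>

lemma preserves_op:
  assumes T: "\<And>i. i \<in> {1..<n} \<Longrightarrow> preserves h (T i)" and x: "\<And>j. j \<in> {1..n} \<Longrightarrow> preserves h (x j)" and w: "w \<in> W"
  shows "preserves h (op w)"
  using w
proof (induction w)
  case Nil
  then show ?case by (simp add: preserves_def op_Nil)
next
  case (Cons l w)
  obtain g b where l: "l = (g, b)" by fastforce
  have gb: "[(g, b)] \<in> W" and w: "w \<in> W" using Cons.prems l by (auto simp: words_def)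
  have "[(g, True)] \<in> W" and gF: "[(g, False)] \<in> W" using gb by (auto simp: words_def)
  have pos: "preserves h (op [(g, True)])"
  proof (cases g)
    case (TGen i)
    then have "i \<in> {1..<n}" using gb by (auto simp: words_def braid_gens_def)
    then show ?thesis using T TGen by (simp add: T_def T_word_def)
  next
    case (XGen j)
    then have "j \<in> {1..n}" using gb by (auto simp: words_def braid_gens_def)
    then show ?thesis using x XGen by (simp add: x_def x_word_def)
  qed
  have "preserves h (op [(g, b)])"
  proof (cases b)
    case True
    then show ?thesis using pos by simp
  next
    case False
    have cancel: "op [(g, True)] (op [(g, False)] v) = v" for v
      using op_cancel[OF \<open>[(g, True)] \<in> W\<close>] by simp
    have "h (op [(g, False)] v) (op [(g, False)] w) = h v w" for v w
      using pos[unfolded preserves_def, rule_format, of "op [(g, False)] v" "op [(g, False)] w"]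
      unfolding cancel ..
    then show ?thesis using False by (simp add: preserves_def)
  qed
  moreover have "op (l # w) v = op [(g, b)] (op w v)" for v
    using op_append[OF gb w] l by simp
  ultimately show ?case
    using Cons.IH[OF w] by (simp add: preserves_def)
qed

lemma calibrated_imp_unitary:
  assumes cr: "completely_reducible (cyclotomic_hecke q Qs n) scale \<rho>" and cal: "calibrated q n scale \<sigma>"
  shows "unitary_rep (braid_group n) scale \<pi>"
proof -
  interpret M: calibrated_module scale Basis n q T X e
    using calibrated_imp_X_semisimple[OF cal] by (rule calibrated_moduleI)
  have sub_iff: "M.submodule Z \<longleftrightarrow> invariant_subspace scale (\<rho> ` carrier (cyclotomic_hecke q Qs n)) Z" for Z
    unfolding M.submodule_def invariant_subspace_iff ..
  obtain h where h: "pos_def_hermitian scale h" "\<And>i. i \<in> {1..<n} \<Longrightarrow> preserves h (T i)"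
      "\<And>j. j \<in> {1..n} \<Longrightarrow> preserves h (X j)"
    using M.invariant_inner_product_exists cr
    unfolding sub_iff completely_reducible_def acts_semisimply_def by blast
  have herm: "hermitian h" using h(1) by (simp add: pos_def_hermitian_iff)
  have "preserves h (x j)" if j: "j \<in> {1..n}" for j
  proof -
    let ?c = "q powi (int j - 1)"
    have "?c * cnj ?c = 1"
      using complex_norm_square[of ?c] by (simp add: norm_power_int norm_q)
    then show ?thesis
      using h(3)[OF j] unfolding preserves_def x_eq[OF j] herm_scale_left[OF herm] herm_scale_right[OF herm]
      by (simp add: mult.assoc[symmetric] mult.commute[of "cnj _ powi _"])
  qed
  then have "preserves h (op w)" if "w \<in> W" for w
    using preserves_op h(2) that by blast
  then have "h (\<pi> g v) (\<pi> g w) = h v w" if "g \<in> carrier (braid_group n)" for g v w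
    using that unfolding braid_group_def in_presented_group_iff[OF braid_relations_words]
    unfolding op_def braid_class_def preserves_def by blast
  then show ?thesis using h(1) unfolding unitary_rep_def by blast
qed

end

theorem theoremA:
  fixes e :: int and n :: nat and s :: "int list"
    and q :: complex and Qs :: "complex list"
    and scale :: "complex \<Rightarrow> 'v::ab_group_add \<Rightarrow> 'v" and Basis :: "'v set"
    and \<rho> :: "braid_alg set set \<Rightarrow> 'v \<Rightarrow> 'v"
  assumes "e > 1" and "n \<ge> 1"
    and "q = exp (2 * of_real pi * \<i> / of_int e)"
    and "Qs = map (\<lambda>k. q powi k) s"
    and "finite_dimensional_vector_space scale Basis"
    and "algebra_representation (cyclotomic_hecke q Qs n) scale \<rho>"
  shows "(unitary_rep (braid_group n) scale (to_braid_rep q n (to_affine_rep q Qs n \<rho>)) \<longrightarrow>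
            calibrated q n scale (to_affine_rep q Qs n \<rho>)) \<and>
         (completely_reducible (cyclotomic_hecke q Qs n) scale \<rho> \<longrightarrow>
            (unitary_rep (braid_group n) scale (to_braid_rep q n (to_affine_rep q Qs n \<rho>)) \<longleftrightarrow>
             calibrated q n scale (to_affine_rep q Qs n \<rho>)))"
proof -
  interpret cyclotomic_rep scale Basis e n s q Qs \<rho>
    using assms by (intro cyclotomic_rep.intro complex_space.intro cyclotomic_rep_axioms.intro)
  show ?thesis using unitary_imp_calibrated calibrated_imp_unitary by blast
qed

end
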